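(* Let $\ell(y;a)=-(y-a)^2/2$, $m>(3+\sqrt5)/4\approx1.309$ and $h\asymp n^{-d}$ for some $\frac1{2m+1}\le d<\frac{2m}{8m-1}$. Suppose that there exist functions $h_\nu\in\mathcal H$, $\nu\in\mathbb N=\{0,1,2,\dots\}$, with $\sup_\nu\|h_\nu\|_{\sup}<\infty$, and a nondecreasing sequence $\gamma_\nu\asymp\nu^{2m}$, such that $V(h_\mu,h_\nu)=\delta_{\mu\nu}$ and $J(h_\mu,h_\nu)=\gamma_\mu\delta_{\mu\nu}$ for all $\mu,\nu$, and every $g\in\mathcal H$ admits the expansion $g=\sum_\nu V(g,h_\nu)h_\nu$ with convergence in $\|\cdot\|$. Fix $\zeta>0$ and $g_0\in\mathcal H$, and let $$\mathcal G_a=\{g\in\mathcal H:\ \mathrm{Var}(g(Z)^2)\le\zeta E^2\{g(Z)^2\},\ J(g,g)\le\zeta\}.$$ Suppose that, uniformly over $g_n\in\mathcal G_a$, $\|\widehat g_{n,\lambda}-g_{n0}\|=O_P(r_n)$ holds under $H_{1n}:g=g_{n0}$, where $g_{n0}=g_0+g_n$ and $r_n=(nh)^{-1/2}+h^m$; that is, for any $\widetilde\delta>0$ there exist constants $\widetilde C$ and $\widetilde N$, both not depending on $g_n\in\mathcal G_a$, such that $\inf_{n\ge\widetilde N}\inf_{g_n\in\mathcal G_a}P_{g_{n0}}(\|\widehat g_{n,\lambda}-g_{n0}\|\le\widetilde Cr_n)\ge1-\widetilde\delta$. Then for any $\delta\in(0,1)$ there exist positive constants $C$ and $N$ such that $$\inf_{n\ge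 N}\ \inf_{g_n\in\mathcal G_a,\ \|g_n\|\ge C\eta_n}P\big(\text{reject }H_0^{\mathrm{global}}\mid H_{1n}\text{ is true}\big)\ge1-\delta,$$ where $\eta_n\ge\sqrt{h^{2m}+(nh^{1/2})^{-1}}$ and rejection refers to the penalized likelihood ratio test. The minimal lower bound of $\eta_n$, i.e. $n^{-2m/(4m+1)}$, is achieved when $h=h^{**}\equiv n^{-2/(4m+1)}$.
   Context: Data: $(Y_i,Z_i)$, $i=1,\dots,n$, are i.i.d. copies of $(Y,Z)$ with $Y=g(Z)+\epsilon$, $Z\in\mathbb I=[0,1]$, $g\in\mathcal H$, where $E(\epsilon\mid Z)=0$, $E(\epsilon^2\mid Z)=1$ and $E(\epsilon^4\mid Z)$ is bounded by a constant a.s.; $P_g$ denotes the law when $g$ is the true regression function. $\mathcal H$ is either the Sobolev space $H^m(\mathbb I)=\{g:\mathbb I\to\mathbb R: g^{(j)}$ absolutely continuous for $j=0,\dots,m-1$, $g^{(m)}\in L_2(\mathbb I)\}$ or its periodic subspace $H^m_0(\mathbb I)$ of those $g$ with $g^{(j)}(0)=g^{(j)}(1)$, $j=0,\dots,m-1$. $J(g,\widetilde g)=\int_{\mathbb I}g^{(m)}(z)\widetilde g^{(m)}(z)\,dz$. The penalized estimate $\widehat g_{n,\lambda}$ maximizes $\ell_{n,\lambda}(g)=\frac1n\sum_{i=1}^n\ell(Y_i;g(Z_i))-(\lambda/2)J(g,g)$ over $g\in\mathcal H$; $\lambda=\lambda_n>0$, $h=\lambda^{1/(2m)}$. $V(g,\widetilde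 g)=E\{g(Z)\widetilde g(Z)\}$; $\langle g,\widetilde g\rangle=V(g,\widetilde g)+\lambda J(g,\widetilde g)$, $\|g\|^2=\langle g,g\rangle$. $W_\lambda:\mathcal H\to\mathcal H$ is the self-adjoint operator with $\langle W_\lambda g,\widetilde g\rangle=\lambda J(g,\widetilde g)$. $\|g\|_{\sup}=\sup_{z\in\mathbb I}|g(z)|$. For positive sequences, $a_\mu\asymp b_\mu$ means $\lim a_\mu/b_\mu=c$ for some $c\in(0,\infty)$. $\delta_{\mu\nu}$ is Kronecker's delta. Test: $H_0^{\mathrm{global}}:g=g_0$; local alternatives $H_{1n}:g=g_{n0}=g_0+g_n$ with $g_n\in\mathcal G_a$. Let $\mathrm{PLRT}_{n,\lambda}=\ell_{n,\lambda}(g_0)-\ell_{n,\lambda}(\widehat g_{n,\lambda})$, $\sigma_K^2=\sum_\nu h/(1+\lambda\gamma_\nu)$, $\rho_K^2=\sum_\nu h/(1+\lambda\gamma_\nu)^2$, $r_K=\sigma_K^2/\rho_K^2$, $u_n=h^{-1}\sigma_K^4/\rho_K^2$. The penalized likelihood ratio test at a fixed significance level $\alpha\in(0,1)$ rejects $H_0^{\mathrm{global}}$ when $(2u_n)^{-1/2}(-2nr_K\,\mathrm{PLRT}_{n,\lambda}-nr_K\|W_\lambda g_0\|^2-u_n)$ (asymptotically $N(0,1)$ under $H_0^{\mathrm{global}}$) exceeds the upper $\alpha$ quantile of $N(0,1)$. *)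

theory Defs
  imports "HOL-Probability.Probability"
begin

section \<open>Sobolev spaces on the unit interval\<close>

text \<open>
  Functions on the unit interval are represented by functions on \<^typ>\<open>real\<close> whose values
  outside \<open>{0..1}\<close> are never used: derivatives are taken within \<open>{0..1}\<close>, hence are one-sided
  at the end points.
\<close>

definition sderiv :: "nat \<Rightarrow> (real \<Rightarrow> real) \<Rightarrow> real \<Rightarrow> real" where
  "sderiv j = ((\<lambda>f x. vector_derivative f (at x within {0..1})) ^^ j)"

definition abs_cont_on :: "real \<Rightarrow> real \<Rightarrow> (real \<Rightarrow> real) \<Rightarrow> bool" where
  "abs_cont_on a b f \<longleftrightarrow>
     (\<forall>\<epsilon>>0. \<exists>\<delta>>0. \<forall>D T. D division_of T \<and> T \<subseteq> {a..b} \<and> (\<Sum>K\<in>D. Sup K - Inf K) < \<delta> \<longrightarrow>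
        (\<Sum>K\<in>D. \<bar>f (Sup K) - f (Inf K)\<bar>) < \<epsilon>)"

text \<open>
  \<^const>\<open>vector_derivative\<close> returns an arbitrary value where the derivative does not exist, so
  existence is spelled out: everywhere for the derivatives of order less than \<open>m\<close>, almost
  everywhere for the one of order \<open>m\<close> (the latter is automatic, since an absolutely continuous
  function is differentiable almost everywhere).
\<close>

definition sobolev :: "nat \<Rightarrow> (real \<Rightarrow> real) set" where
  "sobolev m = {g.
     (\<forall>j<m. abs_cont_on 0 1 (sderiv j g)) \<and>
     (\<forall>j. Suc j < m \<longrightarrow> (\<forall>x\<in>{0..1}. sderiv j g differentiable (at x within {0..1}))) \<and>
     (AE x in lebesgue_on {0..1}. sderiv (m - 1) g differentiable (at x within {0..1})) \<and>
     sderiv m g \<in> borel_measurable (lebesgue_on {0..1}) \<and>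
     integrable (lebesgue_on {0..1}) (\<lambda>x. (sderiv m g x)\<^sup>2)}"

definition sobolev_periodic :: "nat \<Rightarrow> (real \<Rightarrow> real) set" where
  "sobolev_periodic m = {g \<in> sobolev m. \<forall>j<m. sderiv j g 0 = sderiv j g 1}"

definition penJ :: "nat \<Rightarrow> (real \<Rightarrow> real) \<Rightarrow> (real \<Rightarrow> real) \<Rightarrow> real" where
  "penJ m g g' = (\<integral>z. sderiv m g z * sderiv m g' z \<partial>lebesgue_on {0..1})"


section \<open>The regression model\<close>

text \<open>
  \<open>(Z, e)\<close> is the generic covariate/noise pair and \<open>(Zs i, es i)\<close>, \<open>i \<ge> 1\<close>, are its i.i.d. copies.
  The law of \<open>(Z, e)\<close> does not depend on the regression function \<open>g\<close>; the law indexed by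
  \<open>g\<close> is that of the sample \<open>(response Zs es g i, Zs i)\<close>, \<open>i = 1, \<dots>, n\<close>.
\<close>

locale regression_model = prob_space M
  for M :: "'w measure" and Z e :: "'w \<Rightarrow> real" and Zs es :: "nat \<Rightarrow> 'w \<Rightarrow> real" +
  assumes Z_measurable: "Z \<in> borel_measurable M"
    and e_measurable: "e \<in> borel_measurable M"
    and Z_unit: "\<And>\<omega>. \<omega> \<in> space M \<Longrightarrow> Z \<omega> \<in> {0..1}"
    and Zs_unit: "\<And>i \<omega>. i \<ge> 1 \<Longrightarrow> \<omega> \<in> space M \<Longrightarrow> Zs i \<omega> \<in> {0..1}"
    and indep: "indep_vars (\<lambda>_. borel) (\<lambda>i \<omega>. (Zs i \<omega>, es i \<omega>)) {1..}"
    and ident: "\<And>i. i \<ge> 1 \<Longrightarrow>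
      distr M borel (\<lambda>\<omega>. (Zs i \<omega>, es i \<omega>)) = distr M borel (\<lambda>\<omega>. (Z \<omega>, e \<omega>))"
    and e4_integrable: "integrable M (\<lambda>\<omega>. e \<omega> ^ 4)"
    and cond_mean: "AE \<omega> in M. real_cond_exp M (vimage_algebra (space M) Z borel) e \<omega> = 0"
    and cond_var: "AE \<omega> in M.
      real_cond_exp M (vimage_algebra (space M) Z borel) (\<lambda>\<omega>. e \<omega> ^ 2) \<omega> = 1"
    and cond_fourth: "\<exists>c. AE \<omega> in M.
      real_cond_exp M (vimage_algebra (space M) Z borel) (\<lambda>\<omega>. e \<omega> ^ 4) \<omega> \<le> c"

definition response ::
    "(nat \<Rightarrow> 'w \<Rightarrow> real) \<Rightarrow> (nat \<Rightarrow> 'w \<Rightarrow> real) \<Rightarrow> (real \<Rightarrow> real) \<Rightarrow> nat \<Rightarrow> 'w \<Rightarrow> real" where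
  "response Zs es g i \<omega> = g (Zs i \<omega>) + es i \<omega>"

definition covV :: "'w measure \<Rightarrow> ('w \<Rightarrow> real) \<Rightarrow> (real \<Rightarrow> real) \<Rightarrow> (real \<Rightarrow> real) \<Rightarrow> real" where
  "covV M Z g g' = (\<integral>\<omega>. g (Z \<omega>) * g' (Z \<omega>) \<partial>M)"

definition pen_inner ::
    "'w measure \<Rightarrow> ('w \<Rightarrow> real) \<Rightarrow> nat \<Rightarrow> real \<Rightarrow> (real \<Rightarrow> real) \<Rightarrow> (real \<Rightarrow> real) \<Rightarrow> real" where
  "pen_inner M Z m lam g g' = covV M Z g g' + lam * penJ m g g'"

definition pen_norm ::
    "'w measure \<Rightarrow> ('w \<Rightarrow> real) \<Rightarrow> nat \<Rightarrow> real \<Rightarrow> (real \<Rightarrow> real) \<Rightarrow> real" where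
  "pen_norm M Z m lam g = sqrt (pen_inner M Z m lam g g)"

definition is_penalty_operator ::
    "'w measure \<Rightarrow> ('w \<Rightarrow> real) \<Rightarrow> nat \<Rightarrow> (real \<Rightarrow> real) set \<Rightarrow> real \<Rightarrow>
      ((real \<Rightarrow> real) \<Rightarrow> real \<Rightarrow> real) \<Rightarrow> bool" where
  "is_penalty_operator M Z m H lam W \<longleftrightarrow>
     (\<forall>g\<in>H. W g \<in> H) \<and>
     (\<forall>g\<in>H. \<forall>g'\<in>H. pen_inner M Z m lam (W g) g' = pen_inner M Z m lam g (W g')) \<and>
     (\<forall>g\<in>H. \<forall>g'\<in>H. pen_inner M Z m lam (W g) g' = lam * penJ m g g')"

definition alternatives ::
    "'w measure \<Rightarrow> ('w \<Rightarrow> real) \<Rightarrow> nat \<Rightarrow> (real \<Rightarrow> real) set \<Rightarrow> real \<Rightarrow> (real \<Rightarrow> real) set" where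
  "alternatives M Z m H \<zeta> = {g \<in> H.
     prob_space.variance M (\<lambda>\<omega>. (g (Z \<omega>))\<^sup>2) \<le> \<zeta> * (\<integral>\<omega>. (g (Z \<omega>))\<^sup>2 \<partial>M)\<^sup>2 \<and>
     penJ m g g \<le> \<zeta>}"


section \<open>Penalized likelihood ratio test\<close>

definition loglik :: "real \<Rightarrow> real \<Rightarrow> real" where
  "loglik y a = - (y - a)\<^sup>2 / 2"

definition pen_loglik ::
    "nat \<Rightarrow> real \<Rightarrow> nat \<Rightarrow> (nat \<Rightarrow> real) \<Rightarrow> (nat \<Rightarrow> real) \<Rightarrow> (real \<Rightarrow> real) \<Rightarrow> real" where
  "pen_loglik m lam n z y g =
     (1 / real n) * (\<Sum>i=1..n. loglik (y i) (g (z i))) - (lam / 2) * penJ m g g"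

definition bandwidth :: "nat \<Rightarrow> real \<Rightarrow> real" where
  "bandwidth m lam = lam powr (1 / (2 * real m))"

definition sigmaK2 :: "nat \<Rightarrow> real \<Rightarrow> (nat \<Rightarrow> real) \<Rightarrow> real" where
  "sigmaK2 m lam \<gamma> = (\<Sum>\<nu>. bandwidth m lam / (1 + lam * \<gamma> \<nu>))"

definition rhoK2 :: "nat \<Rightarrow> real \<Rightarrow> (nat \<Rightarrow> real) \<Rightarrow> real" where
  "rhoK2 m lam \<gamma> = (\<Sum>\<nu>. bandwidth m lam / (1 + lam * \<gamma> \<nu>)\<^sup>2)"

definition rK :: "nat \<Rightarrow> real \<Rightarrow> (nat \<Rightarrow> real) \<Rightarrow> real" where
  "rK m lam \<gamma> = sigmaK2 m lam \<gamma> / rhoK2 m lam \<gamma>"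

definition uK :: "nat \<Rightarrow> real \<Rightarrow> (nat \<Rightarrow> real) \<Rightarrow> real" where
  "uK m lam \<gamma> = (1 / bandwidth m lam) * (sigmaK2 m lam \<gamma>)\<^sup>2 / rhoK2 m lam \<gamma>"

definition plrt ::
    "nat \<Rightarrow> real \<Rightarrow> nat \<Rightarrow> (nat \<Rightarrow> real) \<Rightarrow> (nat \<Rightarrow> real) \<Rightarrow> (real \<Rightarrow> real) \<Rightarrow> (real \<Rightarrow> real) \<Rightarrow> real" where
  "plrt m lam n z y g0 gh = pen_loglik m lam n z y g0 - pen_loglik m lam n z y gh"

text \<open>Here \<open>W0\<close> stands for the image of \<open>g0\<close> under the penalty operator and \<open>gh\<close> for the
  penalized estimate.\<close>

definition plrt_statistic ::
    "'w measure \<Rightarrow> ('w \<Rightarrow> real) \<Rightarrow> nat \<Rightarrow> real \<Rightarrow> (nat \<Rightarrow> real) \<Rightarrow> nat \<Rightarrow>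
      (nat \<Rightarrow> real) \<Rightarrow> (nat \<Rightarrow> real) \<Rightarrow>
      (real \<Rightarrow> real) \<Rightarrow> (real \<Rightarrow> real) \<Rightarrow> (real \<Rightarrow> real) \<Rightarrow> real" where
  "plrt_statistic M Z m lam \<gamma> n z y g0 W0 gh =
     (2 * uK m lam \<gamma>) powr (- 1 / 2) *
     (- 2 * real n * rK m lam \<gamma> * plrt m lam n z y g0 gh
      - real n * rK m lam \<gamma> * (pen_norm M Z m lam W0)\<^sup>2
      - uK m lam \<gamma>)"

definition upper_normal_quantile :: "real \<Rightarrow> real" where
  "upper_normal_quantile \<alpha> = (THE x. measure std_normal_distribution {x<..} = \<alpha>)"


section \<open>Rates\<close>

text \<open>Convergence of the ratio to a positive constant; this is stronger than membership in
  \<open>\<Theta>\<close> from \<^theory>\<open>HOL-Library.Landau_Symbols\<close>.\<close>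

definition same_order :: "(nat \<Rightarrow> real) \<Rightarrow> (nat \<Rightarrow> real) \<Rightarrow> bool" where
  "same_order a b \<longleftrightarrow> (\<exists>c>0. (\<lambda>n. a n / b n) \<longlonglongrightarrow> c)"

definition est_rate :: "nat \<Rightarrow> nat \<Rightarrow> real \<Rightarrow> real" where
  "est_rate m n h = (real n * h) powr (- 1 / 2) + h ^ m"

definition separation_bound :: "nat \<Rightarrow> nat \<Rightarrow> real \<Rightarrow> real" where
  "separation_bound m n h = sqrt (h ^ (2 * m) + 1 / (real n * h powr (1 / 2)))"

definition minimax_rate :: "nat \<Rightarrow> nat \<Rightarrow> real" where
  "minimax_rate m n = real n powr (- 2 * real m / (4 * real m + 1))"

definition optimal_bandwidth :: "nat \<Rightarrow> nat \<Rightarrow> real" where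
  "optimal_bandwidth m n = real n powr (- 2 / (4 * real m + 1))"

end

theory Submission
  imports Defs "HOL-Real_Asymp.Real_Asymp"
begin

text \<open>
  The statistic depends on the estimate only through the maximum of the penalized likelihood, and a
  large maximum means rejection. So it is enough to exhibit one function in \<open>H\<close> whose penalized
  likelihood exceeds that of \<open>g0\<close> sufficiently.

  Let \<open>w \<nu> = 1 / (1 + lam * \<gamma> \<nu>)\<close>. After cancellation of the normalizing factors
  (\<open>plrt_statistic_standardized\<close>) the test rejects when \<open>2 * n\<close> times the likelihood gain over \<open>g0\<close>,
  diminished by \<open>n\<close> times the squared norm of \<open>W g0\<close>, exceeds \<open>\<Sum> w\<close> by more than the quantile times
  \<open>sqrt (2 * \<Sum> w\<^sup>2)\<close>. As
  \<open>\<Sum> w = O(1 / h)\<close> (\<open>smoothing_weights_bound\<close>), an excess of order \<open>h powr (- 1 / 2)\<close> suffices, but the leading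
  term \<open>\<Sum> w\<close>, which is larger, has to be reproduced exactly. A candidate that does this is
  \<open>g0 + g + S\<close>, where \<open>g0 + g\<close> is the true regression function and \<open>S\<close> is a truncated linear smooth of the
  noise, \<open>S = \<Sum>\<nu><k. w \<nu> * a \<nu> * hf \<nu>\<close> with \<open>a \<nu> = (\<Sum>i=1..n. es i * hf \<nu> (Zs i)) / n\<close>. Its gain,
  times \<open>2 * n\<close>, is bounded below by a combination of the following terms (\<open>loglik_gain\<close>).

  \<^item> The noise energy \<open>U = n * \<Sum> w * a\<^sup>2\<close>. It has mean \<open>\<Sum> w\<close> up to truncation and standard deviation
    of order \<open>h powr (- 1 / 2)\<close> (\<open>weighted_noise_energy_variance\<close>).

  \<^item> The error from the empirical Gram matrix of the \<open>hf \<nu>\<close>, of order \<open>1 / (sqrt n * h\<^sup>2)\<close>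
    (\<open>gram_deviation_moment\<close>). The upper bound on \<open>d\<close> gives \<open>d < 1 / 3\<close>, so \<open>n * h ^ 3 \<ge> 1\<close> for large \<open>n\<close>
    and this error is at most of the order of the fluctuation of \<open>U\<close>.

  \<^item> The signal \<open>\<Sum>i=1..n. (g (Zs i))\<^sup>2\<close>, which by the bound on the variance of \<open>(g Z)\<^sup>2\<close> is at least half of
    its mean \<open>n * V(g, g)\<close> with high probability, and a cross term of noise and signal of the smaller
    order \<open>sqrt (n * V(g, g))\<close>.

  \<^item> Penalty terms of order \<open>n * lam = n * h ^ (2 * m)\<close>, bounded through \<open>J(g, g) \<le> \<zeta>\<close>; \<open>n\<close> times the
    squared norm of \<open>W g0\<close> is of this order too (\<open>penalty_operator_norm_le\<close>).

  If \<open>\<parallel>g\<parallel> \<ge> C * \<eta>\<close>, then \<open>n * V(g, g)\<close> is at least a large multiple of \<open>n * lam + h powr (- 1 / 2)\<close> and dominates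
  all losses (\<open>plrt_power\<close>). The constants depend on \<open>g\<close> only through \<open>\<zeta>\<close>, which gives the uniformity.
\<close>


section \<open>Linear combinations of Sobolev functions\<close>

text \<open>
  The combination is assumed to agree with \<open>k\<close> only on \<open>{0..1}\<close>: this is all that is known about
  an iterated derivative of a linear combination, and all that a derivative within \<open>{0..1}\<close> sees.
\<close>

lemma vector_derivative_unit_lincomb:
  fixes f g k :: "real \<Rightarrow> real"
  assumes x: "x \<in> {0..1}"
    and f: "f differentiable (at x within {0..1})" and g: "g differentiable (at x within {0..1})"
    and k: "\<And>t. t \<in> {0..1} \<Longrightarrow> k t = a * f t + b * g t"
  shows "k differentiable (at x within {0..1})"
    and "vector_derivative k (at x within {0..1}) =
      a * vector_derivative f (at x within {0..1}) + b * vector_derivative g (at x within {0..1})"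
proof -
  let ?F = "at x within {0..1::real}"
  have "((\<lambda>t. a * f t + b * g t) has_vector_derivative
      (a * vector_derivative f ?F + b * vector_derivative g ?F)) ?F"
    using f g unfolding vector_derivative_works
    by (intro has_vector_derivative_add has_vector_derivative_mult_right)
  then have D: "(k has_vector_derivative (a * vector_derivative f ?F + b * vector_derivative g ?F)) ?F"
    using x k by (rule_tac has_vector_derivative_transform[where f = "\<lambda>t. a * f t + b * g t"]) auto
  then show "k differentiable ?F"
    by (auto simp: has_vector_derivative_def differentiable_def)
  show "vector_derivative k ?F = a * vector_derivative f ?F + b * vector_derivative g ?F"
    using vector_derivative_within_closed_interval[OF _ _ D] x by auto
qed

lemma sderiv_0: "sderiv 0 f = f"
  by (simp add: sderiv_def)

lemma sderiv_Suc: "sderiv (Suc j) f x = vector_derivative (sderiv j f) (at x within {0..1})"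
  by (simp add: sderiv_def)

lemma sderiv_lincomb:
  assumes "f \<in> sobolev m" "g \<in> sobolev m" "j < m" "x \<in> {0..1}"
  shows "sderiv j (\<lambda>x. a * f x + b * g x) x = a * sderiv j f x + b * sderiv j g x"
  using assms(3,4)
proof (induction j arbitrary: x)
  case 0
  then show ?case by (simp add: sderiv_0)
next
  case (Suc j)
  show ?case
    unfolding sderiv_Suc
    by (rule vector_derivative_unit_lincomb(2)) (use Suc assms(1,2) in \<open>auto simp: sobolev_def\<close>)
qed

text \<open>
  The derivative of order \<open>m\<close> exists almost everywhere only, so its linearity fails on a null set,
  where \<^const>\<open>vector_derivative\<close> takes default values.
\<close>

lemma sderiv_top_lincomb:
  assumes m: "m \<ge> 1" and f: "f \<in> sobolev m" and g: "g \<in> sobolev m"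
  shows "AE x in lebesgue_on {0..1}.
           sderiv (m - 1) (\<lambda>x. a * f x + b * g x) differentiable (at x within {0..1}) \<and>
           sderiv m (\<lambda>x. a * f x + b * g x) x = a * sderiv m f x + b * sderiv m g x"
proof -
  have fd: "AE x in lebesgue_on {0..1}. sderiv (m - 1) f differentiable (at x within {0..1})"
    and gd: "AE x in lebesgue_on {0..1}. sderiv (m - 1) g differentiable (at x within {0..1})"
    using f g by (auto simp: sobolev_def)
  have sp: "AE x in lebesgue_on {0..1}. x \<in> {0..1::real}"
    using AE_space[of "lebesgue_on {0..1::real}"] by simp
  have m': "m = Suc (m - 1)" using m by simp
  show ?thesis
    using fd gd sp
  proof eventually_elim
    case (elim x)
    note L = vector_derivative_unit_lincomb[OF elim(3,1,2), where a = a and b = b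
        and k = "sderiv (m - 1) (\<lambda>x. a * f x + b * g x)"]
    have k: "sderiv (m - 1) (\<lambda>x. a * f x + b * g x) t = a * sderiv (m-1) f t + b * sderiv (m-1) g t"
      if "t \<in> {0..1}" for t
      using sderiv_lincomb[OF f g _ that] m by simp
    have "sderiv m (\<lambda>x. a * f x + b * g x) x = a * sderiv m f x + b * sderiv m g x"
      using L(2)[OF k] by (subst (1 2 3) m') (simp add: sderiv_Suc)
    then show ?case using L(1)[OF k] by simp
  qed
qed

lemma abs_cont_on_lincomb:
  assumes f: "abs_cont_on 0 1 f" and g: "abs_cont_on 0 1 g"
    and k: "\<And>t. t \<in> {0..1} \<Longrightarrow> k t = a * f t + b * g t"
  shows "abs_cont_on 0 1 k"
  unfolding abs_cont_on_def
proof (intro allI impI)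
  fix \<epsilon> :: real assume \<epsilon>: "\<epsilon> > 0"
  define c where "c = \<bar>a\<bar> + \<bar>b\<bar> + 1"
  have c: "c > 0" by (simp add: c_def add_nonneg_pos)
  then have \<epsilon>c: "\<epsilon> / c > 0" using \<epsilon> by simp
  obtain d1 where d1: "d1 > 0" "\<And>D T. D division_of T \<Longrightarrow> T \<subseteq> {0..1} \<Longrightarrow> (\<Sum>K\<in>D. Sup K - Inf K) < d1 \<Longrightarrow>
      (\<Sum>K\<in>D. \<bar>f (Sup K) - f (Inf K)\<bar>) < \<epsilon> / c"
    using f \<epsilon>c unfolding abs_cont_on_def by meson
  obtain d2 where d2: "d2 > 0" "\<And>D T. D division_of T \<Longrightarrow> T \<subseteq> {0..1} \<Longrightarrow> (\<Sum>K\<in>D. Sup K - Inf K) < d2 \<Longrightarrow>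
      (\<Sum>K\<in>D. \<bar>g (Sup K) - g (Inf K)\<bar>) < \<epsilon> / c"
    using g \<epsilon>c unfolding abs_cont_on_def by meson
  show "\<exists>\<delta>>0. \<forall>D T. D division_of T \<and> T \<subseteq> {0..1} \<and> (\<Sum>K\<in>D. Sup K - Inf K) < \<delta> \<longrightarrow>
        (\<Sum>K\<in>D. \<bar>k (Sup K) - k (Inf K)\<bar>) < \<epsilon>"
  proof (intro exI[of _ "min d1 d2"] conjI allI impI)
    show "min d1 d2 > 0" using d1(1) d2(1) by simp
    fix D T assume A: "D division_of T \<and> T \<subseteq> {0..1::real} \<and> (\<Sum>K\<in>D. Sup K - Inf K) < min d1 d2"
    have in01: "Sup K \<in> {0..1} \<and> Inf K \<in> {0..1}" if "K \<in> D" for K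
    proof -
      have D: "D division_of T" and T: "T \<subseteq> {0..1}" using A by auto
      obtain u v where K: "K = cbox u v" using division_ofD(4)[OF D \<open>K \<in> D\<close>] by blast
      have "K \<noteq> {}" "K \<subseteq> {0..1}"
        using division_ofD(2,3)[OF D \<open>K \<in> D\<close>] T by auto
      then show ?thesis using K by auto
    qed
    have "(\<Sum>K\<in>D. \<bar>k (Sup K) - k (Inf K)\<bar>)
        \<le> (\<Sum>K\<in>D. \<bar>a\<bar> * \<bar>f (Sup K) - f (Inf K)\<bar> + \<bar>b\<bar> * \<bar>g (Sup K) - g (Inf K)\<bar>)"
    proof (rule sum_mono)
      fix K assume "K \<in> D"
      then have "k (Sup K) - k (Inf K) = a * (f (Sup K) - f (Inf K)) + b * (g (Sup K) - g (Inf K))"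
        using in01 k by (simp add: algebra_simps)
      then show "\<bar>k (Sup K) - k (Inf K)\<bar> \<le> \<bar>a\<bar> * \<bar>f (Sup K) - f (Inf K)\<bar> + \<bar>b\<bar> * \<bar>g (Sup K) - g (Inf K)\<bar>"
        by (metis abs_mult abs_triangle_ineq)
    qed
    also have "\<dots> = \<bar>a\<bar> * (\<Sum>K\<in>D. \<bar>f (Sup K) - f (Inf K)\<bar>) + \<bar>b\<bar> * (\<Sum>K\<in>D. \<bar>g (Sup K) - g (Inf K)\<bar>)"
      by (simp add: sum.distrib sum_distrib_left)
    also have "\<dots> \<le> \<bar>a\<bar> * (\<epsilon> / c) + \<bar>b\<bar> * (\<epsilon> / c)"
    proof (intro add_mono mult_left_mono)
      show "(\<Sum>K\<in>D. \<bar>f (Sup K) - f (Inf K)\<bar>) \<le> \<epsilon> / c" using d1(2)[of D T] A by simp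
      show "(\<Sum>K\<in>D. \<bar>g (Sup K) - g (Inf K)\<bar>) \<le> \<epsilon> / c" using d2(2)[of D T] A by simp
    qed auto
    also have "\<dots> < c * (\<epsilon> / c)"
    proof -
      have "c * (\<epsilon> / c) = \<bar>a\<bar> * (\<epsilon> / c) + \<bar>b\<bar> * (\<epsilon> / c) + \<epsilon> / c"
        unfolding c_def by (simp only: distrib_right mult_1_left)
      then show ?thesis using \<epsilon>c by linarith
    qed
    also have "\<dots> = \<epsilon>" using c by simp
    finally show "(\<Sum>K\<in>D. \<bar>k (Sup K) - k (Inf K)\<bar>) < \<epsilon>" .
  qed
qed

text \<open>
  Lebesgue measure is complete. This gives the measurability of the derivative of order \<open>m\<close> of a
  linear combination, which is known up to a null set.
\<close>

lemma borel_measurable_lebesgue_on_AE: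
  fixes f g :: "real \<Rightarrow> real"
  assumes f: "f \<in> borel_measurable (lebesgue_on S)" and S: "S \<in> sets lebesgue"
    and ae: "AE x in lebesgue_on S. g x = f x"
  shows "g \<in> borel_measurable (lebesgue_on S)"
proof -
  have "(\<lambda>x. if x \<in> S then f x else 0) \<in> borel_measurable lebesgue"
    using f S by (simp add: borel_measurable_if)
  moreover have "AE x in lebesgue. (if x \<in> S then f x else 0) = (if x \<in> S then g x else 0)"
    using ae S by (simp add: AE_restrict_space_iff) (auto elim!: eventually_mono)
  ultimately have "(\<lambda>x. if x \<in> S then g x else 0) \<in> borel_measurable lebesgue"
    by (rule borel_measurable_AE)
  then show ?thesis using S by (simp add: borel_measurable_if)
qed

lemma integrable_product_of_squares:
  fixes f g :: "'a \<Rightarrow> real"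
  assumes [measurable]: "f \<in> borel_measurable M" "g \<in> borel_measurable M"
    and "integrable M (\<lambda>x. (f x)\<^sup>2)" "integrable M (\<lambda>x. (g x)\<^sup>2)"
  shows "integrable M (\<lambda>x. f x * g x)"
proof (rule Bochner_Integration.integrable_bound)
  show "integrable M (\<lambda>x. (f x)\<^sup>2 + (g x)\<^sup>2)" using assms by simp
  show "AE x in M. norm (f x * g x) \<le> norm ((f x)\<^sup>2 + (g x)\<^sup>2)"
  proof (rule AE_I2)
    fix x
    have "0 \<le> (\<bar>f x\<bar> - \<bar>g x\<bar>)\<^sup>2" by simp
    then have "2 * \<bar>f x * g x\<bar> \<le> (f x)\<^sup>2 + (g x)\<^sup>2"
      by (simp add: power2_diff abs_mult)
    then show "norm (f x * g x) \<le> norm ((f x)\<^sup>2 + (g x)\<^sup>2)" by simp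
  qed
qed simp

lemma sobolev_lincomb:
  assumes m: "m \<ge> 1" and f: "f \<in> sobolev m" and g: "g \<in> sobolev m"
  shows "(\<lambda>x. a * f x + b * g x) \<in> sobolev m"
proof -
  let ?k = "\<lambda>x. a * f x + b * g x"
  note lin = sderiv_lincomb[OF f g, where a = a and b = b]
  note top = sderiv_top_lincomb[OF m f g, of a b]
  have top1: "AE x in lebesgue_on {0..1}. sderiv (m - 1) ?k differentiable (at x within {0..1})"
    and top2: "AE x in lebesgue_on {0..1}. sderiv m ?k x = a * sderiv m f x + b * sderiv m g x"
    using top by (auto elim: eventually_mono)
  have fm[measurable]: "sderiv m f \<in> borel_measurable (lebesgue_on {0..1})"
    and gm[measurable]: "sderiv m g \<in> borel_measurable (lebesgue_on {0..1})"
    and f2: "integrable (lebesgue_on {0..1}) (\<lambda>x. (sderiv m f x)\<^sup>2)"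
    and g2: "integrable (lebesgue_on {0..1}) (\<lambda>x. (sderiv m g x)\<^sup>2)"
    using f g by (auto simp: sobolev_def)
  have km[measurable]: "sderiv m ?k \<in> borel_measurable (lebesgue_on {0..1})"
    by (rule borel_measurable_lebesgue_on_AE[OF _ _ top2]) auto
  have "integrable (lebesgue_on {0..1}) (\<lambda>x. (a * sderiv m f x + b * sderiv m g x)\<^sup>2)"
    using integrable_product_of_squares[OF fm gm f2 g2] f2 g2
    by (simp add: power2_sum power_mult_distrib mult.assoc mult.left_commute)
  then have k2: "integrable (lebesgue_on {0..1}) (\<lambda>x. (sderiv m ?k x)\<^sup>2)"
    by (rule integrable_cong_AE_imp) (use top2 in \<open>auto elim!: eventually_mono\<close>)
  show ?thesis
    unfolding sobolev_def mem_Collect_eq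
  proof (intro conjI allI impI ballI top1 km k2)
    fix j assume "j < m"
    show "abs_cont_on 0 1 (sderiv j ?k)"
      by (rule abs_cont_on_lincomb[of "sderiv j f" "sderiv j g" _ a b])
        (use f g \<open>j < m\<close> lin in \<open>auto simp: sobolev_def\<close>)
  next
    fix j and x :: real assume j: "Suc j < m" and x: "x \<in> {0..1}"
    show "sderiv j ?k differentiable (at x within {0..1})"
      by (rule vector_derivative_unit_lincomb(1)[OF x, of "sderiv j f" "sderiv j g" _ a b])
        (use f g j x lin in \<open>auto simp: sobolev_def\<close>)
  qed
qed

lemma penJ_commute: "penJ m f g = penJ m g f"
  by (simp add: penJ_def mult.commute)

lemma penJ_nonneg: "penJ m f f \<ge> 0"
  by (simp add: penJ_def)

lemma penJ_lincomb:
  assumes m: "m \<ge> 1" and f: "f \<in> sobolev m" and g: "g \<in> sobolev m" and k: "k \<in> sobolev m"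
  shows "penJ m (\<lambda>x. a * f x + b * g x) k = a * penJ m f k + b * penJ m g k"
proof -
  let ?L = "lebesgue_on {0..1::real}"
  have sq: "sderiv m u \<in> borel_measurable ?L \<and> integrable ?L (\<lambda>x. (sderiv m u x)\<^sup>2)" if "u \<in> sobolev m" for u
    using that by (auto simp: sobolev_def)
  have int: "integrable ?L (\<lambda>x. sderiv m u x * sderiv m k x)" if "u \<in> sobolev m" for u
    using sq[OF that] sq[OF k] by (intro integrable_product_of_squares) auto
  have "penJ m (\<lambda>x. a * f x + b * g x) k
      = (\<integral>x. a * (sderiv m f x * sderiv m k x) + b * (sderiv m g x * sderiv m k x) \<partial>?L)"
    unfolding penJ_def
  proof (rule integral_cong_AE)
    show "(\<lambda>z. sderiv m (\<lambda>x. a * f x + b * g x) z * sderiv m k z) \<in> borel_measurable ?L"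
      using sq[OF sobolev_lincomb[OF m f g]] sq[OF k] by (intro borel_measurable_times) auto
    show "(\<lambda>x. a * (sderiv m f x * sderiv m k x) + b * (sderiv m g x * sderiv m k x)) \<in> borel_measurable ?L"
      using int[OF f] int[OF g] by auto
    show "AE x in ?L. sderiv m (\<lambda>x. a * f x + b * g x) x * sderiv m k x =
        a * (sderiv m f x * sderiv m k x) + b * (sderiv m g x * sderiv m k x)"
      using sderiv_top_lincomb[OF m f g, of a b]
      by eventually_elim (simp add: algebra_simps)
  qed
  then show ?thesis
    using int[OF f] int[OF g] by (simp add: penJ_def)
qed

lemma sobolev_continuous:
  assumes "m \<ge> 2" "f \<in> sobolev m"
  shows "continuous_on {0..1} f"
proof -
  have "\<forall>x\<in>{0..1}. sderiv 0 f differentiable (at x within {0..1})"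
    using assms by (auto simp: sobolev_def)
  then show ?thesis
    by (auto simp: sderiv_0 continuous_on_eq_continuous_within intro: differentiable_imp_continuous_within)
qed


section \<open>Second moments of sums of independent observations\<close>

text \<open>
  Observations are numbered from 1; nothing is known about \<open>X 0\<close>. \<open>D\<close> is their common law.
\<close>

locale iid_sample = prob_space M for M :: "'a measure" +
  fixes N :: "'b measure" and D :: "'b measure" and X :: "nat \<Rightarrow> 'a \<Rightarrow> 'b"
  assumes indep: "indep_vars (\<lambda>_. N) X {1..}"
    and ident: "\<And>i. i \<ge> 1 \<Longrightarrow> distr M N (X i) = D"
begin

lemma X_measurable: "i \<ge> 1 \<Longrightarrow> X i \<in> measurable M N"
  using indep by (auto simp: indep_vars_def)

lemma sets_D: "sets D = sets N"
  using ident[of 1] by (metis order_refl sets_distr)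

lemma has_integral_single:
  fixes \<phi> :: "'b \<Rightarrow> real"
  assumes i: "i \<ge> 1" and b: "has_bochner_integral D \<phi> b"
  shows "has_bochner_integral M (\<lambda>\<omega>. \<phi> (X i \<omega>)) b"
proof -
  have m: "\<phi> \<in> borel_measurable N"
    using b sets_D by (metis borel_measurable_has_bochner_integral measurable_cong_sets)
  have "integrable (distr M N (X i)) \<phi>" "integral\<^sup>L (distr M N (X i)) \<phi> = b"
    using b ident[OF i] by (auto simp: has_bochner_integral_iff)
  then show ?thesis
    using m X_measurable[OF i] by (simp add: has_bochner_integral_iff integrable_distr_eq integral_distr)
qed

text \<open>
  A function \<open>G\<close> of the first \<open>n\<close> observations is independent of observation \<open>n + 1\<close>. The moments of
  sums below follow from this by adding one observation at a time.
\<close>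

lemma has_integral_past_times_new:
  fixes \<phi> :: "'b \<Rightarrow> real" and F :: "(nat \<Rightarrow> 'b) \<Rightarrow> real"
  assumes F: "F \<in> borel_measurable (PiM {1..n} (\<lambda>_. N))"
    and G: "\<And>\<omega>. G \<omega> = F (restrict (\<lambda>i. X i \<omega>) {1..n})"
    and a: "has_bochner_integral M G a" and b: "has_bochner_integral D \<phi> b"
  shows "has_bochner_integral M (\<lambda>\<omega>. G \<omega> * \<phi> (X (Suc n) \<omega>)) (a * b)"
proof -
  have m: "\<phi> \<in> borel_measurable N"
    using b sets_D by (metis borel_measurable_has_bochner_integral measurable_cong_sets)
  let ?I = "\<lambda>J \<omega>. restrict (\<lambda>i. X i \<omega>) J"
  have "indep_var (PiM {1..n} (\<lambda>_. N)) (?I {1..n}) (PiM {Suc n} (\<lambda>_. N)) (?I {Suc n})"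
    by (rule indep_var_restrict[OF indep]) auto
  then have "indep_var borel (F \<circ> ?I {1..n}) borel ((\<lambda>x. \<phi> (x (Suc n))) \<circ> ?I {Suc n})"
    by (rule indep_var_compose) (use F m in auto)
  moreover have "F \<circ> ?I {1..n} = G" "((\<lambda>x. \<phi> (x (Suc n))) \<circ> ?I {Suc n}) = (\<lambda>\<omega>. \<phi> (X (Suc n) \<omega>))"
    using G by auto
  ultimately have iv: "indep_var borel G borel (\<lambda>\<omega>. \<phi> (X (Suc n) \<omega>))" by simp
  have b': "has_bochner_integral M (\<lambda>\<omega>. \<phi> (X (Suc n) \<omega>)) b"
    by (rule has_integral_single[OF _ b]) simp
  show ?thesis
    using indep_var_lebesgue_integral[OF iv] indep_var_integrable[OF iv] a b'
    by (simp add: has_bochner_integral_iff)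
qed

lemma has_integral_sum:
  fixes \<phi> :: "'b \<Rightarrow> real"
  assumes "has_bochner_integral D \<phi> b"
  shows "has_bochner_integral M (\<lambda>\<omega>. \<Sum>i=1..n. \<phi> (X i \<omega>)) (real n * b)"
proof -
  have "has_bochner_integral M (\<lambda>\<omega>. \<Sum>i=1..n. \<phi> (X i \<omega>)) (\<Sum>i=1..n. b)"
    by (intro has_bochner_integral_sum has_integral_single[OF _ assms]) auto
  then show ?thesis by simp
qed

lemma measurable_D: "has_bochner_integral D \<phi> b \<Longrightarrow> (\<phi> :: 'b \<Rightarrow> real) \<in> borel_measurable N"
  using sets_D by (metis borel_measurable_has_bochner_integral measurable_cong_sets)

lemma has_integral_sum_times_sum:
  fixes \<phi> \<psi> :: "'b \<Rightarrow> real"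
  assumes \<phi>: "has_bochner_integral D \<phi> 0" and \<psi>: "has_bochner_integral D \<psi> 0"
    and c: "has_bochner_integral D (\<lambda>x. \<phi> x * \<psi> x) c"
  shows "has_bochner_integral M (\<lambda>\<omega>. (\<Sum>i=1..n. \<phi> (X i \<omega>)) * (\<Sum>i=1..n. \<psi> (X i \<omega>))) (real n * c)"
proof (induction n)
  case 0
  then show ?case by (simp add: has_bochner_integral_zero)
next
  case (Suc n)
  note [measurable] = measurable_D[OF \<phi>] measurable_D[OF \<psi>]
  let ?s = "\<lambda>\<omega>. \<Sum>i=1..n. \<phi> (X i \<omega>)" and ?t = "\<lambda>\<omega>. \<Sum>i=1..n. \<psi> (X i \<omega>)"
  have m: "(\<lambda>x. \<Sum>i=1..n. \<theta> (x i)) \<in> borel_measurable (PiM {1..n} (\<lambda>_. N))"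
    if [measurable]: "\<theta> \<in> borel_measurable N" for \<theta> :: "'b \<Rightarrow> real"
    by measurable
  have 1: "has_bochner_integral M (\<lambda>\<omega>. ?s \<omega> * \<psi> (X (Suc n) \<omega>)) (real n * 0 * 0)"
    by (rule has_integral_past_times_new[where F = "\<lambda>x. \<Sum>i=1..n. \<phi> (x i)", OF m _ has_integral_sum[OF \<phi>] \<psi>]) auto
  have 2: "has_bochner_integral M (\<lambda>\<omega>. ?t \<omega> * \<phi> (X (Suc n) \<omega>)) (real n * 0 * 0)"
    by (rule has_integral_past_times_new[where F = "\<lambda>x. \<Sum>i=1..n. \<psi> (x i)", OF m _ has_integral_sum[OF \<psi>] \<phi>]) auto
  have 3: "has_bochner_integral M (\<lambda>\<omega>. \<phi> (X (Suc n) \<omega>) * \<psi> (X (Suc n) \<omega>)) c"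
    by (rule has_integral_single[OF _ c]) simp
  have "has_bochner_integral M (\<lambda>\<omega>. (?s \<omega> * ?t \<omega> + ?s \<omega> * \<psi> (X (Suc n) \<omega>))
      + (?t \<omega> * \<phi> (X (Suc n) \<omega>) + \<phi> (X (Suc n) \<omega>) * \<psi> (X (Suc n) \<omega>)))
      ((real n * c + real n * 0 * 0) + (real n * 0 * 0 + c))"
    by (intro has_bochner_integral_add Suc.IH 1 2 3)
  then show ?case by (simp add: algebra_simps)
qed

lemma has_integral_square:
  fixes \<phi> :: "'b \<Rightarrow> real"
  assumes "has_bochner_integral D \<phi> 0" "has_bochner_integral D (\<lambda>x. (\<phi> x)\<^sup>2) c"
  shows "has_bochner_integral M (\<lambda>\<omega>. (\<Sum>i=1..n. \<phi> (X i \<omega>))\<^sup>2) (real n * c)"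
  using has_integral_sum_times_sum[OF assms(1,1), of c n] assms(2) by (simp add: power2_eq_square)

text \<open>
  The second moment of a centred weighted chi-square type statistic. Adding an observation \<open>x\<close>
  changes it by \<open>Y + q x\<close>, where \<open>Y\<close> is linear in the scores \<open>\<phi> \<nu> x\<close> with coefficients from the past and
  \<open>q x\<close> is the centred contribution of \<open>x\<close> alone. The past value, \<open>Y\<close> and \<open>q x\<close> are pairwise
  orthogonal, so second moments add up, and \<open>Y\<close> contributes \<open>4 n \<Sum> w\<^sup>2\<close>. This replaces the expansion of
  a fourfold sum over observations.
\<close>

lemma has_integral_chi_square:
  fixes \<phi> :: "nat \<Rightarrow> 'b \<Rightarrow> real" and w :: "nat \<Rightarrow> real" and k :: nat
  defines "A \<equiv> \<Sum>\<nu><k. w \<nu>"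
  assumes mean: "\<And>\<nu>. has_bochner_integral D (\<phi> \<nu>) 0"
    and orth: "\<And>\<mu> \<nu>. has_bochner_integral D (\<lambda>x. \<phi> \<mu> x * \<phi> \<nu> x) (if \<mu> = \<nu> then 1 else 0)"
    and fourth: "has_bochner_integral D (\<lambda>x. ((\<Sum>\<nu><k. w \<nu> * (\<phi> \<nu> x)\<^sup>2) - A)\<^sup>2) B"
  shows "has_bochner_integral M
           (\<lambda>\<omega>. ((\<Sum>\<nu><k. w \<nu> * (\<Sum>i=1..n. \<phi> \<nu> (X i \<omega>))\<^sup>2) - real n * A)\<^sup>2)
           (2 * real n * (real n - 1) * (\<Sum>\<nu><k. (w \<nu>)\<^sup>2) + real n * B)"
proof (induction n)
  case 0
  then show ?case by (simp add: has_bochner_integral_zero)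
next
  case (Suc n)
  note [measurable] = measurable_D[OF mean]
  note [measurable] = X_measurable
  let ?W = "\<Sum>\<nu><k. (w \<nu>)\<^sup>2"
  define s where "s = (\<lambda>\<nu> \<omega>. \<Sum>i=1..n. \<phi> \<nu> (X i \<omega>))"
  define x where "x = (\<lambda>\<omega>. X (Suc n) \<omega>)"
  define q where "q = (\<lambda>x. (\<Sum>\<nu><k. w \<nu> * (\<phi> \<nu> x)\<^sup>2) - A)"
  define Q where "Q = (\<lambda>\<omega>. (\<Sum>\<nu><k. w \<nu> * (s \<nu> \<omega>)\<^sup>2) - real n * A)"
  define Y where "Y = (\<lambda>\<omega>. \<Sum>\<nu><k. 2 * w \<nu> * (s \<nu> \<omega> * \<phi> \<nu> (x \<omega>)))"
  have [measurable]: "x \<in> measurable M N" unfolding x_def by (rule X_measurable) simp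
  have [measurable]: "q \<in> borel_measurable N" unfolding q_def by measurable
  have sM[measurable]: "s \<nu> \<in> borel_measurable M" for \<nu>
    unfolding s_def by (intro borel_measurable_sum measurable_compose[OF X_measurable measurable_D[OF mean]]) auto
  have QM[measurable]: "Q \<in> borel_measurable M" unfolding Q_def by measurable
  let ?sF = "\<lambda>\<nu> y. \<Sum>i=1..n. \<phi> \<nu> (y i)"
  let ?QF = "\<lambda>y. (\<Sum>\<nu><k. w \<nu> * (?sF \<nu> y)\<^sup>2) - real n * A"
  let ?r = "\<lambda>\<omega>. restrict (\<lambda>i. X i \<omega>) {1..n}"
  have sF[measurable]: "?sF \<nu> \<in> borel_measurable (PiM {1..n} (\<lambda>_. N))" for \<nu> by measurable
  have QF[measurable]: "?QF \<in> borel_measurable (PiM {1..n} (\<lambda>_. N))" by measurable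
  have sr: "s \<nu> \<omega> = ?sF \<nu> (?r \<omega>)" for \<nu> \<omega> by (simp add: s_def)
  have Qr: "Q \<omega> = ?QF (?r \<omega>)" for \<omega> by (simp add: Q_def s_def)
  have split: "(\<Sum>\<nu><k. w \<nu> * (\<Sum>i=1..Suc n. \<phi> \<nu> (X i \<omega>))\<^sup>2) - real (Suc n) * A = Q \<omega> + Y \<omega> + q (x \<omega>)" for \<omega>
  proof -
    have "(\<Sum>\<nu><k. w \<nu> * (\<Sum>i=1..Suc n. \<phi> \<nu> (X i \<omega>))\<^sup>2)
        = (\<Sum>\<nu><k. w \<nu> * (s \<nu> \<omega>)\<^sup>2 + 2 * w \<nu> * (s \<nu> \<omega> * \<phi> \<nu> (x \<omega>)) + w \<nu> * (\<phi> \<nu> (x \<omega>))\<^sup>2)"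
      by (simp add: s_def x_def power2_sum algebra_simps)
    then show ?thesis
      by (simp add: Q_def Y_def q_def sum.distrib algebra_simps)
  qed
  have sI: "has_bochner_integral M (s \<nu>) 0" for \<nu>
    using has_integral_sum[OF mean, of \<nu> n] by (simp add: s_def)
  have ssI: "has_bochner_integral M (\<lambda>\<omega>. s \<mu> \<omega> * s \<nu> \<omega>) (real n * (if \<mu> = \<nu> then 1 else 0))" for \<mu> \<nu>
    unfolding s_def by (rule has_integral_sum_times_sum[OF mean mean orth])
  have QQ: "has_bochner_integral M (\<lambda>\<omega>. (Q \<omega>)\<^sup>2) (2 * real n * (real n - 1) * ?W + real n * B)"
    using Suc.IH by (simp add: Q_def s_def)
  have Qint: "integrable M Q"
    using QQ square_integrable_imp_integrable[OF QM] by (auto simp: has_bochner_integral_iff)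
  have Qs: "integrable M (\<lambda>\<omega>. Q \<omega> * s \<nu> \<omega>)" for \<nu>
    using QQ ssI[of \<nu> \<nu>] by (intro integrable_product_of_squares) (auto simp: has_bochner_integral_iff power2_eq_square)
  have qI: "has_bochner_integral D q 0"
  proof -
    have "has_bochner_integral D (\<lambda>x. (\<Sum>\<nu><k. w \<nu> * (\<phi> \<nu> x * \<phi> \<nu> x))) (\<Sum>\<nu><k. w \<nu> * 1)"
      using orth[of \<nu> \<nu> for \<nu>] by (intro has_bochner_integral_sum has_bochner_integral_mult_right) auto
    moreover have "has_bochner_integral D (\<lambda>x. A) A"
    proof -
      interpret D: prob_space D
        using prob_space_distr[OF X_measurable[of 1]] ident[of 1] by simp
      show ?thesis by (simp add: has_bochner_integral_iff D.prob_space)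
    qed
    ultimately show ?thesis
      unfolding q_def A_def using has_bochner_integral_diff by (fastforce simp: power2_eq_square)
  qed
  have qqI: "has_bochner_integral D (\<lambda>x. (q x)\<^sup>2) B" using fourth by (simp add: q_def)
  have \<phi>q: "integrable D (\<lambda>x. \<phi> \<nu> x * q x)" for \<nu>
    using orth[of \<nu> \<nu>] qqI borel_measurable_has_bochner_integral[OF mean] borel_measurable_has_bochner_integral[OF qI]
    by (intro integrable_product_of_squares) (auto simp: has_bochner_integral_iff power2_eq_square)
  have 1: "has_bochner_integral M (\<lambda>\<omega>. (q (x \<omega>))\<^sup>2) B"
    unfolding x_def by (rule has_integral_single[OF _ qqI]) simp
  have 2: "has_bochner_integral M (\<lambda>\<omega>. Q \<omega> * q (x \<omega>)) 0"
    unfolding x_def using has_integral_past_times_new[OF QF Qr has_bochner_integral_integrable[OF Qint] qI] by simp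
  have 3: "has_bochner_integral M (\<lambda>\<omega>. Q \<omega> * Y \<omega>) 0"
  proof -
    have "has_bochner_integral M (\<lambda>\<omega>. (Q \<omega> * s \<nu> \<omega>) * \<phi> \<nu> (x \<omega>)) 0" for \<nu>
      unfolding x_def
      using has_integral_past_times_new[OF borel_measurable_times[OF QF sF] _
          has_bochner_integral_integrable[OF Qs] mean, of \<nu> \<nu>] Qr sr by simp
    then have "has_bochner_integral M (\<lambda>\<omega>. \<Sum>\<nu><k. 2 * w \<nu> * ((Q \<omega> * s \<nu> \<omega>) * \<phi> \<nu> (x \<omega>))) (\<Sum>\<nu><k. 2 * w \<nu> * 0)"
      by (intro has_bochner_integral_sum has_bochner_integral_mult_right) auto
    then show ?thesis by (simp add: Y_def sum_distrib_left mult_ac)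
  qed
  have 4: "has_bochner_integral M (\<lambda>\<omega>. Y \<omega> * q (x \<omega>)) 0"
  proof -
    have "has_bochner_integral M (\<lambda>\<omega>. s \<nu> \<omega> * (\<phi> \<nu> (x \<omega>) * q (x \<omega>))) 0" for \<nu>
      unfolding x_def
      using has_integral_past_times_new[OF sF sr sI has_bochner_integral_integrable[OF \<phi>q], of \<nu> \<nu>] by simp
    then have "has_bochner_integral M (\<lambda>\<omega>. \<Sum>\<nu><k. 2 * w \<nu> * (s \<nu> \<omega> * (\<phi> \<nu> (x \<omega>) * q (x \<omega>)))) (\<Sum>\<nu><k. 2 * w \<nu> * 0)"
      by (intro has_bochner_integral_sum has_bochner_integral_mult_right) auto
    moreover have "(\<Sum>\<nu><k. 2 * w \<nu> * (s \<nu> \<omega> * (\<phi> \<nu> (x \<omega>) * q (x \<omega>)))) = Y \<omega> * q (x \<omega>)" for \<omega>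
      unfolding Y_def sum_distrib_right by (simp only: mult.assoc)
    ultimately show ?thesis by simp
  qed
  have 5: "has_bochner_integral M (\<lambda>\<omega>. (Y \<omega>)\<^sup>2) (4 * real n * ?W)"
  proof -
    have "has_bochner_integral M (\<lambda>\<omega>. (s \<mu> \<omega> * s \<nu> \<omega>) * (\<phi> \<mu> (x \<omega>) * \<phi> \<nu> (x \<omega>)))
        ((real n * (if \<mu> = \<nu> then 1 else 0)) * (if \<mu> = \<nu> then 1 else 0))" for \<mu> \<nu>
      unfolding x_def
      by (rule has_integral_past_times_new[OF borel_measurable_times[OF sF sF] _ ssI orth, of \<mu> \<nu>]) (simp add: sr)
    then have "has_bochner_integral M (\<lambda>\<omega>. \<Sum>\<mu><k. \<Sum>\<nu><k. (4 * w \<mu> * w \<nu>) * ((s \<mu> \<omega> * s \<nu> \<omega>) * (\<phi> \<mu> (x \<omega>) * \<phi> \<nu> (x \<omega>))))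
      (\<Sum>\<mu><k. \<Sum>\<nu><k. (4 * w \<mu> * w \<nu>) * ((real n * (if \<mu> = \<nu> then 1 else 0)) * (if \<mu> = \<nu> then 1 else 0)))"
      by (intro has_bochner_integral_sum has_bochner_integral_mult_right) auto
    moreover have "(\<Sum>\<mu><k. \<Sum>\<nu><k. (4 * w \<mu> * w \<nu>) * ((s \<mu> \<omega> * s \<nu> \<omega>) * (\<phi> \<mu> (x \<omega>) * \<phi> \<nu> (x \<omega>)))) = (Y \<omega>)\<^sup>2" for \<omega>
      unfolding Y_def power2_eq_square sum_product by (intro sum.cong refl) (simp add: mult_ac)
    moreover have "(\<Sum>\<mu><k. \<Sum>\<nu><k. (4 * w \<mu> * w \<nu>) * ((real n * (if \<mu> = \<nu> then 1 else 0)) * (if \<mu> = \<nu> then 1 else 0)))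
        = (\<Sum>\<mu><k. \<Sum>\<nu><k. if \<mu> = \<nu> then 4 * real n * (w \<nu>)\<^sup>2 else 0)"
      by (intro sum.cong refl) (simp add: power2_eq_square)
    moreover have "\<dots> = 4 * real n * ?W" by (simp add: sum_distrib_left)
    ultimately show ?thesis by simp
  qed
  have "has_bochner_integral M
      (\<lambda>\<omega>. (Q \<omega>)\<^sup>2 + (Y \<omega>)\<^sup>2 + (q (x \<omega>))\<^sup>2 + 2 * (Q \<omega> * Y \<omega>) + 2 * (Q \<omega> * q (x \<omega>)) + 2 * (Y \<omega> * q (x \<omega>)))
      ((2 * real n * (real n - 1) * ?W + real n * B) + 4 * real n * ?W + B + 2 * 0 + 2 * 0 + 2 * 0)"
    by (intro has_bochner_integral_add has_bochner_integral_mult_right QQ 1 2 3 4 5)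
  moreover have "(Q \<omega> + Y \<omega> + q (x \<omega>))\<^sup>2 = (Q \<omega>)\<^sup>2 + (Y \<omega>)\<^sup>2 + (q (x \<omega>))\<^sup>2 + 2 * (Q \<omega> * Y \<omega>) + 2 * (Q \<omega> * q (x \<omega>)) + 2 * (Y \<omega> * q (x \<omega>))" for \<omega>
    by (simp add: power2_eq_square algebra_simps)
  moreover have "(2 * real n * (real n - 1) * ?W + real n * B) + 4 * real n * ?W + B + 2 * 0 + 2 * 0 + 2 * 0
      = 2 * real (Suc n) * (real (Suc n) - 1) * ?W + real (Suc n) * B"
    by (simp add: algebra_simps)
  ultimately show ?case unfolding split by simp
qed

end


section \<open>Smoothing weights, the standardized statistic and rates\<close>

lemma sum_inverse_one_plus_square_le:
  fixes h :: real
  assumes h: "h > 0"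
  shows "(\<Sum>\<nu><Suc k. 1 / (1 + (h * real \<nu>)\<^sup>2)) \<le> 1 + arctan (h * real k) / h"
proof (induction k)
  case 0
  then show ?case by simp
next
  case (Suc k)
  let ?x = "h * real k" and ?y = "h * real (Suc k)"
  have "\<exists>t>?x. t < ?y \<and> arctan ?y - arctan ?x = (?y - ?x) * inverse (1 + t\<^sup>2)"
    using h by (intro MVT2) (auto intro: DERIV_arctan)
  then obtain t where t: "?x < t" "t < ?y" "arctan ?y - arctan ?x = h * inverse (1 + t\<^sup>2)"
    by (auto simp: algebra_simps)
  have "0 \<le> ?x" using h by simp
  then have "t\<^sup>2 \<le> ?y\<^sup>2" using t by (intro power_mono) auto
  then have "1 / (1 + ?y\<^sup>2) \<le> 1 / (1 + t\<^sup>2)"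
    by (intro divide_left_mono) (auto intro!: mult_pos_pos add_pos_nonneg)
  also have "\<dots> = (arctan ?y - arctan ?x) / h"
    unfolding t(3) using h by (simp add: inverse_eq_divide)
  finally have "1 / (1 + ?y\<^sup>2) \<le> arctan ?y / h - arctan ?x / h"
    by (simp add: diff_divide_distrib)
  then show ?case using Suc by simp
qed

lemma one_plus_square_le:
  fixes x :: real
  assumes m: "m \<ge> 1" and x: "x \<ge> 0"
  shows "1 + x\<^sup>2 \<le> 2 * (1 + x ^ (2 * m))"
proof -
  have p: "0 \<le> x ^ (2 * m)" using x by simp
  have gen: "1 + u \<le> 2 * (1 + v)" if "u \<le> 1 \<or> u \<le> v" "0 \<le> v" for u v :: real
    using that by auto
  have "x\<^sup>2 \<le> 1 \<or> x\<^sup>2 \<le> x ^ (2 * m)"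
  proof (cases "x \<le> 1")
    case True
    then show ?thesis using x by (simp add: power_le_one)
  next
    case False
    then have "x ^ 2 \<le> x ^ (2 * m)" using m by (intro power_increasing) auto
    then show ?thesis ..
  qed
  then show ?thesis using p by (rule gen)
qed

text \<open>
  The weights \<open>1 / (1 + h ^ (2 * m) * \<gamma> \<nu>)\<close> behave like \<open>1 / (1 + (h \<nu>) ^ (2 * m))\<close>, so about \<open>1 / h\<close> of them
  are of order 1 and the others have a summable tail. They are dominated by a multiple of
  \<open>1 / (1 + (h \<nu>)\<^sup>2)\<close>, whose partial sums are Riemann sums of the derivative of \<^const>\<open>arctan\<close>.
\<close>

lemma smoothing_weights_bound:
  fixes \<gamma> :: "nat \<Rightarrow> real"
  assumes m: "m \<ge> 1" and \<gamma>0: "\<And>\<nu>. \<gamma> \<nu> \<ge> 0" and ord: "same_order \<gamma> (\<lambda>\<nu>. real \<nu> ^ (2 * m))"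
  shows "\<exists>c>0. \<forall>h. 0 < h \<longrightarrow> h \<le> 1 \<longrightarrow>
    summable (\<lambda>\<nu>. 1 / (1 + h ^ (2 * m) * \<gamma> \<nu>)) \<and> (\<Sum>\<nu>. 1 / (1 + h ^ (2 * m) * \<gamma> \<nu>)) \<le> c / h"
proof -
  obtain c0 where c0: "c0 > 0" "(\<lambda>\<nu>. \<gamma> \<nu> / real \<nu> ^ (2 * m)) \<longlonglongrightarrow> c0"
    using ord by (auto simp: same_order_def)
  then have "\<forall>\<^sub>F \<nu> in sequentially. c0 / 2 < \<gamma> \<nu> / real \<nu> ^ (2 * m)"
    by (intro order_tendstoD) auto
  then obtain N where N: "\<And>\<nu>. \<nu> \<ge> N \<Longrightarrow> c0 / 2 < \<gamma> \<nu> / real \<nu> ^ (2 * m)"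
    by (auto simp: eventually_sequentially)
  define b where "b = min 1 (c0 / 2)"
  have b: "0 < b" "b \<le> 1" "b \<le> c0 / 2" using c0 by (auto simp: b_def)
  \<comment> \<open>\<open>2 / b\<close> serves the indices above \<open>N\<close>, the other summand those up to \<open>N\<close>, where the weight is at most 1.\<close>
  define C where "C = 2 / b + (1 + (real N + 1)\<^sup>2)"
  have C: "C > 0" using b by (auto simp: C_def intro!: add_pos_pos add_pos_nonneg)
  have w: "1 / (1 + h ^ (2 * m) * \<gamma> \<nu>) \<le> C * (1 / (1 + (h * real \<nu>)\<^sup>2))" if h: "0 < h" "h \<le> 1" for h \<nu>
  proof -
    have pos: "1 + (h * real \<nu>)\<^sup>2 > 0" by (intro add_pos_nonneg) auto
    have wpos: "1 + h ^ (2 * m) * \<gamma> \<nu> \<ge> 1" using h \<gamma>0 by simp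
    have "1 + (h * real \<nu>)\<^sup>2 \<le> C * (1 + h ^ (2 * m) * \<gamma> \<nu>)"
    proof (cases "\<nu> \<le> N")
      case True
      have "h * real \<nu> \<le> 1 * (real N + 1)" using h True by (intro mult_mono) auto
      then have "(h * real \<nu>)\<^sup>2 \<le> (real N + 1)\<^sup>2" using h by (intro power_mono) auto
      moreover have "2 / b > 0" using b by simp
      ultimately have "1 + (h * real \<nu>)\<^sup>2 \<le> C * 1" unfolding C_def mult_1_right by linarith
      also have "\<dots> \<le> C * (1 + h ^ (2 * m) * \<gamma> \<nu>)" using C wpos by (intro mult_left_mono) auto
      finally show ?thesis .
    next
      case False
      then have "real \<nu> ^ (2 * m) > 0" by simp
      then have g: "c0 / 2 * real \<nu> ^ (2 * m) \<le> \<gamma> \<nu>"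
        using N[of \<nu>] False by (simp add: field_simps)
      let ?x = "h * real \<nu>"
      have x0: "?x \<ge> 0" using h by simp
      have "1 + ?x\<^sup>2 \<le> 2 * (1 + ?x ^ (2 * m))"
        using m x0 by (rule one_plus_square_le)
      also have "2 * (1 + ?x ^ (2 * m)) = (2 / b) * (b + b * ?x ^ (2 * m))"
        using b by (simp add: field_simps)
      also have "\<dots> \<le> (2 / b) * (1 + c0 / 2 * ?x ^ (2 * m))"
        using b x0 by (intro mult_left_mono add_mono mult_right_mono) auto
      also have "c0 / 2 * ?x ^ (2 * m) \<le> h ^ (2 * m) * \<gamma> \<nu>"
        using mult_left_mono[OF g, of "h ^ (2 * m)"] h by (simp add: power_mult_distrib mult_ac)
      also have "(2 / b) * (1 + h ^ (2 * m) * \<gamma> \<nu>) \<le> C * (1 + h ^ (2 * m) * \<gamma> \<nu>)"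
        using wpos by (intro mult_right_mono) (auto simp: C_def)
      finally show ?thesis using b by (simp add: divide_right_mono)
    qed
    then show ?thesis using pos wpos by (simp add: field_simps)
  qed
  have part: "(\<Sum>\<nu><k. 1 / (1 + h ^ (2 * m) * \<gamma> \<nu>)) \<le> 3 * C / h" if h: "0 < h" "h \<le> 1" for h k
  proof -
    have "(\<Sum>\<nu><k. 1 / (1 + h ^ (2 * m) * \<gamma> \<nu>)) \<le> (\<Sum>\<nu><Suc k. 1 / (1 + h ^ (2 * m) * \<gamma> \<nu>))"
      using h \<gamma>0 by simp
    also have "\<dots> \<le> (\<Sum>\<nu><Suc k. C * (1 / (1 + (h * real \<nu>)\<^sup>2)))"
      by (intro sum_mono w h)
    also have "\<dots> = C * (\<Sum>\<nu><Suc k. 1 / (1 + (h * real \<nu>)\<^sup>2))" by (simp add: sum_distrib_left distrib_left)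
    also have "\<dots> \<le> C * (1 + arctan (h * real k) / h)"
      using sum_inverse_one_plus_square_le[OF h(1)] C by (intro mult_left_mono) auto
    also have "\<dots> \<le> C * (1 / h + 2 / h)"
    proof (intro mult_left_mono add_mono divide_right_mono)
      show "1 \<le> 1 / h" using h by simp
      show "arctan (h * real k) \<le> 2" using arctan_ubound[of "h * real k"] pi_half_less_two by linarith
    qed (use C h in auto)
    finally show ?thesis by (simp add: field_simps)
  qed
  show ?thesis
  proof (intro exI conjI allI impI)
    show "3 * C > 0" using C by simp
    fix h :: real assume h: "0 < h" "h \<le> 1"
    have s: "summable (\<lambda>\<nu>. 1 / (1 + h ^ (2 * m) * \<gamma> \<nu>))"
      by (rule summableI_nonneg_bounded[OF _ part[OF h]]) (use h \<gamma>0 in auto)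
    show "summable (\<lambda>\<nu>. 1 / (1 + h ^ (2 * m) * \<gamma> \<nu>))" by (rule s)
    show "(\<Sum>\<nu>. 1 / (1 + h ^ (2 * m) * \<gamma> \<nu>)) \<le> 3 * C / h"
      by (rule suminf_le_const[OF s part[OF h]])
  qed
qed

lemma summable_square_of_unit_interval:
  fixes w :: "nat \<Rightarrow> real"
  assumes "\<And>\<nu>. 0 \<le> w \<nu>" "\<And>\<nu>. w \<nu> \<le> 1" "summable w"
  shows "summable (\<lambda>\<nu>. (w \<nu>)\<^sup>2)" "(\<Sum>\<nu>. (w \<nu>)\<^sup>2) \<le> (\<Sum>\<nu>. w \<nu>)"
proof -
  have le: "(w \<nu>)\<^sup>2 \<le> w \<nu>" for \<nu>
    using assms mult_left_le by (auto simp: power2_eq_square)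
  show s: "summable (\<lambda>\<nu>. (w \<nu>)\<^sup>2)"
    by (rule summable_comparison_test_ev[OF _ assms(3)]) (use le in auto)
  show "(\<Sum>\<nu>. (w \<nu>)\<^sup>2) \<le> (\<Sum>\<nu>. w \<nu>)"
    using le s assms(3) by (rule suminf_le)
qed

lemma bandwidth_pos: "lam > 0 \<Longrightarrow> bandwidth m lam > 0"
  by (simp add: bandwidth_def)

lemma bandwidth_power:
  assumes "m \<ge> 1" "lam > 0"
  shows "bandwidth m lam ^ (2 * m) = lam"
proof -
  have "bandwidth m lam ^ (2 * m) = lam powr (1 / (2 * real m) * real (2 * m))"
    using assms by (simp add: bandwidth_def powr_powr flip: powr_realpow)
  also have "1 / (2 * real m) * real (2 * m) = 1" using assms by simp
  finally show ?thesis using assms by simp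
qed

text \<open>
  With \<open>A\<close> the sum of the weights and \<open>A2\<close> the sum of their squares, \<open>r\<^sub>K = A / A2\<close> and \<open>u\<^sub>n = A\<^sup>2 / A2\<close>.
  Multiplying by \<open>(2 u\<^sub>n)^(-1/2)\<close> cancels the factor \<open>r\<^sub>K\<close> and leaves the ordinary standardization of a
  weighted chi-square variable, with mean \<open>A\<close> and variance \<open>2 A2\<close>.
\<close>

lemma plrt_statistic_standardized:
  fixes \<gamma> :: "nat \<Rightarrow> real"
  assumes lam: "lam > 0" and \<gamma>0: "\<And>\<nu>. \<gamma> \<nu> \<ge> 0"
    and sm: "summable (\<lambda>\<nu>. 1 / (1 + lam * \<gamma> \<nu>))"
  shows "plrt_statistic M Z m lam \<gamma> n z y g0 W0 gh =
    (- 2 * real n * plrt m lam n z y g0 gh - real n * (pen_norm M Z m lam W0)\<^sup>2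
      - (\<Sum>\<nu>. 1 / (1 + lam * \<gamma> \<nu>))) / sqrt (2 * (\<Sum>\<nu>. (1 / (1 + lam * \<gamma> \<nu>))\<^sup>2))"
proof -
  define w where "w = (\<lambda>\<nu>. 1 / (1 + lam * \<gamma> \<nu>))"
  define A where "A = (\<Sum>\<nu>. w \<nu>)"
  define A2 where "A2 = (\<Sum>\<nu>. (w \<nu>)\<^sup>2)"
  define b where "b = bandwidth m lam"
  have b: "b > 0" using lam bandwidth_pos by (simp add: b_def)
  have w0: "0 < 1 + lam * \<gamma> \<nu>" "1 \<le> 1 + lam * \<gamma> \<nu>" for \<nu> using lam \<gamma>0[of \<nu>] by (auto intro!: add_pos_nonneg)
  then have wp: "0 < w \<nu>" and w1: "w \<nu> \<le> 1" for \<nu> by (auto simp: w_def)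
  have sw: "summable w" using sm by (simp add: w_def)
  have sw2: "summable (\<lambda>\<nu>. (w \<nu>)\<^sup>2)"
    using summable_square_of_unit_interval(1)[of w] wp w1 sw by (simp add: less_imp_le)
  have A: "A > 0" unfolding A_def by (rule suminf_pos[OF sw wp])
  have A2: "A2 > 0" unfolding A2_def by (rule suminf_pos[OF sw2]) (use zero_less_power[OF wp] in blast)
  have "sigmaK2 m lam \<gamma> = b * A"
    unfolding sigmaK2_def A_def suminf_mult[OF sw, symmetric] by (simp add: b_def w_def)
  moreover have "rhoK2 m lam \<gamma> = b * A2"
    unfolding rhoK2_def A2_def suminf_mult[OF sw2, symmetric] by (simp add: b_def w_def power_divide)
  ultimately have r: "rK m lam \<gamma> = A / A2" and u: "uK m lam \<gamma> = A\<^sup>2 / A2"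
    using b by (simp_all add: rK_def uK_def flip: b_def) (simp add: power2_eq_square field_simps)
  have "(2 * (A\<^sup>2 / A2)) powr (- 1 / 2) = 1 / sqrt (2 * (A\<^sup>2 / A2))"
    using A A2 by (simp add: powr_minus_divide powr_half_sqrt del: powr_half_sqrt_powr)
  also have "sqrt (2 * (A\<^sup>2 / A2)) = A / A2 * sqrt (2 * A2)"
  proof (rule real_sqrt_unique)
    show "(A / A2 * sqrt (2 * A2))\<^sup>2 = 2 * (A\<^sup>2 / A2)"
      using A A2 by (simp add: power_mult_distrib power_divide) (simp add: power2_eq_square)
  qed (use A A2 in simp)
  finally have p: "(2 * uK m lam \<gamma>) powr (- 1 / 2) = 1 / (A / A2 * sqrt (2 * A2))" using u by simp
  have "uK m lam \<gamma> = A / A2 * A" using u by (simp add: power2_eq_square)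
  then have "plrt_statistic M Z m lam \<gamma> n z y g0 W0 gh =
      1 / (A / A2 * sqrt (2 * A2)) * (A / A2 * (- 2 * real n * plrt m lam n z y g0 gh
         - real n * (pen_norm M Z m lam W0)\<^sup>2 - A))"
    unfolding plrt_statistic_def p r by (simp add: algebra_simps)
  also have "\<dots> = (- 2 * real n * plrt m lam n z y g0 gh - real n * (pen_norm M Z m lam W0)\<^sup>2 - A) / sqrt (2 * A2)"
    using A A2 by simp
  finally show ?thesis unfolding A_def A2_def w_def .
qed

text \<open>
  The first term under the root increases in \<open>b\<close> and the second decreases. At
  \<open>b = n powr (- 2 / (4 * m + 1))\<close> both equal the squared rate, so on either side of this value one of
  them is at least as large.
\<close>

lemma minimax_rate_le_separation_bound:
  assumes n: "n \<ge> 1" and b: "b > 0"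
  shows "minimax_rate m n \<le> separation_bound m n b"
proof -
  let ?q = "4 * real m + 1" and ?h = "real n powr (- 2 / (4 * real m + 1))"
  have n0: "real n > 0" using n by simp
  have h: "?h > 0" using n0 by simp
  have sq: "(minimax_rate m n)\<^sup>2 = real n powr (- 4 * real m / ?q)"
    using n0 by (simp add: minimax_rate_def power2_eq_square flip: powr_add) 
  have "(minimax_rate m n)\<^sup>2 \<le> b ^ (2 * m) + 1 / (real n * b powr (1 / 2))"
  proof (cases "b \<ge> ?h")
    case True
    have "(minimax_rate m n)\<^sup>2 = ?h ^ (2 * m)"
      using n0 by (simp add: sq powr_powr flip: powr_realpow)
    also have "\<dots> \<le> b ^ (2 * m)" using True h by (intro power_mono) auto
    also have "\<dots> \<le> b ^ (2 * m) + 1 / (real n * b powr (1 / 2))" using n0 b by simp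
    finally show ?thesis .
  next
    case False
    then have "b powr (1 / 2) \<le> ?h powr (1 / 2)" using b by (intro powr_mono2) auto
    then have "real n * b powr (1 / 2) \<le> real n powr 1 * ?h powr (1 / 2)" using n0 by simp
    also have "\<dots> = real n powr (1 + - 2 / ?q * (1 / 2))" unfolding powr_powr powr_add ..
    also have "1 + - 2 / ?q * (1 / 2) = 4 * real m / ?q"
      by (simp add: field_simps)
    finally have "1 / real n powr (4 * real m / ?q) \<le> 1 / (real n * b powr (1 / 2))"
      using n0 b by (intro divide_left_mono) auto
    moreover have "(minimax_rate m n)\<^sup>2 = 1 / real n powr (4 * real m / ?q)"
      by (simp add: sq flip: powr_minus_divide)
    ultimately show ?thesis using b zero_le_power[of b "2 * m"] by linarith
  qed
  then show ?thesis
    unfolding separation_bound_def by (rule real_le_rsqrt)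
qed

lemma separation_bound_optimal:
  assumes n: "n \<ge> 1"
  shows "separation_bound m n (optimal_bandwidth m n) = sqrt 2 * minimax_rate m n"
proof -
  let ?q = "4 * real m + 1"
  have n0: "real n > 0" using n by simp
  have sq: "(minimax_rate m n)\<^sup>2 = real n powr (- 4 * real m / ?q)"
    using n0 by (simp add: minimax_rate_def power2_eq_square flip: powr_add)
  have 1: "optimal_bandwidth m n ^ (2 * m) = (minimax_rate m n)\<^sup>2"
    using n0 by (simp add: optimal_bandwidth_def sq powr_powr flip: powr_realpow)
  have "real n * optimal_bandwidth m n powr (1 / 2) = real n powr 1 * real n powr (- 2 / ?q * (1 / 2))"
    using n0 by (simp add: optimal_bandwidth_def powr_powr)
  also have "\<dots> = real n powr (1 + - 2 / ?q * (1 / 2))" unfolding powr_add ..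
  also have "1 + - 2 / ?q * (1 / 2) = 4 * real m / ?q" by (simp add: field_simps)
  finally have 2: "1 / (real n * optimal_bandwidth m n powr (1 / 2)) = (minimax_rate m n)\<^sup>2"
    by (simp add: sq flip: powr_minus_divide)
  have "minimax_rate m n \<ge> 0" by (simp add: minimax_rate_def)
  then show ?thesis unfolding separation_bound_def 1 2 by (simp add: real_sqrt_mult)
qed

lemma same_order_separation_bound_optimal:
  "same_order (\<lambda>n. separation_bound m n (optimal_bandwidth m n)) (minimax_rate m)"
  unfolding same_order_def
proof (intro exI conjI)
  have "\<forall>\<^sub>F n in sequentially. separation_bound m n (optimal_bandwidth m n) / minimax_rate m n = sqrt 2"
    using eventually_ge_at_top[of 1]
    by eventually_elim (simp add: separation_bound_optimal minimax_rate_def)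
  then show "(\<lambda>n. separation_bound m n (optimal_bandwidth m n) / minimax_rate m n) \<longlonglongrightarrow> sqrt 2"
    by (rule tendsto_eventually)
qed simp

lemma optimal_exponent_admissible:
  assumes "m \<ge> 2"
  shows "1 / (2 * real m + 1) \<le> 2 / (4 * real m + 1)"
    and "2 / (4 * real m + 1) < 2 * real m / (8 * real m - 1)"
proof -
  have m: "real m \<ge> 2" using assms by simp
  show "1 / (2 * real m + 1) \<le> 2 / (4 * real m + 1)" using m by (simp add: field_simps)
  have "16 * real m \<le> 8 * real m * real m" using m by (intro mult_right_mono) auto
  then have "2 * (8 * real m - 1) < 8 * real m * real m + 2 * real m" using m by argo
  also have "\<dots> = 2 * real m * (4 * real m + 1)" by algebra
  finally have "2 * (8 * real m - 1) < 2 * real m * (4 * real m + 1)" .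
  moreover have "4 * real m + 1 > 0" "8 * real m - 1 > 0" using m by simp_all
  moreover have "2 / a < c / b" if "2 * b < c * a" "a > 0" "b > 0" for a b c :: real
    using that by (simp add: field_simps)
  ultimately show "2 / (4 * real m + 1) < 2 * real m / (8 * real m - 1)" by blast
qed

text \<open>
  The product \<open>n h\<^sup>3\<close> compares the fluctuation \<open>h powr (- 1 / 2)\<close> of the test statistic with the effect
  \<open>1 / (sqrt n * h\<^sup>2)\<close> of replacing the design distribution by the empirical one.
\<close>

lemma bandwidth_asymptotics:
  fixes h :: "nat \<Rightarrow> real"
  assumes ord: "same_order h (\<lambda>n. real n powr (- d))" and d: "0 < d" "d < 1 / 3"
  shows "\<forall>\<^sub>F n in sequentially. h n \<le> 1" and "\<forall>\<^sub>F n in sequentially. 1 \<le> real n * h n ^ 3"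
proof -
  obtain c where c: "c > 0" "(\<lambda>n. h n / real n powr (- d)) \<longlonglongrightarrow> c"
    using ord by (auto simp: same_order_def)
  have "(\<lambda>n. real n powr (- d)) \<longlonglongrightarrow> 0"
    using d by (intro tendsto_neg_powr filterlim_real_sequentially) auto
  then have "\<forall>\<^sub>F n in sequentially. real n powr (- d) < 1 / (2 * c)"
    using c by (intro order_tendstoD) auto
  moreover have "\<forall>\<^sub>F n in sequentially. h n / real n powr (- d) < 2 * c"
    using c by (intro order_tendstoD) auto
  moreover have n1: "\<forall>\<^sub>F n in sequentially. n \<ge> (1::nat)" by (rule eventually_ge_at_top)
  ultimately show "\<forall>\<^sub>F n in sequentially. h n \<le> 1"
  proof eventually_elim
    case (elim n)
    have p: "real n powr (- d) > 0" using elim by simp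
    have "h n < 2 * c * real n powr (- d)" using elim(2) p by (simp add: pos_divide_less_eq)
    also have "\<dots> < 2 * c * (1 / (2 * c))" using elim(1) c by (intro mult_strict_left_mono) auto
    finally show ?case using c by simp
  qed
  have "filterlim (\<lambda>n. real n powr (1 - 3 * d)) at_top sequentially"
    using d by real_asymp
  then have "\<forall>\<^sub>F n in sequentially. real n powr (1 - 3 * d) \<ge> 1 / (c / 2) ^ 3"
    by (auto simp: filterlim_at_top)
  moreover have "\<forall>\<^sub>F n in sequentially. c / 2 < h n / real n powr (- d)"
    using c by (intro order_tendstoD) auto
  ultimately show "\<forall>\<^sub>F n in sequentially. 1 \<le> real n * h n ^ 3" using n1
  proof eventually_elim
    case (elim n)
    have n0: "real n > 0" using elim by simp
    then have p: "real n powr (- d) > 0" by simp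
    have "c / 2 * real n powr (- d) \<le> h n" using elim(2) p by (simp add: pos_less_divide_eq less_imp_le)
    then have "(c / 2 * real n powr (- d)) ^ 3 \<le> h n ^ 3" using c by (intro power_mono) auto
    then have "real n * (c / 2 * real n powr (- d)) ^ 3 \<le> real n * h n ^ 3" using n0 by simp
    moreover have "real n * (c / 2 * real n powr (- d)) ^ 3 = (c / 2) ^ 3 * real n powr (1 - 3 * d)"
    proof -
      have "(real n powr (- d)) ^ 3 = real n powr (- d * 3)"
        using n0 by (simp add: powr_powr flip: powr_numeral)
      moreover have "real n powr (1 - 3 * d) = real n * real n powr (- d * 3)"
        using n0 by (simp only: powr_mult_base of_nat_0_le_iff) (simp add: mult.commute)
      moreover have "(c / 2 * real n powr (- d)) ^ 3 = (c / 2) ^ 3 * (real n powr (- d)) ^ 3"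
        by (rule power_mult_distrib)
      ultimately show ?thesis by (simp only: mult_ac)
    qed
    moreover have "(c / 2) ^ 3 * real n powr (1 - 3 * d) \<ge> 1"
      using elim(1) c by (simp add: field_simps)
    ultimately show ?case by linarith
  qed
qed


section \<open>Likelihood gain in penalized function spaces\<close>

definition lincomb_closed :: "(real \<Rightarrow> real) set \<Rightarrow> bool" where
  "lincomb_closed H \<longleftrightarrow> (\<forall>f\<in>H. \<forall>g\<in>H. \<forall>a b. (\<lambda>x. a * f x + b * g x) \<in> H)"

lemma sobolev_spaces_closed:
  assumes m: "m \<ge> 1" and H: "H = sobolev m \<or> H = sobolev_periodic m"
  shows "lincomb_closed H" and "H \<subseteq> sobolev m"
proof -
  have "sderiv j (\<lambda>x. a * f x + b * g x) 0 = sderiv j (\<lambda>x. a * f x + b * g x) 1"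
    if "f \<in> sobolev_periodic m" "g \<in> sobolev_periodic m" "j < m" for f g a b j
    using that by (auto simp: sobolev_periodic_def sderiv_lincomb)
  then show "lincomb_closed H"
    using H sobolev_lincomb[OF m] by (auto simp: lincomb_closed_def sobolev_periodic_def)
  show "H \<subseteq> sobolev m" using H by (auto simp: sobolev_periodic_def)
qed

locale penalized_space =
  fixes m :: nat and H :: "(real \<Rightarrow> real) set"
  assumes m2: "m \<ge> 2" and sobolev: "H \<subseteq> sobolev m" and closed: "lincomb_closed H"
begin

lemma lincomb: "f \<in> H \<Longrightarrow> g \<in> H \<Longrightarrow> (\<lambda>x. a * f x + b * g x) \<in> H"
  using closed by (auto simp: lincomb_closed_def)

lemma add: "f \<in> H \<Longrightarrow> g \<in> H \<Longrightarrow> (\<lambda>x. f x + g x) \<in> H"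
  using lincomb[of f g 1 1] by simp

lemma penJ_linear:
  "f \<in> H \<Longrightarrow> g \<in> H \<Longrightarrow> k \<in> H \<Longrightarrow> penJ m (\<lambda>x. a * f x + b * g x) k = a * penJ m f k + b * penJ m g k"
  using penJ_lincomb m2 sobolev by (meson le_trans one_le_numeral subsetD)

lemma penJ_square:
  assumes "f \<in> H" "g \<in> H"
  shows "penJ m (\<lambda>x. a * f x + b * g x) (\<lambda>x. a * f x + b * g x) =
    a\<^sup>2 * penJ m f f + 2 * a * b * penJ m f g + b\<^sup>2 * penJ m g g"
proof -
  let ?k = "\<lambda>x. a * f x + b * g x"
  have "penJ m ?k ?k = a * penJ m ?k f + b * penJ m ?k g"
    using penJ_linear[OF assms lincomb[OF assms]] by (simp add: penJ_commute)
  also have "\<dots> = a * (a * penJ m f f + b * penJ m f g) + b * (a * penJ m f g + b * penJ m g g)"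
    using penJ_linear[OF assms assms(1)] penJ_linear[OF assms assms(2)] by (simp add: penJ_commute[of m g f])
  finally show ?thesis by (simp add: power2_eq_square algebra_simps)
qed

text \<open>
  The parallelogram law, of which one diagonal is dropped.
\<close>

lemma penJ_add_le:
  assumes "f \<in> H" "g \<in> H"
  shows "penJ m (\<lambda>x. f x + g x) (\<lambda>x. f x + g x) \<le> 2 * penJ m f f + 2 * penJ m g g"
  using penJ_square[OF assms, of 1 1] penJ_square[OF assms, of 1 "-1"]
    penJ_nonneg[of m "\<lambda>x. 1 * f x + - 1 * g x"] by simp

lemma span:
  fixes hf :: "nat \<Rightarrow> real \<Rightarrow> real"
  assumes "\<And>\<nu>. hf \<nu> \<in> H" "f \<in> H"
  shows "(\<lambda>x. \<Sum>\<nu><k. c \<nu> * hf \<nu> x) \<in> H"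
    and "penJ m (\<lambda>x. \<Sum>\<nu><k. c \<nu> * hf \<nu> x) f = (\<Sum>\<nu><k. c \<nu> * penJ m (hf \<nu>) f)"
proof -
  have "(\<lambda>x. \<Sum>\<nu><k. c \<nu> * hf \<nu> x) \<in> H
    \<and> penJ m (\<lambda>x. \<Sum>\<nu><k. c \<nu> * hf \<nu> x) f = (\<Sum>\<nu><k. c \<nu> * penJ m (hf \<nu>) f)"
  proof (induction k)
    case 0
    show ?case using lincomb[OF assms(2,2), of 0 0] penJ_linear[OF assms(2,2,2), of 0 0] by simp
  next
    case (Suc k)
    then show ?case
      using lincomb[OF _ assms(1), of "\<lambda>x. \<Sum>\<nu><k. c \<nu> * hf \<nu> x" 1 "c k" k]
        penJ_linear[OF _ assms(1) assms(2), of "\<lambda>x. \<Sum>\<nu><k. c \<nu> * hf \<nu> x" 1 "c k" k] by simp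
  qed
  then show "(\<lambda>x. \<Sum>\<nu><k. c \<nu> * hf \<nu> x) \<in> H"
    and "penJ m (\<lambda>x. \<Sum>\<nu><k. c \<nu> * hf \<nu> x) f = (\<Sum>\<nu><k. c \<nu> * penJ m (hf \<nu>) f)" by auto
qed

lemma penJ_span_self:
  fixes hf :: "nat \<Rightarrow> real \<Rightarrow> real"
  assumes hf: "\<And>\<nu>. hf \<nu> \<in> H"
    and J: "\<And>\<mu> \<nu>. penJ m (hf \<mu>) (hf \<nu>) = (if \<mu> = \<nu> then \<gamma> \<mu> else 0)"
  shows "penJ m (\<lambda>x. \<Sum>\<nu><k. c \<nu> * hf \<nu> x) (\<lambda>x. \<Sum>\<nu><k. c \<nu> * hf \<nu> x) = (\<Sum>\<nu><k. (c \<nu>)\<^sup>2 * \<gamma> \<nu>)"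
proof -
  let ?S = "\<lambda>x. \<Sum>\<nu><k. c \<nu> * hf \<nu> x"
  have S: "?S \<in> H" by (rule span(1)[OF hf hf])
  have "penJ m ?S (hf \<mu>) = (\<Sum>\<nu><k. if \<nu> = \<mu> then c \<nu> * \<gamma> \<nu> else 0)" for \<mu>
    unfolding span(2)[OF hf hf] J by (intro sum.cong) auto
  then have "penJ m ?S (hf \<mu>) = c \<mu> * \<gamma> \<mu>" if "\<mu> < k" for \<mu>
    using that by (simp add: sum.delta)
  then have "penJ m (hf \<mu>) ?S = c \<mu> * \<gamma> \<mu>" if "\<mu> < k" for \<mu>
    using that by (simp add: penJ_commute[of m "hf \<mu>"])
  then show ?thesis
    unfolding span(2)[OF hf S] by (intro sum.cong) (auto simp: power2_eq_square)
qed

text \<open>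
  Bessel's inequality for the semi-inner product \<open>J\<close>. Subtracting from \<open>f\<close> the combination of the
  \<open>hf \<nu>\<close> with coefficients \<open>lam * J(f, hf \<nu>) / (1 + lam * \<gamma> \<nu>)\<close>, instead of the orthogonal projection, gives
  the weights that occur in the noise term of the penalty and avoids division by \<open>\<gamma> \<nu>\<close>, which vanishes
  when \<open>hf \<nu>\<close> is a polynomial of degree below \<open>m\<close>.
\<close>

lemma penalty_bessel:
  fixes hf :: "nat \<Rightarrow> real \<Rightarrow> real"
  assumes hf: "\<And>\<nu>. hf \<nu> \<in> H" and f: "f \<in> H"
    and J: "\<And>\<mu> \<nu>. penJ m (hf \<mu>) (hf \<nu>) = (if \<mu> = \<nu> then \<gamma> \<mu> else 0)"
    and lam: "lam > 0"
  shows "(\<Sum>\<nu><k. lam * (penJ m f (hf \<nu>) / (1 + lam * \<gamma> \<nu>))\<^sup>2) \<le> penJ m f f"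
proof -
  have \<gamma>: "\<gamma> \<nu> \<ge> 0" for \<nu> using J[of \<nu> \<nu>] penJ_nonneg[of m "hf \<nu>"] by simp
  define c where "c = (\<lambda>\<nu>. lam * penJ m f (hf \<nu>) / (1 + lam * \<gamma> \<nu>))"
  let ?S = "\<lambda>x. \<Sum>\<nu><k. c \<nu> * hf \<nu> x"
  have S: "?S \<in> H" by (rule span(1)[OF hf hf])
  have cm: "penJ m (hf \<nu>) f = penJ m f (hf \<nu>)" for \<nu> by (rule penJ_commute)
  have "0 \<le> penJ m (\<lambda>x. 1 * f x + (-1) * ?S x) (\<lambda>x. 1 * f x + (-1) * ?S x)"
    by (rule penJ_nonneg)
  also have "\<dots> = penJ m f f - 2 * penJ m ?S f + penJ m ?S ?S"
    unfolding penJ_square[OF f S] penJ_commute[of m f ?S] by simp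
  also have "\<dots> = penJ m f f - (\<Sum>\<nu><k. 2 * (c \<nu> * penJ m f (hf \<nu>)) - (c \<nu>)\<^sup>2 * \<gamma> \<nu>)"
    unfolding penJ_span_self[OF hf J] span(2)[OF hf f]
    by (simp add: sum_subtractf sum_distrib_left cm)
  finally have "(\<Sum>\<nu><k. 2 * (c \<nu> * penJ m f (hf \<nu>)) - (c \<nu>)\<^sup>2 * \<gamma> \<nu>) \<le> penJ m f f" by simp
  moreover have "lam * (penJ m f (hf \<nu>) / (1 + lam * \<gamma> \<nu>))\<^sup>2 \<le> 2 * (c \<nu> * penJ m f (hf \<nu>)) - (c \<nu>)\<^sup>2 * \<gamma> \<nu>" for \<nu>
  proof -
    define j where "j = penJ m f (hf \<nu>)"
    define t where "t = 1 + lam * \<gamma> \<nu>"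
    have t: "t \<ge> 1" using lam \<gamma> by (simp add: t_def)
    have c: "c \<nu> = lam * j / t" by (simp add: c_def j_def t_def)
    have "(c \<nu>)\<^sup>2 * \<gamma> \<nu> = lam * j\<^sup>2 / t\<^sup>2 * (t - 1)"
      by (simp add: c t_def power2_eq_square)
    moreover have "2 * (c \<nu> * j) = lam * j\<^sup>2 / t\<^sup>2 * (2 * t)"
      using t by (simp add: c power2_eq_square)
    moreover have "y - x = r * (t + 1)" if "x = r * (t - 1)" "y = r * (2 * t)" for r x y :: real
      using that by (simp add: algebra_simps)
    ultimately have "2 * (c \<nu> * j) - (c \<nu>)\<^sup>2 * \<gamma> \<nu> = lam * j\<^sup>2 / t\<^sup>2 * (t + 1)"
      by blast
    moreover have "lam * j\<^sup>2 / t\<^sup>2 * 1 \<le> lam * j\<^sup>2 / t\<^sup>2 * (t + 1)"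
      using lam t by (intro mult_left_mono) auto
    ultimately show ?thesis by (simp add: j_def t_def power_divide)
  qed
  then have "(\<Sum>\<nu><k. lam * (penJ m f (hf \<nu>) / (1 + lam * \<gamma> \<nu>))\<^sup>2)
      \<le> (\<Sum>\<nu><k. 2 * (c \<nu> * penJ m f (hf \<nu>)) - (c \<nu>)\<^sup>2 * \<gamma> \<nu>)"
    by (rule sum_mono)
  ultimately show ?thesis by (rule order_trans[rotated])
qed

text \<open>
  By definition of \<open>W\<close> the squared norm of \<open>W f\<close> is \<open>lam * J(f, W f)\<close>. Expanding \<open>J(f - W f, f - W f) \<ge> 0\<close>
  bounds twice this by \<open>lam * J(f, f) + lam * J(W f, W f)\<close>, and the last term is at most the squared
  norm of \<open>W f\<close> again.
\<close>

lemma penalty_operator_norm_le: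
  assumes W: "is_penalty_operator M Z m H lam W" and f: "f \<in> H" and lam: "lam > 0"
  shows "(pen_norm M Z m lam (W f))\<^sup>2 \<le> lam * penJ m f f"
proof -
  have Wf: "W f \<in> H" using W f by (simp add: is_penalty_operator_def)
  have e: "pen_inner M Z m lam (W f) (W f) = lam * penJ m f (W f)"
    using W f Wf unfolding is_penalty_operator_def by blast
  have c: "covV M Z (W f) (W f) \<ge> 0" by (simp add: covV_def)
  have p: "pen_inner M Z m lam (W f) (W f) \<ge> 0"
    using c lam penJ_nonneg[of m "W f"] by (simp add: pen_inner_def)
  have le: "lam * penJ m (W f) (W f) \<le> pen_inner M Z m lam (W f) (W f)"
    using c by (simp add: pen_inner_def)
  have "2 * penJ m f (W f) \<le> penJ m f f + penJ m (W f) (W f)"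
    using penJ_square[OF f Wf, of 1 "-1"] penJ_nonneg[of m "\<lambda>x. 1 * f x + - 1 * W f x"] by simp
  then have "lam * (2 * penJ m f (W f)) \<le> lam * (penJ m f f + penJ m (W f) (W f))"
    using lam by simp
  then have "2 * pen_inner M Z m lam (W f) (W f) \<le> lam * penJ m f f + lam * penJ m (W f) (W f)"
    unfolding e by (simp add: algebra_simps)
  then show ?thesis using le p by (simp add: pen_norm_def)
qed

text \<open>
  The gain in penalized likelihood from \<open>f0\<close> to the candidate \<open>G + S\<close>, when \<open>G = f0 + g\<close> is the regression
  function. The correction \<open>S\<close> is the truncated solution of the linearized score equation for the
  noise; its coefficients are chosen such that, for \<open>hf \<nu>\<close> orthonormal with respect to \<open>V\<close>, the linear
  term \<open>\<Sum> e S\<close> and the expected quadratic loss \<open>n (V(S, S) + lam * J(S, S))\<close> both equal \<open>U\<close>. So the noise contributes \<open>2 U - U = U\<close>, up to the difference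
  between the empirical and the expected value of \<open>S\<^sup>2\<close>. That difference is a quadratic form in the
  deviation of the empirical Gram matrix from the identity, and \<open>U * sqrt Q\<close> bounds it by the
  Cauchy-Schwarz inequality over pairs of indices.
\<close>

lemma loglik_gain:
  fixes hf :: "nat \<Rightarrow> real \<Rightarrow> real"
    and e z :: "nat \<Rightarrow> real" and k :: nat
  assumes hf: "\<And>\<nu>. hf \<nu> \<in> H" and f0: "f0 \<in> H" and g: "g \<in> H"
    and J: "\<And>\<mu> \<nu>. penJ m (hf \<mu>) (hf \<nu>) = (if \<mu> = \<nu> then \<gamma> \<mu> else 0)"
    and lam: "lam > 0" and n: "n \<ge> 1"
  defines "w \<equiv> \<lambda>\<nu>. 1 / (1 + lam * \<gamma> \<nu>)"
  defines "s \<equiv> \<lambda>\<nu>. \<Sum>i=1..n. e i * hf \<nu> (z i)"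
  defines "G \<equiv> \<lambda>t. f0 t + g t"
  defines "S \<equiv> \<lambda>t. \<Sum>\<nu><k. (w \<nu> * s \<nu> / real n) * hf \<nu> t"
  defines "U \<equiv> (\<Sum>\<nu><k. w \<nu> * (s \<nu>)\<^sup>2) / real n"
  defines "Q \<equiv> \<Sum>\<mu><k. \<Sum>\<nu><k. w \<mu> * w \<nu> *
      ((\<Sum>i=1..n. hf \<mu> (z i) * hf \<nu> (z i)) / real n - (if \<mu> = \<nu> then 1 else 0))\<^sup>2"
  shows "2 * real n * (pen_loglik m lam n z (\<lambda>i. G (z i) + e i) (\<lambda>t. G t + S t)
            - pen_loglik m lam n z (\<lambda>i. G (z i) + e i) f0)
    \<ge> U - U * sqrt Q + 2 * (\<Sum>i=1..n. e i * g (z i)) + (\<Sum>i=1..n. (g (z i))\<^sup>2)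
      - real n * lam * penJ m G G
      - 2 * lam * (\<Sum>i=1..n. e i * (\<Sum>\<nu><k. w \<nu> * penJ m G (hf \<nu>) * hf \<nu> (z i)))"
proof -
  have \<gamma>: "\<gamma> \<nu> \<ge> 0" for \<nu> using J[of \<nu> \<nu>] penJ_nonneg[of m "hf \<nu>"] by simp
  have n0: "real n > 0" using n by simp
  have w: "0 < w \<nu>" for \<nu> using lam \<gamma>[of \<nu>] by (auto simp: w_def intro!: divide_pos_pos add_pos_nonneg)
  define b where "b = (\<lambda>\<nu>. w \<nu> * s \<nu> / real n)"
  define D where "D = (\<lambda>\<mu> \<nu>. (\<Sum>i=1..n. hf \<mu> (z i) * hf \<nu> (z i)) / real n - (if \<mu> = \<nu> then 1 else 0))"
  have Q_D: "Q = (\<Sum>\<mu><k. \<Sum>\<nu><k. w \<mu> * w \<nu> * (D \<mu> \<nu>)\<^sup>2)" unfolding Q_def D_def ..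
  have S_b: "S = (\<lambda>t. \<Sum>\<nu><k. b \<nu> * hf \<nu> t)" by (simp add: S_def b_def)
  have SH: "S \<in> H" unfolding S_b by (rule span(1)[OF hf hf])
  have GH: "G \<in> H" unfolding G_def by (rule add[OF f0 g])
  have gain: "2 * real n * (pen_loglik m lam n z y f - pen_loglik m lam n z y f')
      = (\<Sum>i=1..n. (y i - f' (z i))\<^sup>2 - (y i - f (z i))\<^sup>2) - real n * lam * (penJ m f f - penJ m f' f')" for f f' y
  proof -
    have 1: "2 * real n * pen_loglik m lam n z y f = - (\<Sum>i=1..n. (y i - f (z i))\<^sup>2) - real n * lam * penJ m f f" for f
      using n0 by (simp add: pen_loglik_def loglik_def sum_negf sum_divide_distrib[symmetric] algebra_simps)
    show ?thesis unfolding right_diff_distrib 1 by (simp add: sum_subtractf algebra_simps)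
  qed
  have quad: "(\<Sum>i=1..n. (G (z i) + e i - f0 (z i))\<^sup>2 - (G (z i) + e i - (G (z i) + S (z i)))\<^sup>2)
      = 2 * (\<Sum>i=1..n. e i * g (z i)) + (\<Sum>i=1..n. (g (z i))\<^sup>2) + 2 * (\<Sum>i=1..n. e i * S (z i)) - (\<Sum>i=1..n. (S (z i))\<^sup>2)"
    unfolding sum_distrib_left sum.distrib[symmetric] sum_subtractf[symmetric]
    by (intro sum.cong refl) (simp add: G_def power2_eq_square algebra_simps)
  have eS: "(\<Sum>i=1..n. e i * S (z i)) = U"
  proof -
    have "(\<Sum>i=1..n. e i * S (z i)) = (\<Sum>\<nu><k. \<Sum>i=1..n. b \<nu> * (e i * hf \<nu> (z i)))"
      unfolding S_b sum_distrib_left by (subst sum.swap) (simp add: mult_ac)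
    also have "\<dots> = (\<Sum>\<nu><k. b \<nu> * s \<nu>)" by (simp add: s_def sum_distrib_left)
    finally show ?thesis by (simp add: b_def U_def sum_divide_distrib power2_eq_square mult_ac)
  qed
  have JS: "penJ m S S = (\<Sum>\<nu><k. (b \<nu>)\<^sup>2 * \<gamma> \<nu>)"
    unfolding S_b by (rule penJ_span_self[OF hf J])
  have ener: "real n * (\<Sum>\<nu><k. (b \<nu>)\<^sup>2) + real n * lam * penJ m S S = U"
  proof -
    have "real n * (b \<nu>)\<^sup>2 + real n * lam * ((b \<nu>)\<^sup>2 * \<gamma> \<nu>) = w \<nu> * (s \<nu>)\<^sup>2 / real n" for \<nu>
    proof -
      have "real n * (b \<nu>)\<^sup>2 + real n * lam * ((b \<nu>)\<^sup>2 * \<gamma> \<nu>) = real n * (b \<nu>)\<^sup>2 * (1 + lam * \<gamma> \<nu>)"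
        by (simp add: algebra_simps)
      also have "\<dots> = real n * (b \<nu>)\<^sup>2 / w \<nu>" by (simp add: w_def)
      also have "\<dots> = w \<nu> * (s \<nu>)\<^sup>2 / real n"
        using n0 w[of \<nu>] by (simp add: b_def power2_eq_square field_simps)
      finally show ?thesis .
    qed
    then show ?thesis
      unfolding JS U_def sum_divide_distrib by (simp add: sum_distrib_left flip: sum.distrib)
  qed
  have SS: "(\<Sum>i=1..n. (S (z i))\<^sup>2) = real n * (\<Sum>\<nu><k. (b \<nu>)\<^sup>2) + real n * (\<Sum>\<mu><k. \<Sum>\<nu><k. b \<mu> * b \<nu> * D \<mu> \<nu>)"
  proof -
    have "(\<Sum>i=1..n. (S (z i))\<^sup>2) = (\<Sum>i=1..n. \<Sum>\<mu><k. \<Sum>\<nu><k. b \<mu> * b \<nu> * (hf \<mu> (z i) * hf \<nu> (z i)))"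
      unfolding S_b power2_eq_square sum_product by (intro sum.cong refl) (simp add: mult_ac)
    also have "\<dots> = (\<Sum>\<mu><k. \<Sum>\<nu><k. b \<mu> * b \<nu> * (\<Sum>i=1..n. hf \<mu> (z i) * hf \<nu> (z i)))"
    proof -
      have "(\<Sum>i=1..n. \<Sum>\<mu><k. \<Sum>\<nu><k. b \<mu> * b \<nu> * (hf \<mu> (z i) * hf \<nu> (z i)))
          = (\<Sum>\<mu><k. \<Sum>i=1..n. \<Sum>\<nu><k. b \<mu> * b \<nu> * (hf \<mu> (z i) * hf \<nu> (z i)))"
        by (rule sum.swap)
      also have "\<dots> = (\<Sum>\<mu><k. \<Sum>\<nu><k. \<Sum>i=1..n. b \<mu> * b \<nu> * (hf \<mu> (z i) * hf \<nu> (z i)))"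
        by (intro sum.cong refl sum.swap)
      finally show ?thesis by (simp only: sum_distrib_left)
    qed
    also have "\<dots> = (\<Sum>\<mu><k. \<Sum>\<nu><k. real n * (b \<mu> * b \<nu> * D \<mu> \<nu>) + (if \<mu> = \<nu> then real n * (b \<nu>)\<^sup>2 else 0))"
      using n0 by (intro sum.cong refl) (simp add: D_def field_simps power2_eq_square)
    also have "\<dots> = real n * (\<Sum>\<mu><k. \<Sum>\<nu><k. b \<mu> * b \<nu> * D \<mu> \<nu>) + real n * (\<Sum>\<nu><k. (b \<nu>)\<^sup>2)"
      by (simp add: sum.distrib sum_distrib_left)
    finally show ?thesis by simp
  qed
  have Rle: "real n * (\<Sum>\<mu><k. \<Sum>\<nu><k. b \<mu> * b \<nu> * D \<mu> \<nu>) \<le> U * sqrt Q"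
  proof -
    let ?P = "{..<k} \<times> {..<k}"
    \<comment> \<open>Splitting the weights evenly between the two factors makes the sum of \<open>p\<^sup>2\<close> equal to \<open>(U / n)\<^sup>2\<close>
      and that of \<open>q\<^sup>2\<close> equal to \<open>Q\<close>.\<close>
    define p where "p = (\<lambda>(\<mu>, \<nu>). sqrt (w \<mu> * w \<nu>) * s \<mu> * s \<nu> / (real n)\<^sup>2)"
    define q where "q = (\<lambda>(\<mu>, \<nu>). sqrt (w \<mu> * w \<nu>) * D \<mu> \<nu>)"
    have "(\<Sum>\<mu><k. \<Sum>\<nu><k. b \<mu> * b \<nu> * D \<mu> \<nu>) = (\<Sum>x\<in>?P. p x * q x)"
      unfolding sum.cartesian_product
    proof (intro sum.cong refl)
      fix x :: "nat \<times> nat"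
      obtain \<mu> \<nu> where x: "x = (\<mu>, \<nu>)" by fastforce
      have "sqrt (w \<mu> * w \<nu>) * sqrt (w \<mu> * w \<nu>) = w \<mu> * w \<nu>"
        using w[of \<mu>] w[of \<nu>] by simp
      moreover have "p (\<mu>, \<nu>) * q (\<mu>, \<nu>) = (sqrt (w \<mu> * w \<nu>) * sqrt (w \<mu> * w \<nu>)) * s \<mu> * s \<nu> / (real n)\<^sup>2 * D \<mu> \<nu>"
        unfolding p_def q_def by simp
      ultimately show "(case x of (\<mu>, \<nu>) \<Rightarrow> b \<mu> * b \<nu> * D \<mu> \<nu>) = p x * q x"
        unfolding x by (simp add: b_def power2_eq_square)
    qed
    also have "\<dots> \<le> sqrt (\<Sum>x\<in>?P. (p x)\<^sup>2) * sqrt (\<Sum>x\<in>?P. (q x)\<^sup>2)"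
    proof -
      have "(\<Sum>x\<in>?P. p x * q x)\<^sup>2 \<le> (\<Sum>x\<in>?P. (p x)\<^sup>2) * (\<Sum>x\<in>?P. (q x)\<^sup>2)"
        by (rule Cauchy_Schwarz_ineq_sum)
      then have "(\<Sum>x\<in>?P. p x * q x) \<le> sqrt ((\<Sum>x\<in>?P. (p x)\<^sup>2) * (\<Sum>x\<in>?P. (q x)\<^sup>2))"
        by (rule real_le_rsqrt)
      then show ?thesis by (simp only: real_sqrt_mult)
    qed
    also have "(\<Sum>x\<in>?P. (q x)\<^sup>2) = Q"
      unfolding Q_D sum.cartesian_product q_def
      by (intro sum.cong refl) (use w in \<open>auto simp: power_mult_distrib less_imp_le\<close>)
    also have "(\<Sum>x\<in>?P. (p x)\<^sup>2) = (U / real n)\<^sup>2"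
    proof -
      have "(U / real n)\<^sup>2 = (\<Sum>\<mu><k. \<Sum>\<nu><k. (w \<mu> * (s \<mu>)\<^sup>2 / (real n)\<^sup>2) * (w \<nu> * (s \<nu>)\<^sup>2 / (real n)\<^sup>2))"
        unfolding sum_product[symmetric] U_def by (simp add: power2_eq_square sum_divide_distrib)
      also have "\<dots> = (\<Sum>x\<in>?P. (p x)\<^sup>2)"
        unfolding sum.cartesian_product p_def
        by (intro sum.cong refl)
           (use w in \<open>auto simp: power_mult_distrib power_divide less_imp_le power2_eq_square mult_ac\<close>)
      finally show ?thesis ..
    qed
    finally have "(\<Sum>\<mu><k. \<Sum>\<nu><k. b \<mu> * b \<nu> * D \<mu> \<nu>) \<le> U / real n * sqrt Q"
      using n0 w by (simp add: U_def sum_nonneg less_imp_le)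
    then show ?thesis using n0 by (simp add: field_simps)
  qed
  have JGS: "penJ m (\<lambda>t. G t + S t) (\<lambda>t. G t + S t) = penJ m G G + 2 * penJ m G S + penJ m S S"
    using penJ_square[OF GH SH, of 1 1] by simp
  have cross: "real n * penJ m G S = (\<Sum>i=1..n. e i * (\<Sum>\<nu><k. w \<nu> * penJ m G (hf \<nu>) * hf \<nu> (z i)))"
  proof -
    have "penJ m G S = (\<Sum>\<nu><k. b \<nu> * penJ m G (hf \<nu>))"
      unfolding S_b penJ_commute[of m G "\<lambda>t. \<Sum>\<nu><k. b \<nu> * hf \<nu> t"] penJ_commute[of m G "hf \<nu>" for \<nu>] by (rule span(2)[OF hf GH])
    then have "real n * penJ m G S = (\<Sum>\<nu><k. w \<nu> * penJ m G (hf \<nu>) * s \<nu>)"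
      using n0 by (simp add: b_def sum_distrib_left mult_ac)
    also have "\<dots> = (\<Sum>i=1..n. e i * (\<Sum>\<nu><k. w \<nu> * penJ m G (hf \<nu>) * hf \<nu> (z i)))"
      unfolding s_def sum_distrib_left by (subst sum.swap) (simp add: mult_ac)
    finally show ?thesis .
  qed
  have J0: "0 \<le> real n * lam * penJ m f0 f0" using n0 lam penJ_nonneg by simp
  have "2 * real n * (pen_loglik m lam n z (\<lambda>i. G (z i) + e i) (\<lambda>t. G t + S t)
            - pen_loglik m lam n z (\<lambda>i. G (z i) + e i) f0)
    = 2 * (\<Sum>i=1..n. e i * g (z i)) + (\<Sum>i=1..n. (g (z i))\<^sup>2) + 2 * U - (\<Sum>i=1..n. (S (z i))\<^sup>2)
      - real n * lam * (penJ m G G + 2 * penJ m G S + penJ m S S - penJ m f0 f0)"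
    unfolding gain quad eS JGS ..
  also have "\<dots> = 2 * (\<Sum>i=1..n. e i * g (z i)) + (\<Sum>i=1..n. (g (z i))\<^sup>2) + U
      - real n * (\<Sum>\<mu><k. \<Sum>\<nu><k. b \<mu> * b \<nu> * D \<mu> \<nu>)
      - real n * lam * penJ m G G - 2 * lam * (real n * penJ m G S) + real n * lam * penJ m f0 f0"
    unfolding SS using ener by (simp add: algebra_simps)
  finally show ?thesis
    unfolding cross[symmetric] using Rle J0 by linarith
qed

end


section \<open>Moments and measurability in the regression model\<close>

text \<open>
  The regression functions are continuous on the unit interval and arbitrary outside it. Composition
  with the retraction \<open>clamp01\<close> makes them continuous, hence Borel measurable, on the whole line without
  changing their values at the covariates.
\<close>

definition clamp01 :: "real \<Rightarrow> real" where
  "clamp01 x = max 0 (min 1 x)"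

lemma clamp01_in: "clamp01 x \<in> {0..1}"
  by (simp add: clamp01_def)

lemma clamp01_id: "x \<in> {0..1} \<Longrightarrow> clamp01 x = x"
  by (simp add: clamp01_def)

lemma continuous_on_clamp01:
  assumes "continuous_on {0..1} f"
  shows "continuous_on UNIV (\<lambda>x. f (clamp01 x))"
  by (rule continuous_on_compose2[OF assms])
    (auto simp: clamp01_def intro!: continuous_intros)

lemma continuous_unit_bounded:
  fixes f :: "real \<Rightarrow> real"
  assumes "continuous_on {0..1} f"
  obtains b where "\<And>x. x \<in> {0..1} \<Longrightarrow> \<bar>f x\<bar> \<le> b"
proof -
  have "bounded (f ` {0..1})"
    by (rule compact_imp_bounded[OF compact_continuous_image[OF assms]]) simp
  then obtain b where "\<forall>y\<in>f ` {0..1}. norm y \<le> b" unfolding bounded_iff by blast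
  then show thesis by (intro that[of b]) auto
qed

context regression_model begin

abbreviation "obs \<equiv> \<lambda>i \<omega>. (Zs i \<omega>, es i \<omega>)"
abbreviation "law \<equiv> distr M borel (\<lambda>\<omega>. (Z \<omega>, e \<omega>))"

sublocale sample: iid_sample M borel law obs
  by unfold_locales (use indep ident in auto)

lemma e_square_integrable: "integrable M (\<lambda>\<omega>. (e \<omega>)\<^sup>2)"
proof -
  note [measurable] = e_measurable
  have "integrable M (\<lambda>\<omega>. ((e \<omega>)\<^sup>2)\<^sup>2)" using e4_integrable by simp
  then show ?thesis by (rule square_integrable_imp_integrable[rotated]) simp
qed

lemma e_integrable: "integrable M e"
  by (rule square_integrable_imp_integrable[OF e_measurable e_square_integrable])

lemma design_measurable:
  assumes "continuous_on {0..1} f"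
  shows "(\<lambda>\<omega>. (f (Z \<omega>) :: real)) \<in> borel_measurable (vimage_algebra (space M) Z borel)"
    and "(\<lambda>\<omega>. f (Z \<omega>)) \<in> borel_measurable M"
proof -
  have f: "(\<lambda>x. f (clamp01 x)) \<in> borel_measurable borel"
    by (rule borel_measurable_continuous_onI[OF continuous_on_clamp01[OF assms]])
  have "Z \<in> measurable (vimage_algebra (space M) Z borel) borel"
    by (rule measurable_vimage_algebra1) simp
  from measurable_compose[OF this f]
  show "(\<lambda>\<omega>. f (Z \<omega>)) \<in> borel_measurable (vimage_algebra (space M) Z borel)"
    by (rule measurable_cong[THEN iffD1, rotated]) (simp add: clamp01_id[OF Z_unit])
  from measurable_compose[OF Z_measurable f]
  show "(\<lambda>\<omega>. f (Z \<omega>)) \<in> borel_measurable M"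
    by (rule measurable_cong[THEN iffD1, rotated]) (simp add: clamp01_id[OF Z_unit])
qed

lemma integrable_times_design:
  fixes f :: "real \<Rightarrow> real"
  assumes f: "continuous_on {0..1} f" and u: "integrable M u"
  shows "integrable M (\<lambda>\<omega>. u \<omega> * f (Z \<omega>))"
proof -
  obtain b where b: "\<And>x. x \<in> {0..1} \<Longrightarrow> \<bar>f x\<bar> \<le> b"
    using continuous_unit_bounded[OF f] by blast
  have um: "u \<in> borel_measurable M" using u by simp
  show ?thesis
  proof (rule Bochner_Integration.integrable_bound)
    show "integrable M (\<lambda>\<omega>. b * u \<omega>)" using u by simp
    show "(\<lambda>\<omega>. u \<omega> * f (Z \<omega>)) \<in> borel_measurable M"
      using um design_measurable(2)[OF f] by (rule borel_measurable_times)
    show "AE \<omega> in M. norm (u \<omega> * f (Z \<omega>)) \<le> norm (b * u \<omega>)"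
    proof (rule AE_I2)
      fix \<omega> assume "\<omega> \<in> space M"
      then have "\<bar>f (Z \<omega>)\<bar> \<le> \<bar>b\<bar>" using b[OF Z_unit] by fastforce
      then show "norm (u \<omega> * f (Z \<omega>)) \<le> norm (b * u \<omega>)"
        using mult_right_mono[of "\<bar>f (Z \<omega>)\<bar>" "\<bar>b\<bar>" "\<bar>u \<omega>\<bar>"] by (simp add: abs_mult mult.commute)
    qed
  qed
qed

lemma integrable_design:
  fixes f :: "real \<Rightarrow> real"
  assumes "continuous_on {0..1} f"
  shows "integrable M (\<lambda>\<omega>. f (Z \<omega>))"
  using integrable_times_design[OF assms, of "\<lambda>_. 1"] by simp

text \<open>
  The defining property of the conditional expectation, as \<open>f (Z)\<close> is measurable with respect to the
  sigma-algebra generated by \<open>Z\<close>.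
\<close>

lemma noise_cond_moment:
  fixes f :: "real \<Rightarrow> real"
  assumes f: "continuous_on {0..1} f" and u: "integrable M u"
    and c: "AE \<omega> in M. real_cond_exp M (vimage_algebra (space M) Z borel) u \<omega> = c"
  shows "(\<integral>\<omega>. u \<omega> * f (Z \<omega>) \<partial>M) = c * (\<integral>\<omega>. f (Z \<omega>) \<partial>M)"
proof -
  let ?F = "vimage_algebra (space M) Z borel"
  have "subalgebra M ?F"
    unfolding subalgebra_def using Z_measurable by (auto simp: sets_vimage_algebra2 measurable_sets)
  then interpret finite_measure_subalgebra M ?F
    by unfold_locales
  have fu: "integrable M (\<lambda>\<omega>. f (Z \<omega>) * u \<omega>)"
    using integrable_times_design[OF f u] by (simp add: mult.commute)
  have "(\<integral>\<omega>. f (Z \<omega>) * u \<omega> \<partial>M) = (\<integral>\<omega>. f (Z \<omega>) * real_cond_exp M ?F u \<omega> \<partial>M)"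
    using real_cond_exp_intg(2)[OF fu design_measurable(1)[OF f]] u by simp
  also have "\<dots> = (\<integral>\<omega>. f (Z \<omega>) * c \<partial>M)"
  proof (rule integral_cong_AE)
    show "(\<lambda>\<omega>. f (Z \<omega>) * real_cond_exp M ?F u \<omega>) \<in> borel_measurable M"
      using design_measurable(2)[OF f] by (intro borel_measurable_times) auto
    show "(\<lambda>\<omega>. f (Z \<omega>) * c) \<in> borel_measurable M"
      using design_measurable(2)[OF f] by simp
    show "AE \<omega> in M. f (Z \<omega>) * real_cond_exp M ?F u \<omega> = f (Z \<omega>) * c"
      using c by eventually_elim simp
  qed
  finally show ?thesis by (simp add: mult.commute)
qed

lemma has_integral_law:
  fixes \<phi> :: "real \<times> real \<Rightarrow> real"
  assumes \<phi>: "\<phi> \<in> borel_measurable borel"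
    and b: "has_bochner_integral M (\<lambda>\<omega>. \<phi> (Z \<omega>, e \<omega>)) b"
  shows "has_bochner_integral law \<phi> b"
proof -
  have "(\<lambda>\<omega>. (Z \<omega>, e \<omega>)) \<in> measurable M borel"
    using Z_measurable e_measurable by (simp add: borel_prod[symmetric])
  then show ?thesis using b \<phi>
    by (simp add: has_bochner_integral_iff integrable_distr_eq integral_distr)
qed

lemma has_integral_law_monomial:
  fixes f :: "real \<Rightarrow> real"
  assumes f: "continuous_on {0..1} f"
    and b: "has_bochner_integral M (\<lambda>\<omega>. e \<omega> ^ j * f (Z \<omega>)) b"
  shows "has_bochner_integral law (\<lambda>x. snd x ^ j * f (clamp01 (fst x))) b"
proof (rule has_integral_law)
  have "(\<lambda>x. f (clamp01 x)) \<in> borel_measurable borel"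
    by (rule borel_measurable_continuous_onI[OF continuous_on_clamp01[OF f]])
  then have [measurable]: "(\<lambda>x::real \<times> real. f (clamp01 (fst x))) \<in> borel_measurable (borel \<Otimes>\<^sub>M borel)"
    by measurable
  show "(\<lambda>x::real \<times> real. snd x ^ j * f (clamp01 (fst x))) \<in> borel_measurable borel"
    unfolding borel_prod[symmetric] by measurable
  show "has_bochner_integral M (\<lambda>\<omega>. snd (Z \<omega>, e \<omega>) ^ j * f (clamp01 (fst (Z \<omega>, e \<omega>)))) b"
    using b by (rule has_bochner_integral_cong[THEN iffD1, rotated 3]) (simp_all add: clamp01_id[OF Z_unit])
qed

lemma has_integral_law_design:
  fixes f :: "real \<Rightarrow> real"
  assumes f: "continuous_on {0..1} f"
  shows "has_bochner_integral law (\<lambda>x. f (clamp01 (fst x))) (\<integral>\<omega>. f (Z \<omega>) \<partial>M)"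
  using has_integral_law_monomial[OF f, of 0] integrable_design[OF f]
  by (simp add: has_bochner_integral_iff)

lemma has_integral_law_noise:
  fixes f :: "real \<Rightarrow> real"
  assumes f: "continuous_on {0..1} f"
  shows "has_bochner_integral law (\<lambda>x. snd x * f (clamp01 (fst x))) 0"
    and "has_bochner_integral law (\<lambda>x. (snd x)\<^sup>2 * f (clamp01 (fst x))) (\<integral>\<omega>. f (Z \<omega>) \<partial>M)"
proof -
  show "has_bochner_integral law (\<lambda>x. snd x * f (clamp01 (fst x))) 0"
    using has_integral_law_monomial[OF f, of 1] integrable_times_design[OF f e_integrable]
      noise_cond_moment[OF f e_integrable cond_mean]
    by (simp add: has_bochner_integral_iff)
  show "has_bochner_integral law (\<lambda>x. (snd x)\<^sup>2 * f (clamp01 (fst x))) (\<integral>\<omega>. f (Z \<omega>) \<partial>M)"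
    using has_integral_law_monomial[OF f, of 2] integrable_times_design[OF f e_square_integrable]
      noise_cond_moment[OF f e_square_integrable cond_var]
    by (simp add: has_bochner_integral_iff)
qed

lemma noise_sum_second_moment:
  fixes f :: "real \<Rightarrow> real"
  assumes f: "continuous_on {0..1} f"
  shows "has_bochner_integral M (\<lambda>\<omega>. (\<Sum>i=1..n. es i \<omega> * f (Zs i \<omega>))\<^sup>2) (real n * covV M Z f f)"
proof -
  have f2: "continuous_on {0..1} (\<lambda>x. f x * f x)" using f by (intro continuous_intros)
  have sq: "has_bochner_integral law (\<lambda>x. (snd x * f (clamp01 (fst x)))\<^sup>2) (covV M Z f f)"
    using has_integral_law_noise(2)[OF f2] by (simp add: covV_def power2_eq_square mult_ac)
  have "has_bochner_integral M (\<lambda>\<omega>. (\<Sum>i=1..n. snd (obs i \<omega>) * f (clamp01 (fst (obs i \<omega>))))\<^sup>2) (real n * covV M Z f f)"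
    by (rule sample.has_integral_square[OF has_integral_law_noise(1)[OF f] sq])
  then show ?thesis
    by (rule has_bochner_integral_cong[THEN iffD1, rotated 3]) (simp_all add: clamp01_id[OF Zs_unit])
qed

lemma design_sum_second_moment:
  fixes f :: "real \<Rightarrow> real"
  assumes f: "continuous_on {0..1} f"
  defines "v \<equiv> \<integral>\<omega>. f (Z \<omega>) \<partial>M"
  shows "has_bochner_integral M (\<lambda>\<omega>. ((\<Sum>i=1..n. f (Zs i \<omega>)) - real n * v)\<^sup>2)
    (real n * (\<integral>\<omega>. (f (Z \<omega>) - v)\<^sup>2 \<partial>M))"
proof -
  have f1: "continuous_on {0..1} (\<lambda>x. f x - v)" using f by (intro continuous_intros)
  have f2: "continuous_on {0..1} (\<lambda>x. (f x - v)\<^sup>2)" using f by (intro continuous_intros)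
  have "(\<integral>\<omega>. f (Z \<omega>) - v \<partial>M) = 0"
    using integrable_design[OF f] by (simp add: v_def prob_space)
  then have 0: "has_bochner_integral law (\<lambda>x. f (clamp01 (fst x)) - v) 0"
    using has_integral_law_design[OF f1] by simp
  have "has_bochner_integral M (\<lambda>\<omega>. (\<Sum>i=1..n. f (clamp01 (fst (obs i \<omega>))) - v)\<^sup>2)
      (real n * (\<integral>\<omega>. (f (Z \<omega>) - v)\<^sup>2 \<partial>M))"
    by (rule sample.has_integral_square[OF 0 has_integral_law_design[OF f2]])
  then show ?thesis
    by (rule has_bochner_integral_cong[THEN iffD1, rotated 3]) (simp_all add: clamp01_id[OF Zs_unit] sum_subtractf)
qed

lemma design_variance_le:
  fixes f :: "real \<Rightarrow> real"
  assumes f: "continuous_on {0..1} f" and b: "\<And>x. x \<in> {0..1} \<Longrightarrow> \<bar>f x\<bar> \<le> b"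
  shows "(\<integral>\<omega>. (f (Z \<omega>) - (\<integral>\<omega>. f (Z \<omega>) \<partial>M))\<^sup>2 \<partial>M) \<le> b\<^sup>2"
proof -
  have f2: "continuous_on {0..1} (\<lambda>x. (f x)\<^sup>2)" using f by (intro continuous_intros)
  have "variance (\<lambda>\<omega>. f (Z \<omega>)) = expectation (\<lambda>\<omega>. (f (Z \<omega>))\<^sup>2) - (expectation (\<lambda>\<omega>. f (Z \<omega>)))\<^sup>2"
    by (rule variance_eq[OF integrable_design[OF f] integrable_design[OF f2]])
  also have "\<dots> \<le> expectation (\<lambda>\<omega>. (f (Z \<omega>))\<^sup>2)" by simp
  also have "\<dots> \<le> expectation (\<lambda>\<omega>. b\<^sup>2)"
  proof (rule integral_mono[OF integrable_design[OF f2]])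
    fix \<omega> assume "\<omega> \<in> space M"
    then show "(f (Z \<omega>))\<^sup>2 \<le> b\<^sup>2" using b[OF Z_unit] by (metis abs_ge_zero power2_abs power_mono)
  qed simp
  finally show ?thesis by (simp add: prob_space)
qed

text \<open>
  The scores \<open>e * hf \<nu> (Z)\<close> are centred and orthonormal, so the chi-square moment formula applies. The
  contribution of single observations is bounded crudely: their weighted sum of squares is at most
  \<open>A * e\<^sup>2 * B\<^sup>2\<close>, and \<open>(y - A)\<^sup>2 \<le> y\<^sup>2 + A\<^sup>2\<close> for \<open>y \<ge> 0\<close>.
\<close>

lemma weighted_noise_energy_variance:
  fixes hf :: "nat \<Rightarrow> real \<Rightarrow> real" and w :: "nat \<Rightarrow> real" and k n :: nat
  assumes hf: "\<And>\<nu>. continuous_on {0..1} (hf \<nu>)"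
    and bd: "\<And>\<nu> z. z \<in> {0..1} \<Longrightarrow> \<bar>hf \<nu> z\<bar> \<le> B"
    and V: "\<And>\<mu> \<nu>. covV M Z (hf \<mu>) (hf \<nu>) = (if \<mu> = \<nu> then 1 else 0)"
    and w: "\<And>\<nu>. 0 \<le> w \<nu>" "\<And>\<nu>. w \<nu> \<le> 1"
  defines "A \<equiv> \<Sum>\<nu><k. w \<nu>"
  obtains b where "has_bochner_integral M
      (\<lambda>\<omega>. ((\<Sum>\<nu><k. w \<nu> * (\<Sum>i=1..n. es i \<omega> * hf \<nu> (Zs i \<omega>))\<^sup>2) - real n * A)\<^sup>2) b"
    and "b \<le> 2 * (real n)\<^sup>2 * A + real n * (A\<^sup>2 * (B ^ 4 * expectation (\<lambda>\<omega>. e \<omega> ^ 4) + 1))"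
proof -
  define \<phi> where "\<phi> = (\<lambda>\<nu> (x::real\<times>real). snd x * hf \<nu> (clamp01 (fst x)))"
  define q where "q = (\<lambda>x. ((\<Sum>\<nu><k. w \<nu> * (\<phi> \<nu> x)\<^sup>2) - A)\<^sup>2)"
  have mean: "has_bochner_integral law (\<phi> \<nu>) 0" for \<nu>
    unfolding \<phi>_def by (rule has_integral_law_noise(1)[OF hf])
  have orth: "has_bochner_integral law (\<lambda>x. \<phi> \<mu> x * \<phi> \<nu> x) (if \<mu> = \<nu> then 1 else 0)" for \<mu> \<nu>
  proof -
    have "continuous_on {0..1} (\<lambda>x. hf \<mu> x * hf \<nu> x)" using hf by (intro continuous_intros)
    from has_integral_law_noise(2)[OF this]
    show ?thesis using V[of \<mu> \<nu>] by (simp add: \<phi>_def covV_def power2_eq_square mult_ac)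
  qed
  have A0: "A \<ge> 0" unfolding A_def by (intro sum_nonneg w)
  have qM: "q \<in> borel_measurable law"
    unfolding q_def using borel_measurable_has_bochner_integral[OF mean] by measurable
  have e4: "has_bochner_integral law (\<lambda>x. snd x ^ 4 * 1) (expectation (\<lambda>\<omega>. e \<omega> ^ 4))"
    using has_integral_law_monomial[of "\<lambda>_. 1" 4] e4_integrable by (simp add: has_bochner_integral_iff)
  define r where "r = (\<lambda>x::real\<times>real. A\<^sup>2 * (B ^ 4 * snd x ^ 4 + 1))"
  interpret law: prob_space law
    by (rule prob_space_distr) (use Z_measurable e_measurable in \<open>simp add: borel_prod[symmetric]\<close>)
  have rI: "has_bochner_integral law r (A\<^sup>2 * (B ^ 4 * expectation (\<lambda>\<omega>. e \<omega> ^ 4) + 1))"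
  proof -
    have "has_bochner_integral law (\<lambda>x. 1) (1::real)"
      using law.prob_space by (simp add: has_bochner_integral_iff)
    with e4 show ?thesis
      unfolding r_def by (intro has_bochner_integral_mult_right has_bochner_integral_add) auto
  qed
  have qr: "q x \<le> r x" for x
  proof -
    let ?y = "\<Sum>\<nu><k. w \<nu> * (\<phi> \<nu> x)\<^sup>2"
    have y0: "0 \<le> ?y" by (intro sum_nonneg mult_nonneg_nonneg w) auto
    have "?y \<le> (\<Sum>\<nu><k. w \<nu> * ((snd x)\<^sup>2 * B\<^sup>2))"
    proof (intro sum_mono mult_left_mono w)
      fix \<nu>
      have "\<bar>hf \<nu> (clamp01 (fst x))\<bar>\<^sup>2 \<le> B\<^sup>2" by (intro power_mono bd clamp01_in) auto
      then show "(\<phi> \<nu> x)\<^sup>2 \<le> (snd x)\<^sup>2 * B\<^sup>2"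
        by (simp add: \<phi>_def power_mult_distrib mult_left_mono)
    qed
    also have "\<dots> = A * (snd x)\<^sup>2 * B\<^sup>2" by (simp only: A_def sum_distrib_right mult.assoc)
    finally have "?y \<le> A * (snd x)\<^sup>2 * B\<^sup>2" .
    then have "?y\<^sup>2 \<le> (A * (snd x)\<^sup>2 * B\<^sup>2)\<^sup>2" using y0 by (rule power_mono)
    also have "\<dots> = A\<^sup>2 * (B ^ 4 * snd x ^ 4)"
      by (simp add: power_mult_distrib flip: power_mult)
    finally have "?y\<^sup>2 \<le> A\<^sup>2 * (B ^ 4 * snd x ^ 4)" .
    moreover have "(?y - A)\<^sup>2 \<le> ?y\<^sup>2 + A\<^sup>2" using y0 A0 by (simp add: power2_diff)
    ultimately show ?thesis by (simp add: q_def r_def algebra_simps)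
  qed
  have q0: "0 \<le> q x" for x by (simp add: q_def)
  have qi: "integrable law q"
  proof (rule Bochner_Integration.integrable_bound[OF _ qM])
    show "integrable law r" using rI by (simp add: has_bochner_integral_iff)
    have "norm (q x) \<le> norm (r x)" for x using qr[of x] q0[of x] by simp
    then show "AE x in law. norm (q x) \<le> norm (r x)" by (rule AE_I2)
  qed
  have fourth: "has_bochner_integral law q (integral\<^sup>L law q)"
    using qi by (rule has_bochner_integral_integrable)
  have qle: "integral\<^sup>L law q \<le> A\<^sup>2 * (B ^ 4 * expectation (\<lambda>\<omega>. e \<omega> ^ 4) + 1)"
    using integral_mono[OF qi, of r] rI qr by (simp add: has_bochner_integral_iff)
  have ww: "(\<Sum>\<nu><k. (w \<nu>)\<^sup>2) \<le> A"
    unfolding A_def using w mult_left_le by (intro sum_mono) (auto simp: power2_eq_square)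
  have ww0: "0 \<le> (\<Sum>\<nu><k. (w \<nu>)\<^sup>2)" by (intro sum_nonneg) auto
  note chi = sample.has_integral_chi_square[where n = n, OF mean orth fourth[unfolded q_def A_def], folded A_def]
  show thesis
  proof (rule that)
    show "has_bochner_integral M
      (\<lambda>\<omega>. ((\<Sum>\<nu><k. w \<nu> * (\<Sum>i=1..n. es i \<omega> * hf \<nu> (Zs i \<omega>))\<^sup>2) - real n * A)\<^sup>2)
      (2 * real n * (real n - 1) * (\<Sum>\<nu><k. (w \<nu>)\<^sup>2) + real n * integral\<^sup>L law q)"
      using chi unfolding q_def[symmetric] A_def[symmetric]
      by (rule has_bochner_integral_cong[THEN iffD1, rotated 3]) (simp_all add: \<phi>_def clamp01_id[OF Zs_unit])
    have "real n * (real n - 1) \<le> (real n)\<^sup>2" by (simp add: power2_eq_square algebra_simps)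
    then have "2 * (real n * (real n - 1)) * (\<Sum>\<nu><k. (w \<nu>)\<^sup>2) \<le> 2 * (real n)\<^sup>2 * (\<Sum>\<nu><k. (w \<nu>)\<^sup>2)"
      using ww0 by (intro mult_right_mono) auto
    also have "\<dots> \<le> 2 * (real n)\<^sup>2 * A" using ww by (intro mult_left_mono) auto
    finally have "2 * (real n * (real n - 1)) * (\<Sum>\<nu><k. (w \<nu>)\<^sup>2) \<le> 2 * (real n)\<^sup>2 * A" .
    moreover have "real n * integral\<^sup>L law q \<le> real n * (A\<^sup>2 * (B ^ 4 * expectation (\<lambda>\<omega>. e \<omega> ^ 4) + 1))"
      using qle by (intro mult_left_mono) auto
    ultimately show "2 * real n * (real n - 1) * (\<Sum>\<nu><k. (w \<nu>)\<^sup>2) + real n * integral\<^sup>L law q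
      \<le> 2 * (real n)\<^sup>2 * A + real n * (A\<^sup>2 * (B ^ 4 * expectation (\<lambda>\<omega>. e \<omega> ^ 4) + 1))"
      by (simp add: mult.assoc)
  qed
qed

text \<open>
  Every entry of the empirical Gram matrix is a mean of \<open>n\<close> independent variables bounded by \<open>B\<^sup>2\<close>.
\<close>

lemma gram_deviation_moment:
  fixes hf :: "nat \<Rightarrow> real \<Rightarrow> real" and w :: "nat \<Rightarrow> real"
  assumes hf: "\<And>\<nu>. continuous_on {0..1} (hf \<nu>)"
    and bd: "\<And>\<nu> z. z \<in> {0..1} \<Longrightarrow> \<bar>hf \<nu> z\<bar> \<le> B"
    and V: "\<And>\<mu> \<nu>. covV M Z (hf \<mu>) (hf \<nu>) = (if \<mu> = \<nu> then 1 else 0)"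
    and w: "\<And>\<nu>. 0 \<le> w \<nu>" and n: "n \<ge> 1"
  obtains b where "has_bochner_integral M (\<lambda>\<omega>. \<Sum>\<mu><k. \<Sum>\<nu><k. w \<mu> * w \<nu> *
      ((\<Sum>i=1..n. hf \<mu> (Zs i \<omega>) * hf \<nu> (Zs i \<omega>)) / real n - (if \<mu> = \<nu> then 1 else 0))\<^sup>2) b"
    and "b \<le> (\<Sum>\<nu><k. w \<nu>)\<^sup>2 * B ^ 4 / real n"
proof -
  have n0: "real n > 0" using n by simp
  define \<delta> :: "nat \<Rightarrow> nat \<Rightarrow> real" where "\<delta> = (\<lambda>\<mu> \<nu>. if \<mu> = \<nu> then 1 else 0)"
  define c where "c = (\<lambda>\<mu> \<nu>. \<integral>\<omega>. (hf \<mu> (Z \<omega>) * hf \<nu> (Z \<omega>) - \<delta> \<mu> \<nu>)\<^sup>2 \<partial>M)"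
  have cont: "continuous_on {0..1} (\<lambda>x. hf \<mu> x * hf \<nu> x)" for \<mu> \<nu>
    using hf by (intro continuous_intros)
  have v: "(\<integral>\<omega>. hf \<mu> (Z \<omega>) * hf \<nu> (Z \<omega>) \<partial>M) = \<delta> \<mu> \<nu>" for \<mu> \<nu>
    using V[of \<mu> \<nu>] by (simp add: covV_def \<delta>_def)
  have c_le: "c \<mu> \<nu> \<le> B ^ 4" for \<mu> \<nu>
  proof -
    have "\<bar>hf \<mu> x * hf \<nu> x\<bar> \<le> B * B" if "x \<in> {0..1}" for x
      unfolding abs_mult using bd[OF that, of \<mu>] bd[OF that, of \<nu>] by (intro mult_mono) auto
    from design_variance_le[OF cont this]
    have "c \<mu> \<nu> \<le> (B * B)\<^sup>2" unfolding v c_def by simp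
    also have "\<dots> = B ^ 4" by (simp add: power2_eq_square power4_eq_xxxx)
    finally show ?thesis .
  qed
  have one: "has_bochner_integral M
     (\<lambda>\<omega>. ((\<Sum>i=1..n. hf \<mu> (Zs i \<omega>) * hf \<nu> (Zs i \<omega>)) / real n - \<delta> \<mu> \<nu>)\<^sup>2) (c \<mu> \<nu> / real n)" for \<mu> \<nu>
  proof -
    let ?s = "\<lambda>\<omega>. \<Sum>i=1..n. hf \<mu> (Zs i \<omega>) * hf \<nu> (Zs i \<omega>)"
    have "has_bochner_integral M (\<lambda>\<omega>. (1 / (real n)\<^sup>2) * (?s \<omega> - real n * \<delta> \<mu> \<nu>)\<^sup>2) (1 / (real n)\<^sup>2 * (real n * c \<mu> \<nu>))"
      using design_sum_second_moment[OF cont[of \<mu> \<nu>], of n] unfolding v c_def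
      by (intro has_bochner_integral_mult_right)
    moreover have "(1 / (real n)\<^sup>2) * (?s \<omega> - real n * \<delta> \<mu> \<nu>)\<^sup>2 = (?s \<omega> / real n - \<delta> \<mu> \<nu>)\<^sup>2" for \<omega>
    proof -
      have "?s \<omega> / real n - \<delta> \<mu> \<nu> = (?s \<omega> - real n * \<delta> \<mu> \<nu>) / real n" using n0 by (simp add: diff_divide_distrib)
      then show ?thesis by (simp add: power_divide)
    qed
    moreover have "1 / (real n)\<^sup>2 * (real n * c \<mu> \<nu>) = c \<mu> \<nu> / real n" using n0 by (simp add: power2_eq_square)
    ultimately show ?thesis by simp
  qed
  have "has_bochner_integral M (\<lambda>\<omega>. \<Sum>\<mu><k. \<Sum>\<nu><k. w \<mu> * w \<nu> *
      ((\<Sum>i=1..n. hf \<mu> (Zs i \<omega>) * hf \<nu> (Zs i \<omega>)) / real n - \<delta> \<mu> \<nu>)\<^sup>2)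
      (\<Sum>\<mu><k. \<Sum>\<nu><k. w \<mu> * w \<nu> * (c \<mu> \<nu> / real n))"
    by (intro has_bochner_integral_sum has_bochner_integral_mult_right one)
  moreover have "(\<Sum>\<mu><k. \<Sum>\<nu><k. w \<mu> * w \<nu> * (c \<mu> \<nu> / real n)) \<le> (\<Sum>\<nu><k. w \<nu>)\<^sup>2 * B ^ 4 / real n"
  proof -
    have "(\<Sum>\<mu><k. \<Sum>\<nu><k. w \<mu> * w \<nu> * (c \<mu> \<nu> / real n)) \<le> (\<Sum>\<mu><k. \<Sum>\<nu><k. w \<mu> * w \<nu> * (B ^ 4 / real n))"
      using c_le n0 w by (intro sum_mono mult_left_mono divide_right_mono) auto
    also have "\<dots> = (\<Sum>\<mu><k. \<Sum>\<nu><k. w \<mu> * w \<nu>) * (B ^ 4 / real n)"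
      by (simp only: sum_distrib_right)
    also have "\<dots> = (\<Sum>\<nu><k. w \<nu>)\<^sup>2 * B ^ 4 / real n"
      by (simp add: power2_eq_square sum_product)
    finally show ?thesis .
  qed
  ultimately show thesis by (intro that) (auto simp: \<delta>_def)
qed

lemma sample_measurable:
  assumes "i \<ge> 1"
  shows "Zs i \<in> borel_measurable M" "es i \<in> borel_measurable M"
proof -
  have "obs i \<in> measurable M (borel \<Otimes>\<^sub>M borel)"
    using sample.X_measurable[OF assms] by (simp add: borel_prod)
  from measurable_compose[OF this measurable_fst] measurable_compose[OF this measurable_snd]
  show "Zs i \<in> borel_measurable M" "es i \<in> borel_measurable M" by simp_all
qed

text \<open>
  The maximizer itself need not depend measurably on the sample, but the maximum is the supremum of
  a family of functions that are continuous in the sample. Its superlevel sets are unions of open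
  sets, so it is measurable although the family is uncountable.
\<close>

lemma maximal_penalized_loglik_measurable:
  fixes f :: "real \<Rightarrow> real"
  assumes H: "\<And>g. g \<in> H \<Longrightarrow> continuous_on {0..1} g" and f: "continuous_on {0..1} f"
    and max: "\<And>\<omega>. \<omega> \<in> space M \<Longrightarrow>
      is_arg_max (pen_loglik m lam n (\<lambda>i. Zs i \<omega>) (\<lambda>i. response Zs es f i \<omega>)) (\<lambda>g. g \<in> H) (gh \<omega>)"
  shows "(\<lambda>\<omega>. pen_loglik m lam n (\<lambda>i. Zs i \<omega>) (\<lambda>i. response Zs es f i \<omega>) (gh \<omega>)) \<in> borel_measurable M"
    (is "(\<lambda>\<omega>. ?L \<omega> (gh \<omega>)) \<in> _")
proof (rule borel_measurable_iff_greater[THEN iffD2], rule allI)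
  fix c :: real
  \<comment> \<open>The value at index 0 is fixed because \<open>Zs 0\<close> and \<open>es 0\<close> need not be measurable.\<close>
  define T where "T = (\<lambda>\<omega> i. if i \<ge> 1 then (Zs i \<omega>, response Zs es f i \<omega>) else (0, 0))"
  define \<Phi> where "\<Phi> = (\<lambda>g (p :: nat \<Rightarrow> real \<times> real).
     (1 / real n) * (\<Sum>i=1..n. loglik (snd (p i)) (g (clamp01 (fst (p i))))) - (lam / 2) * penJ m g g)"
  have coord: "(\<lambda>\<omega>. T \<omega> i) \<in> borel_measurable M" for i
  proof (cases "i \<ge> 1")
    case True
    note [measurable] = sample_measurable[OF True]
    have "(\<lambda>x. f (clamp01 x)) \<in> borel_measurable borel"
      by (rule borel_measurable_continuous_onI[OF continuous_on_clamp01[OF f]])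
    from measurable_compose[OF sample_measurable(1)[OF True] this]
    have [measurable]: "(\<lambda>\<omega>. f (Zs i \<omega>)) \<in> borel_measurable M"
      by (rule measurable_cong[THEN iffD1, rotated]) (simp add: clamp01_id[OF Zs_unit[OF True]])
    have "(\<lambda>\<omega>. (Zs i \<omega>, response Zs es f i \<omega>)) \<in> measurable M (borel \<Otimes>\<^sub>M borel)"
      unfolding response_def by measurable
    then show ?thesis using True by (simp add: T_def borel_prod)
  qed (simp add: T_def)
  have T: "T \<in> borel_measurable M"
    by (rule measurable_coordinatewise_then_product) (rule coord)
  have "continuous_on UNIV (\<Phi> g)" if "g \<in> H" for g
  proof -
    note cp = continuous_on_product_coordinates
    have fs: "continuous_on UNIV (\<lambda>p :: nat \<Rightarrow> real \<times> real. fst (p i))" for i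
      by (intro continuous_on_fst cp)
    have "continuous_on UNIV (\<lambda>p :: nat \<Rightarrow> real \<times> real. g (clamp01 (fst (p i))))" for i
      by (rule continuous_on_compose2[OF continuous_on_clamp01[OF H[OF that]] fs]) simp
    then show ?thesis
      unfolding \<Phi>_def loglik_def by (intro continuous_intros continuous_on_snd cp) simp_all
  qed
  then have "open {p. c < \<Phi> g p}" if "g \<in> H" for g
    using that by (intro open_Collect_less) auto
  then have "open (\<Union>g\<in>H. {p. c < \<Phi> g p})" by auto
  then have "T -` (\<Union>g\<in>H. {p. c < \<Phi> g p}) \<inter> space M \<in> sets M"
    using T by (intro measurable_sets) auto
  also have "T -` (\<Union>g\<in>H. {p. c < \<Phi> g p}) \<inter> space M = {\<omega> \<in> space M. c < ?L \<omega> (gh \<omega>)}"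
  proof -
    have L: "\<Phi> g (T \<omega>) = ?L \<omega> g" if "\<omega> \<in> space M" for g \<omega>
      using that by (simp add: \<Phi>_def T_def pen_loglik_def clamp01_id[OF Zs_unit])
    have inH: "gh \<omega> \<in> H" and opt: "c < ?L \<omega> g \<Longrightarrow> g \<in> H \<Longrightarrow> c < ?L \<omega> (gh \<omega>)"
      if "\<omega> \<in> space M" for \<omega> g
      using max[OF that] unfolding is_arg_max_def by (auto simp: not_less intro: less_le_trans)
    have "(\<exists>g\<in>H. c < \<Phi> g (T \<omega>)) \<longleftrightarrow> c < ?L \<omega> (gh \<omega>)" if \<omega>: "\<omega> \<in> space M" for \<omega>
      unfolding L[OF \<omega>] using inH[OF \<omega>] opt[OF \<omega>] by blast
    then show ?thesis by auto
  qed
  finally show "{\<omega> \<in> space M. c < ?L \<omega> (gh \<omega>)} \<in> sets M" .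
qed

lemma penalized_loglik_measurable:
  assumes f: "continuous_on {0..1} f" and g: "continuous_on {0..1} g"
  shows "(\<lambda>\<omega>. pen_loglik m lam n (\<lambda>i. Zs i \<omega>) (\<lambda>i. response Zs es f i \<omega>) g) \<in> borel_measurable M"
  by (rule maximal_penalized_loglik_measurable[where H = "{g}" and gh = "\<lambda>_. g"])
     (use f g in \<open>auto simp: is_arg_max_def\<close>)

end


section \<open>Power at a fixed sample size\<close>

lemma two_abs_le:
  fixes x c :: real
  assumes "c > 0"
  shows "2 * \<bar>x\<bar> \<le> x\<^sup>2 / c + c"
proof -
  have "0 \<le> (\<bar>x\<bar> - c)\<^sup>2" by simp
  then have "2 * \<bar>x\<bar> * c \<le> x\<^sup>2 + c * c" by (simp add: power2_eq_square algebra_simps)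
  then show ?thesis using assms by (simp add: field_simps)
qed

text \<open>
  The size of the likelihood gain once the square of each random deviation is at most \<open>K\<close> times its
  expected order.
  The noise energy \<open>U\<close> deviates from its mean by \<open>h powr (- 1 / 2)\<close> and is itself of order \<open>1 / h\<close>; the Gram
  error \<open>U * sqrt Q\<close> is of order \<open>1 / (sqrt n * h\<^sup>2)\<close>, which \<open>n * h ^ 3 \<ge> 1\<close> turns into \<open>h powr (- 1 / 2)\<close>. The
  empirical energy \<open>G\<close> of the signal keeps half of its mean \<open>n * V\<close>, and the cross term \<open>x\<close> between noise and
  signal consumes at most half of the rest, up to a constant.
\<close>

lemma gain_on_good_event:
  fixes h n K a cA U A V G x y lam Q :: real
  assumes h: "0 < h" "h \<le> 1" and n: "n > 0" and nh: "1 \<le> n * h ^ 3" and K: "K > 0" "4 * K \<le> n"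
    and cA: "0 \<le> cA" "A \<le> cA / h" and U: "0 \<le> U" and V: "0 \<le> V" and lam: "lam > 0" and Q: "0 \<le> Q"
    and 1: "h * (U - A)\<^sup>2 \<le> K" and 2: "n * h\<^sup>2 * Q \<le> K" and 3: "(G - n * V)\<^sup>2 \<le> K * n * V\<^sup>2"
    and 4: "x\<^sup>2 \<le> K * n * V" and 5: "lam * y\<^sup>2 \<le> K * n"
  shows "U - U * sqrt Q + 2 * x + G - 2 * lam * y
    \<ge> A + n * V / 4 - (sqrt K + (cA + sqrt K) * sqrt K + 5 * K) / sqrt h - n * lam"
proof -
  have sh: "sqrt h > 0" "sqrt h \<le> 1" "sqrt h * sqrt h = h" using h by auto
  have sK: "sqrt K > 0" using K by simp
  have "(U - A)\<^sup>2 \<le> K / h" using 1 h by (simp add: field_simps)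
  then have "\<bar>U - A\<bar> \<le> sqrt (K / h)" by (metis real_sqrt_abs real_sqrt_le_mono)
  then have dU: "\<bar>U - A\<bar> \<le> sqrt K / sqrt h" by (simp add: real_sqrt_divide)
  have "sqrt K / sqrt h \<le> sqrt K / h"
    using sh sK h mult_left_mono[OF sh(2), of "sqrt h"] by (intro divide_left_mono) auto
  then have Ub: "U \<le> (cA + sqrt K) / h" using dU cA(2) by (simp add: add_divide_distrib)
  have Qb: "sqrt Q \<le> sqrt K / (sqrt n * h)"
  proof -
    have "Q \<le> K / (n * h\<^sup>2)" using 2 h n by (simp add: field_simps)
    then have "sqrt Q \<le> sqrt (K / (n * h\<^sup>2))" by (rule real_sqrt_le_mono)
    also have "\<dots> = sqrt K / (sqrt n * h)" using h by (simp add: real_sqrt_divide real_sqrt_mult)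
    finally show ?thesis .
  qed
  have UQ: "U * sqrt Q \<le> (cA + sqrt K) * sqrt K / sqrt h"
  proof -
    have "sqrt 1 \<le> sqrt (n * h ^ 3)" using nh by (rule real_sqrt_le_mono)
    also have "h ^ 3 = h\<^sup>2 * h" by (simp add: power2_eq_square power3_eq_cube)
    finally have one: "1 \<le> sqrt n * h * sqrt h" using h by (simp add: real_sqrt_mult)
    have "U * sqrt Q \<le> ((cA + sqrt K) / h) * (sqrt K / (sqrt n * h))"
      using Ub Qb Q h cA sK by (intro mult_mono) auto
    also have "\<dots> = (cA + sqrt K) * sqrt K / (sqrt n * h * h)" by simp
    also have "\<dots> \<le> (cA + sqrt K) * sqrt K / sqrt h"
    proof (rule divide_left_mono)
      have "sqrt h * 1 \<le> sqrt h * (sqrt n * h * sqrt h)" using one sh by (intro mult_left_mono) auto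
      also have "\<dots> = sqrt n * h * h" using sh(3) by (simp add: mult_ac)
      finally show "sqrt h \<le> sqrt n * h * h" by simp
    qed (use cA sK h n sh in auto)
    finally show ?thesis .
  qed
  have Gb: "G \<ge> n * V / 2"
  proof -
    have "K * n * V\<^sup>2 \<le> (n / 4) * n * V\<^sup>2" using K n by (intro mult_right_mono) auto
    also have "(n / 4) * n * V\<^sup>2 = (n * V / 2)\<^sup>2" by (simp add: power2_eq_square)
    finally have "(G - n * V)\<^sup>2 \<le> (n * V / 2)\<^sup>2" using 3 by (rule order_trans[rotated])
    then have "\<bar>G - n * V\<bar> \<le> n * V / 2" using n V by (simp add: abs_le_square_iff[symmetric])
    then show ?thesis by linarith
  qed
  have xb: "2 * \<bar>x\<bar> \<le> n * V / 4 + 4 * K"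
  proof -
    have "2 * \<bar>x\<bar> \<le> x\<^sup>2 / (4 * K) + 4 * K" using K by (intro two_abs_le) auto
    also have "x\<^sup>2 / (4 * K) \<le> (K * n * V) / (4 * K)" using 4 K by (intro divide_right_mono) auto
    also have "\<dots> = n * V / 4" using K by simp
    finally show ?thesis by simp
  qed
  have yb: "2 * lam * y \<le> n * lam + K"
  proof -
    have "2 * lam * y \<le> 2 * \<bar>lam * y\<bar>" by simp
    also have "\<dots> \<le> (lam * y)\<^sup>2 / K + K" using K by (intro two_abs_le) auto
    also have "(lam * y)\<^sup>2 = lam * (lam * y\<^sup>2)" by (simp add: power2_eq_square)
    also have "lam * (lam * y\<^sup>2) / K \<le> lam * (K * n) / K"
      using 5 lam K by (intro divide_right_mono mult_left_mono) auto
    also have "\<dots> = n * lam" using K by simp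
    finally show ?thesis by simp
  qed
  have "5 * K \<le> 5 * K / sqrt h" using K sh by (simp add: field_simps)
  then have "U - U * sqrt Q + 2 * x + G - 2 * lam * y
    \<ge> A + n * V / 4 - (sqrt K / sqrt h + (cA + sqrt K) * sqrt K / sqrt h + 5 * K / sqrt h) - n * lam"
    using dU UQ Gb xb yb by linarith
  then show ?thesis by (simp add: add_divide_distrib)
qed

lemma (in prob_space) Markov_complement:
  assumes X: "has_bochner_integral M X b" and nonneg: "\<And>\<omega>. \<omega> \<in> space M \<Longrightarrow> 0 \<le> X \<omega>"
    and b: "b \<le> c" and K: "K > 0"
  shows "measure M {\<omega> \<in> space M. X \<omega> < K} \<ge> 1 - c / K"
proof -
  have [measurable]: "X \<in> borel_measurable M" using X by (rule borel_measurable_has_bochner_integral)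
  have "measure M {\<omega> \<in> space M. X \<omega> \<ge> K} \<le> expectation X / K"
    using X nonneg K by (intro integral_Markov_inequality_measure[where A = "{}"]) (auto simp: has_bochner_integral_iff)
  also have "\<dots> \<le> c / K" using X b K by (intro divide_right_mono) (auto simp: has_bochner_integral_iff)
  finally have "measure M {\<omega> \<in> space M. X \<omega> \<ge> K} \<le> c / K" .
  moreover have "{\<omega> \<in> space M. X \<omega> < K} = space M - {\<omega> \<in> space M. X \<omega> \<ge> K}" by auto
  ultimately show ?thesis by (simp add: prob_compl)
qed

context regression_model begin

lemma covV_span_self:
  fixes hf :: "nat \<Rightarrow> real \<Rightarrow> real"
  assumes hf: "\<And>\<nu>. continuous_on {0..1} (hf \<nu>)"
    and V: "\<And>\<mu> \<nu>. covV M Z (hf \<mu>) (hf \<nu>) = (if \<mu> = \<nu> then 1 else 0)"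
  shows "covV M Z (\<lambda>x. \<Sum>\<nu><k. c \<nu> * hf \<nu> x) (\<lambda>x. \<Sum>\<nu><k. c \<nu> * hf \<nu> x) = (\<Sum>\<nu><k. (c \<nu>)\<^sup>2)"
proof -
  have "continuous_on {0..1} (\<lambda>x. hf \<mu> x * hf \<nu> x)" for \<mu> \<nu> using hf by (intro continuous_intros)
  then have one: "has_bochner_integral M (\<lambda>\<omega>. hf \<mu> (Z \<omega>) * hf \<nu> (Z \<omega>)) (if \<mu> = \<nu> then 1 else 0)" for \<mu> \<nu>
    using integrable_design[of "\<lambda>x. hf \<mu> x * hf \<nu> x"] V[of \<mu> \<nu>] by (simp add: covV_def has_bochner_integral_iff)
  have "has_bochner_integral M (\<lambda>\<omega>. \<Sum>\<mu><k. \<Sum>\<nu><k. (c \<mu> * c \<nu>) * (hf \<mu> (Z \<omega>) * hf \<nu> (Z \<omega>)))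
     (\<Sum>\<mu><k. \<Sum>\<nu><k. (c \<mu> * c \<nu>) * (if \<mu> = \<nu> then 1 else 0))"
    by (intro has_bochner_integral_sum has_bochner_integral_mult_right one)
  moreover have "(\<Sum>\<mu><k. \<Sum>\<nu><k. (c \<mu> * c \<nu>) * (hf \<mu> z * hf \<nu> z)) = (\<Sum>\<nu><k. c \<nu> * hf \<nu> z) * (\<Sum>\<nu><k. c \<nu> * hf \<nu> z)" for z
    unfolding sum_product by (intro sum.cong refl) (simp add: mult_ac)
  moreover have "(\<Sum>\<mu><k. \<Sum>\<nu><k. (c \<mu> * c \<nu>) * (if \<mu> = \<nu> then 1 else 0)) = (\<Sum>\<mu><k. (c \<mu>)\<^sup>2)"
    by (intro sum.cong refl) (simp add: power2_eq_square if_distrib sum.delta cong: if_cong)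
  ultimately show ?thesis unfolding covV_def by (auto simp: has_bochner_integral_iff)
qed

text \<open>
  The power of the test at a fixed sample size, with constants that depend on \<open>g\<close> only through \<open>\<zeta>\<close>. The
  five random terms in the lower bound for the likelihood gain are collected, each divided by its
  squared scale, in one nonnegative variable \<open>\<Xi>\<close> with expectation at most \<open>c0\<close>, so a single application of
  Markov's inequality controls all of them. The separation condition makes \<open>n * V(g, g)\<close> exceed every
  loss in the bound, all of which are of order \<open>n * lam + h powr (- 1 / 2)\<close>.
\<close>

lemma plrt_power:
  fixes hf :: "nat \<Rightarrow> real \<Rightarrow> real" and \<gamma> :: "nat \<Rightarrow> real" and gh :: "'w \<Rightarrow> real \<Rightarrow> real"
  assumes PS: "penalized_space m H"
    and hf: "\<And>\<nu>. hf \<nu> \<in> H"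
    and bd: "\<And>\<nu> z. z \<in> {0..1} \<Longrightarrow> \<bar>hf \<nu> z\<bar> \<le> B"
    and V: "\<And>\<mu> \<nu>. covV M Z (hf \<mu>) (hf \<nu>) = (if \<mu> = \<nu> then 1 else 0)"
    and J: "\<And>\<mu> \<nu>. penJ m (hf \<mu>) (hf \<nu>) = (if \<mu> = \<nu> then \<gamma> \<mu> else 0)"
    and lam: "lam > 0" and h: "0 < h" "h \<le> 1" and n: "n \<ge> 1" and nh: "1 \<le> real n * h ^ 3"
    and f0: "f0 \<in> H" and W: "is_penalty_operator M Z m H lam W"
    and \<zeta>: "\<zeta> > 0" and g: "g \<in> alternatives M Z m H \<zeta>"
    and max: "\<And>\<omega>. \<omega> \<in> space M \<Longrightarrow> is_arg_max
      (pen_loglik m lam n (\<lambda>i. Zs i \<omega>) (\<lambda>i. response Zs es (\<lambda>t. f0 t + g t) i \<omega>)) (\<lambda>u. u \<in> H) (gh \<omega>)"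
    and sm: "summable (\<lambda>\<nu>. 1 / (1 + lam * \<gamma> \<nu>))" and cA: "(\<Sum>\<nu>. 1 / (1 + lam * \<gamma> \<nu>)) \<le> cA / h"
    and K: "K > 0" "4 * K \<le> real n"
    and c0: "c0 = 2 * cA + cA\<^sup>2 * (B ^ 4 * expectation (\<lambda>\<omega>. e \<omega> ^ 4) + 1) + cA\<^sup>2 * B ^ 4 + \<zeta> + 1
      + (2 * penJ m f0 f0 + 2 * \<zeta>)"
    and c1: "c1 = sqrt K + (cA + sqrt K) * sqrt K + 5 * K + 2 + 3 * penJ m f0 f0 + 3 * \<zeta> + \<bar>t\<bar> * sqrt (2 * cA)"
    and sep: "(pen_norm M Z m lam g)\<^sup>2 \<ge> 4 * c1 * (lam + 1 / (real n * sqrt h))"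
  shows "measure M {\<omega> \<in> space M. plrt_statistic M Z m lam \<gamma> n (\<lambda>i. Zs i \<omega>)
      (\<lambda>i. response Zs es (\<lambda>t. f0 t + g t) i \<omega>) f0 (W f0) (gh \<omega>) > t} \<ge> 1 - c0 / K"
proof -
  interpret penalized_space m H by (rule PS)
  have Hc: "continuous_on {0..1} u" if "u \<in> H" for u
    using sobolev_continuous[OF m2] sobolev that by blast
  have n0: "real n > 0" using n by simp
  have gH: "g \<in> H" and gJ: "penJ m g g \<le> \<zeta>"
    and gV: "variance (\<lambda>\<omega>. (g (Z \<omega>))\<^sup>2) \<le> \<zeta> * (\<integral>\<omega>. (g (Z \<omega>))\<^sup>2 \<partial>M)\<^sup>2"
    using g by (auto simp: alternatives_def)
  define G where "G = (\<lambda>t. f0 t + g t)"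
  have GH: "G \<in> H" unfolding G_def by (rule add[OF f0 gH])
  define JG where "JG = penJ m G G"
  have JG: "JG \<le> 2 * penJ m f0 f0 + 2 * \<zeta>"
    unfolding JG_def G_def using penJ_add_le[OF f0 gH] gJ by linarith
  have J0: "penJ m f0 f0 \<ge> 0" by (rule penJ_nonneg)
  have \<gamma>0: "\<gamma> \<nu> \<ge> 0" for \<nu> using J[of \<nu> \<nu>] penJ_nonneg[of m "hf \<nu>"] by simp
  define w where "w = (\<lambda>\<nu>. 1 / (1 + lam * \<gamma> \<nu>))"
  have w1: "1 \<le> 1 + lam * \<gamma> \<nu>" for \<nu> using lam \<gamma>0 by simp
  have w: "0 \<le> w \<nu>" "w \<nu> \<le> 1" for \<nu> using w1[of \<nu>] by (auto simp: w_def)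
  have wpos: "0 < w \<nu>" for \<nu> using w1[of \<nu>] by (auto simp: w_def)
  define A where "A = (\<Sum>\<nu>. w \<nu>)"
  define A2 where "A2 = (\<Sum>\<nu>. (w \<nu>)\<^sup>2)"
  have sw: "summable w" using sm by (simp add: w_def)
  have A_le: "A \<le> cA / h" using cA by (simp add: A_def w_def)
  have A_pos: "A > 0" unfolding A_def by (rule suminf_pos[OF sw wpos])
  have "0 < cA / h" using A_le A_pos by linarith
  then have cA0: "cA \<ge> 0" using h by (simp add: zero_less_divide_iff)
  have sw2: "summable (\<lambda>\<nu>. (w \<nu>)\<^sup>2)" and A2_le: "A2 \<le> A"
    using summable_square_of_unit_interval[OF w sw] by (auto simp: A_def A2_def)
  have A2_pos: "A2 > 0" unfolding A2_def by (rule suminf_pos[OF sw2]) (use zero_less_power[OF wpos] in blast)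
  \<comment> \<open>Truncation keeps the candidate a finite combination of the \<open>hf \<nu>\<close>, hence in \<open>H\<close>, and costs at most 1
    in the centring.\<close>
  have "(\<lambda>k. \<Sum>\<nu><k. w \<nu>) \<longlonglongrightarrow> A" unfolding A_def by (rule summable_LIMSEQ[OF sw])
  then have "\<forall>\<^sub>F k in sequentially. A - 1 < (\<Sum>\<nu><k. w \<nu>)" by (rule order_tendstoD) simp
  then obtain k where k: "A - 1 < (\<Sum>\<nu><k. w \<nu>)" by (auto simp: eventually_sequentially)
  define Ak where "Ak = (\<Sum>\<nu><k. w \<nu>)"
  have Ak0: "0 \<le> Ak" unfolding Ak_def by (intro sum_nonneg w)
  have AkA: "Ak \<le> A" unfolding Ak_def A_def by (rule sum_le_suminf[OF sw]) (use w in auto)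
  have Ak_le: "Ak \<le> cA / h" using AkA A_le by linarith
  define v where "v = covV M Z g g"
  have v_eq: "v = (\<integral>\<omega>. (g (Z \<omega>))\<^sup>2 \<partial>M)" by (simp add: v_def covV_def power2_eq_square)
  have v0: "v \<ge> 0" by (simp add: v_eq)
  have c1_ge: "c1 \<ge> 1 + \<zeta>" using J0 \<zeta> K cA0 by (simp add: c1)
  have norm_g: "(pen_norm M Z m lam g)\<^sup>2 = v + lam * penJ m g g"
    using v0 lam penJ_nonneg[of m g] by (simp add: pen_norm_def pen_inner_def v_def)
  have v_ge: "v \<ge> (pen_norm M Z m lam g)\<^sup>2 - lam * \<zeta>" using norm_g gJ lam by simp
  \<comment> \<open>The order of the fluctuations of the statistic.\<close>
  define a where "a = 1 / sqrt h"
  have a: "a \<ge> 1" using h by (simp add: a_def)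
  have nsep: "real n * (pen_norm M Z m lam g)\<^sup>2 \<ge> 4 * c1 * (real n * lam + a)"
  proof -
    have "real n * (4 * c1 * (lam + 1 / (real n * sqrt h))) = 4 * c1 * (real n * lam + a)"
      using n0 by (simp add: a_def algebra_simps)
    moreover have "real n * (4 * c1 * (lam + 1 / (real n * sqrt h))) \<le> real n * (pen_norm M Z m lam g)\<^sup>2"
      by (rule mult_left_mono[OF sep]) simp
    ultimately show ?thesis by (simp only:)
  qed
  have nlam: "real n * lam > 0" using n0 lam by simp
  have v_pos: "v > 0"
  proof -
    have "real n * v \<ge> 4 * c1 * (real n * lam + a) - real n * lam * \<zeta>"
      using nsep mult_left_mono[OF v_ge, of "real n"] n0 by (simp add: algebra_simps)
    moreover have "4 * c1 * (real n * lam + a) \<ge> (1 + \<zeta>) * (real n * lam + a)"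
      using c1_ge nlam a \<zeta> by (intro mult_right_mono) auto
    moreover have "(1 + \<zeta>) * (real n * lam + a) > real n * lam * \<zeta>"
      using nlam a \<zeta> by (simp add: algebra_simps add_pos_pos)
    ultimately have "real n * v > 0" by linarith
    then show ?thesis using n0 by (simp add: zero_less_mult_iff)
  qed
  note hfc = Hc[OF hf] and gc = Hc[OF gH]

  define s where "s = (\<lambda>\<nu> \<omega>. \<Sum>i=1..n. es i \<omega> * hf \<nu> (Zs i \<omega>))"
  define U where "U = (\<lambda>\<omega>. (\<Sum>\<nu><k. w \<nu> * (s \<nu> \<omega>)\<^sup>2) / real n)"
  define Q where "Q = (\<lambda>\<omega>. \<Sum>\<mu><k. \<Sum>\<nu><k. w \<mu> * w \<nu> *
      ((\<Sum>i=1..n. hf \<mu> (Zs i \<omega>) * hf \<nu> (Zs i \<omega>)) / real n - (if \<mu> = \<nu> then 1 else 0))\<^sup>2)"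
  define x where "x = (\<lambda>\<omega>. \<Sum>i=1..n. es i \<omega> * g (Zs i \<omega>))"
  define g2 where "g2 = (\<lambda>\<omega>. \<Sum>i=1..n. (g (Zs i \<omega>))\<^sup>2)"
  \<comment> \<open>\<open>y\<close> is \<open>n\<close> times the penalty inner product of \<open>G\<close> and the noise correction.\<close>
  define f where "f = (\<lambda>z. \<Sum>\<nu><k. (w \<nu> * penJ m G (hf \<nu>)) * hf \<nu> z)"
  define y where "y = (\<lambda>\<omega>. \<Sum>i=1..n. es i \<omega> * f (Zs i \<omega>))"
  obtain b1 where b1: "has_bochner_integral M (\<lambda>\<omega>. ((\<Sum>\<nu><k. w \<nu> * (s \<nu> \<omega>)\<^sup>2) - real n * Ak)\<^sup>2) b1"
      "b1 \<le> 2 * (real n)\<^sup>2 * Ak + real n * (Ak\<^sup>2 * (B ^ 4 * expectation (\<lambda>\<omega>. e \<omega> ^ 4) + 1))"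
    unfolding s_def Ak_def by (rule weighted_noise_energy_variance[OF hfc bd V w])
  obtain b2 where b2: "has_bochner_integral M Q b2" "b2 \<le> Ak\<^sup>2 * B ^ 4 / real n"
    unfolding Q_def Ak_def by (rule gram_deviation_moment[OF hfc bd V w(1) n])
  have b3: "has_bochner_integral M (\<lambda>\<omega>. (g2 \<omega> - real n * v)\<^sup>2) (real n * variance (\<lambda>\<omega>. (g (Z \<omega>))\<^sup>2))"
    using design_sum_second_moment[of "\<lambda>z. (g z)\<^sup>2" n] gc unfolding g2_def v_eq
    by (simp add: continuous_on_power)
  have b4: "has_bochner_integral M (\<lambda>\<omega>. (x \<omega>)\<^sup>2) (real n * v)"
    unfolding x_def v_def by (rule noise_sum_second_moment[OF gc])
  have fH: "f \<in> H" unfolding f_def by (rule span(1)[OF hf hf])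
  have b5: "has_bochner_integral M (\<lambda>\<omega>. (y \<omega>)\<^sup>2) (real n * (\<Sum>\<nu><k. (w \<nu> * penJ m G (hf \<nu>))\<^sup>2))"
    using noise_sum_second_moment[OF Hc[OF fH], of n]
    unfolding y_def f_def covV_span_self[OF hfc V] .
  have b5_le: "lam * (\<Sum>\<nu><k. (w \<nu> * penJ m G (hf \<nu>))\<^sup>2) \<le> JG"
    using penalty_bessel[OF hf GH J lam, where k = k] by (simp add: JG_def w_def sum_distrib_left)

  define \<Xi> where "\<Xi> = (\<lambda>\<omega>. h / (real n)\<^sup>2 * ((\<Sum>\<nu><k. w \<nu> * (s \<nu> \<omega>)\<^sup>2) - real n * Ak)\<^sup>2
      + real n * h\<^sup>2 * Q \<omega> + 1 / (real n * v\<^sup>2) * (g2 \<omega> - real n * v)\<^sup>2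
      + 1 / (real n * v) * (x \<omega>)\<^sup>2 + lam / real n * (y \<omega>)\<^sup>2)"
  have XiI: "has_bochner_integral M \<Xi> (h / (real n)\<^sup>2 * b1 + real n * h\<^sup>2 * b2
      + 1 / (real n * v\<^sup>2) * (real n * variance (\<lambda>\<omega>. (g (Z \<omega>))\<^sup>2)) + 1 / (real n * v) * (real n * v)
      + lam / real n * (real n * (\<Sum>\<nu><k. (w \<nu> * penJ m G (hf \<nu>))\<^sup>2)))"
    unfolding \<Xi>_def by (intro has_bochner_integral_add has_bochner_integral_mult_right b1 b2 b3 b4 b5)
  have Ak2: "(h * Ak)\<^sup>2 \<le> cA\<^sup>2" "h * Ak \<le> cA"
  proof -
    show "h * Ak \<le> cA" using Ak_le h by (simp add: field_simps)
    then show "(h * Ak)\<^sup>2 \<le> cA\<^sup>2" using Ak0 h by (intro power_mono) auto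
  qed
  have nh1: "1 \<le> real n * h"
  proof -
    have "h ^ 3 \<le> h ^ 1" using h by (intro power_decreasing) auto
    then have "real n * h ^ 3 \<le> real n * h" using n0 by simp
    then show ?thesis using nh by linarith
  qed
  have B4: "B ^ 4 \<ge> 0" by simp
  have \<kappa>: "expectation (\<lambda>\<omega>. e \<omega> ^ 4) \<ge> 0" by simp
  have e1: "h / (real n)\<^sup>2 * b1 \<le> 2 * cA + cA\<^sup>2 * (B ^ 4 * expectation (\<lambda>\<omega>. e \<omega> ^ 4) + 1)"
  proof -
    let ?c = "B ^ 4 * expectation (\<lambda>\<omega>. e \<omega> ^ 4) + 1"
    have c: "?c \<ge> 0" using B4 \<kappa> by simp
    have "h / (real n)\<^sup>2 * b1 \<le> h / (real n)\<^sup>2 * (2 * (real n)\<^sup>2 * Ak + real n * (Ak\<^sup>2 * ?c))"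
      using b1(2) h by (intro mult_left_mono) auto
    also have "\<dots> = 2 * (h * Ak) + ((h * Ak)\<^sup>2 * ?c) * (1 / (real n * h))"
      using n0 h by (simp add: field_simps power2_eq_square)
    also have "\<dots> \<le> 2 * cA + (cA\<^sup>2 * ?c) * 1"
    proof (intro add_mono mult_left_mono mult_mono Ak2)
      show "1 / (real n * h) \<le> 1" using nh1 by simp
    qed (use c h n0 in auto)
    finally show ?thesis by simp
  qed
  have e2: "real n * h\<^sup>2 * b2 \<le> cA\<^sup>2 * B ^ 4"
  proof -
    have "real n * h\<^sup>2 * b2 \<le> real n * h\<^sup>2 * (Ak\<^sup>2 * B ^ 4 / real n)"
      using b2(2) by (intro mult_left_mono) auto
    also have "\<dots> = (h * Ak)\<^sup>2 * B ^ 4" using n0 by (simp add: power_mult_distrib)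
    also have "\<dots> \<le> cA\<^sup>2 * B ^ 4" using Ak2 B4 by (intro mult_right_mono) auto
    finally show ?thesis .
  qed
  have e3: "1 / (real n * v\<^sup>2) * (real n * variance (\<lambda>\<omega>. (g (Z \<omega>))\<^sup>2)) \<le> \<zeta>"
    using gV n0 v_pos unfolding v_eq[symmetric] by (simp add: field_simps)
  have e4: "1 / (real n * v) * (real n * v) = 1" using n0 v_pos by simp
  have e5: "lam / real n * (real n * (\<Sum>\<nu><k. (w \<nu> * penJ m G (hf \<nu>))\<^sup>2)) \<le> 2 * penJ m f0 f0 + 2 * \<zeta>"
    using b5_le JG n0 by simp
  have U0: "U \<omega> \<ge> 0" for \<omega> unfolding U_def using w n0 by (intro divide_nonneg_nonneg sum_nonneg mult_nonneg_nonneg) auto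
  have Q0: "Q \<omega> \<ge> 0" for \<omega> unfolding Q_def using w by (intro sum_nonneg mult_nonneg_nonneg) auto
  have t1: "h / (real n)\<^sup>2 * ((\<Sum>\<nu><k. w \<nu> * (s \<nu> \<omega>)\<^sup>2) - real n * Ak)\<^sup>2 = h * (U \<omega> - Ak)\<^sup>2" for \<omega>
  proof -
    have "U \<omega> - Ak = ((\<Sum>\<nu><k. w \<nu> * (s \<nu> \<omega>)\<^sup>2) - real n * Ak) / real n"
      using n0 by (simp add: U_def diff_divide_distrib)
    then show ?thesis by (simp add: power_divide)
  qed
  have pos: "0 \<le> h * (U \<omega> - Ak)\<^sup>2" "0 \<le> real n * h\<^sup>2 * Q \<omega>" "0 \<le> 1 / (real n * v\<^sup>2) * (g2 \<omega> - real n * v)\<^sup>2"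
    "0 \<le> 1 / (real n * v) * (x \<omega>)\<^sup>2" "0 \<le> lam / real n * (y \<omega>)\<^sup>2" for \<omega>
    using h Q0[of \<omega>] n0 v_pos lam by simp_all
  have XiP: "measure M {\<omega> \<in> space M. \<Xi> \<omega> < K} \<ge> 1 - c0 / K"
  proof (rule Markov_complement[OF XiI _ _ K(1)])
    show "0 \<le> \<Xi> \<omega>" for \<omega> using pos[of \<omega>] unfolding \<Xi>_def t1 by linarith
    show "h / (real n)\<^sup>2 * b1 + real n * h\<^sup>2 * b2
      + 1 / (real n * v\<^sup>2) * (real n * variance (\<lambda>\<omega>. (g (Z \<omega>))\<^sup>2)) + 1 / (real n * v) * (real n * v)
      + lam / real n * (real n * (\<Sum>\<nu><k. (w \<nu> * penJ m G (hf \<nu>))\<^sup>2)) \<le> c0"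
      unfolding c0 using e1 e2 e3 e4 e5 by linarith
  qed

  let ?resp = "\<lambda>\<omega> i. response Zs es (\<lambda>t. f0 t + g t) i \<omega>"
  let ?T = "\<lambda>\<omega>. plrt_statistic M Z m lam \<gamma> n (\<lambda>i. Zs i \<omega>) (?resp \<omega>) f0 (W f0) (gh \<omega>)"
  have rej: "?T \<omega> > t" if \<omega>: "\<omega> \<in> space M" and Xi: "\<Xi> \<omega> < K" for \<omega>
  proof -
    let ?L = "pen_loglik m lam n (\<lambda>i. Zs i \<omega>) (?resp \<omega>)"
    define P where "P = - 2 * real n * plrt m lam n (\<lambda>i. Zs i \<omega>) (?resp \<omega>) f0 (gh \<omega>)
       - real n * (pen_norm M Z m lam (W f0))\<^sup>2 - A"
    have r: "?resp \<omega> = (\<lambda>i. (f0 (Zs i \<omega>) + g (Zs i \<omega>)) + es i \<omega>)"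
      by (simp add: response_def)
    define S where "S = (\<lambda>t. \<Sum>\<nu><k. (w \<nu> * s \<nu> \<omega> / real n) * hf \<nu> t)"
    have SH: "S \<in> H" unfolding S_def by (rule span(1)[OF hf hf])
    have cand: "(\<lambda>t. (f0 t + g t) + S t) \<in> H" by (rule add[OF add[OF f0 gH] SH])
    have opt: "?L (\<lambda>t. (f0 t + g t) + S t) \<le> ?L (gh \<omega>)"
      using max[OF \<omega>] cand unfolding is_arg_max_def by (meson not_less)
    have gain: "2 * real n * (?L (\<lambda>t. (f0 t + g t) + S t) - ?L f0)
      \<ge> U \<omega> - U \<omega> * sqrt (Q \<omega>) + 2 * x \<omega> + g2 \<omega> - real n * lam * JG - 2 * lam * y \<omega>"
      using loglik_gain[OF hf f0 gH J lam n, where e = "\<lambda>i. es i \<omega>" and z = "\<lambda>i. Zs i \<omega>" and k = k]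
      unfolding r S_def U_def Q_def x_def g2_def JG_def y_def f_def s_def G_def w_def .
    have 1: "h * (U \<omega> - Ak)\<^sup>2 \<le> K" and 2: "real n * h\<^sup>2 * Q \<omega> \<le> K"
      and 3: "1 / (real n * v\<^sup>2) * (g2 \<omega> - real n * v)\<^sup>2 \<le> K"
      and 4: "1 / (real n * v) * (x \<omega>)\<^sup>2 \<le> K" and 5: "lam / real n * (y \<omega>)\<^sup>2 \<le> K"
      using Xi pos[of \<omega>] unfolding \<Xi>_def t1 by linarith+
    have 3: "(g2 \<omega> - real n * v)\<^sup>2 \<le> K * real n * v\<^sup>2" using 3 n0 v_pos by (simp add: field_simps)
    have 4: "(x \<omega>)\<^sup>2 \<le> K * real n * v" using 4 n0 v_pos by (simp add: field_simps)
    have 5: "lam * (y \<omega>)\<^sup>2 \<le> K * real n" using 5 n0 by (simp add: field_simps)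
    let ?c = "sqrt K + (cA + sqrt K) * sqrt K + 5 * K"
    have good: "U \<omega> - U \<omega> * sqrt (Q \<omega>) + 2 * x \<omega> + g2 \<omega> - 2 * lam * y \<omega>
       \<ge> Ak + real n * v / 4 - ?c / sqrt h - real n * lam"
      by (rule gain_on_good_event[OF h n0 nh K cA0 Ak_le U0 v0 lam Q0 1 2 3 4 5])
    have W2: "real n * (pen_norm M Z m lam (W f0))\<^sup>2 \<le> real n * lam * penJ m f0 f0"
      using mult_left_mono[OF penalty_operator_norm_le[OF W f0 lam], of "real n"] n0 by (simp add: mult_ac)
    have JGn: "real n * lam * JG \<le> real n * lam * (2 * penJ m f0 f0 + 2 * \<zeta>)"
      using JG nlam by (intro mult_left_mono) auto
    have vn: "real n * v \<ge> 4 * c1 * (real n * lam + a) - real n * lam * \<zeta>"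
      using nsep mult_left_mono[OF v_ge, of "real n"] n0 by (simp add: algebra_simps)
    have "- 2 * real n * plrt m lam n (\<lambda>i. Zs i \<omega>) (?resp \<omega>) f0 (gh \<omega>) = 2 * real n * (?L (gh \<omega>) - ?L f0)"
      by (simp add: plrt_def algebra_simps)
    also have "\<dots> \<ge> 2 * real n * (?L (\<lambda>t. (f0 t + g t) + S t) - ?L f0)"
      using opt n0 by (intro mult_left_mono) auto
    finally have 0: "P \<ge> Ak - A + real n * v / 4 - ?c * a - real n * lam
        - real n * lam * (2 * penJ m f0 f0 + 2 * \<zeta>) - real n * lam * penJ m f0 f0"
      unfolding P_def using gain good W2 JGn by (simp add: a_def)
    have P1: "P \<ge> c1 * (real n * lam + a) - 1 - ?c * a
        - real n * lam * (1 + 3 * penJ m f0 f0 + 3 * \<zeta>)"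
    proof -
      have "real n * lam * (1 + 3 * penJ m f0 f0 + 3 * \<zeta>) = real n * lam
          + real n * lam * (2 * penJ m f0 f0 + 2 * \<zeta>) + real n * lam * penJ m f0 f0 + real n * lam * \<zeta>"
        by (simp add: algebra_simps)
      moreover have "real n * v \<ge> 4 * (c1 * (real n * lam + a)) - real n * lam * \<zeta>"
        using vn by (simp only: mult.assoc)
      moreover have "real n * lam * \<zeta> \<ge> 0" using nlam \<zeta> by simp
      moreover have "A - 1 < Ak" using k by (simp add: Ak_def)
      ultimately show ?thesis using 0 by linarith
    qed
    define E where "E = real n * lam + a"
    have P2: "P > (\<bar>t\<bar> * sqrt (2 * cA)) * a"
    proof -
      have Ea: "a \<le> E" "real n * lam \<le> E" "1 \<le> E" using nlam a by (auto simp: E_def)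
      have c_nn: "0 \<le> ?c" "0 \<le> 1 + 3 * penJ m f0 f0 + 3 * \<zeta>" using K cA0 J0 \<zeta> by auto
      define d where "d = \<bar>t\<bar> * sqrt (2 * cA)"
      have d0: "d \<ge> 0" using cA0 by (simp add: d_def)
      have "c1 * E = ?c * E + (1 + 3 * penJ m f0 f0 + 3 * \<zeta>) * E + E + d * E"
        unfolding c1 d_def by (simp add: algebra_simps)
      moreover have "?c * a \<le> ?c * E" using Ea c_nn by (intro mult_left_mono)
      moreover have "real n * lam * (1 + 3 * penJ m f0 f0 + 3 * \<zeta>) + a * (1 + 3 * penJ m f0 f0 + 3 * \<zeta>) = (1 + 3 * penJ m f0 f0 + 3 * \<zeta>) * E"
        by (simp add: E_def algebra_simps)
      moreover have "a * (1 + 3 * penJ m f0 f0 + 3 * \<zeta>) > 0" using a J0 \<zeta> by (intro mult_pos_pos) auto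
      moreover have "d * a \<le> d * E" using Ea d0 by (intro mult_left_mono)
      ultimately show ?thesis using P1 Ea(3) unfolding E_def[symmetric] d_def[symmetric] by linarith
    qed
    have sq: "sqrt (2 * A2) \<le> sqrt (2 * cA) * a"
    proof -
      have "sqrt (2 * A2) \<le> sqrt (2 * (cA / h))" using A2_le A_le by simp
      then show ?thesis by (simp add: a_def real_sqrt_mult real_sqrt_divide)
    qed
    have "t * sqrt (2 * A2) \<le> \<bar>t\<bar> * sqrt (2 * A2)" using A2_pos by (intro mult_right_mono) auto
    also have "\<dots> \<le> \<bar>t\<bar> * (sqrt (2 * cA) * a)" using sq by (intro mult_left_mono) auto
    also have "\<dots> < P" using P2 by (simp add: mult.assoc)
    finally have "t < P / sqrt (2 * A2)" using A2_pos by (simp add: pos_less_divide_eq)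
    then show ?thesis
      unfolding plrt_statistic_standardized[OF lam \<gamma>0 sm] P_def A_def A2_def w_def .
  qed
  have meas: "{\<omega> \<in> space M. ?T \<omega> > t} \<in> sets M"
  proof -
    have m1: "(\<lambda>\<omega>. pen_loglik m lam n (\<lambda>i. Zs i \<omega>) (?resp \<omega>) (gh \<omega>)) \<in> borel_measurable M"
      by (rule maximal_penalized_loglik_measurable[OF Hc Hc[OF add[OF f0 gH]] max])
    have m2: "(\<lambda>\<omega>. pen_loglik m lam n (\<lambda>i. Zs i \<omega>) (?resp \<omega>) f0) \<in> borel_measurable M"
      by (rule penalized_loglik_measurable[OF Hc[OF add[OF f0 gH]] Hc[OF f0]])
    have "?T \<in> borel_measurable M"
      unfolding plrt_statistic_def plrt_def using m1 m2 by measurable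
    then show ?thesis by measurable
  qed
  have "{\<omega> \<in> space M. \<Xi> \<omega> < K} \<subseteq> {\<omega> \<in> space M. ?T \<omega> > t}" using rej by blast
  from finite_measure_mono[OF this meas] show ?thesis using XiP by linarith
qed

end


section \<open>Uniform power and the optimal bandwidth\<close>

theorem theorem5p4:
  fixes M :: "'w measure" and Z e :: "'w \<Rightarrow> real" and Zs es :: "nat \<Rightarrow> 'w \<Rightarrow> real"
    and m :: nat and H :: "(real \<Rightarrow> real) set"
    and lam h \<eta> :: "nat \<Rightarrow> real" and d \<zeta> \<alpha> :: real
    and hf :: "nat \<Rightarrow> real \<Rightarrow> real" and \<gamma> :: "nat \<Rightarrow> real"
    and g0 :: "real \<Rightarrow> real"
    and W :: "nat \<Rightarrow> (real \<Rightarrow> real) \<Rightarrow> real \<Rightarrow> real"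
    and ghat :: "nat \<Rightarrow> (nat \<Rightarrow> real) \<Rightarrow> (nat \<Rightarrow> real) \<Rightarrow> real \<Rightarrow> real"
  assumes model: "regression_model M Z e Zs es"
    and H: "H = sobolev m \<or> H = sobolev_periodic m"
    and m: "real m > (3 + sqrt 5) / 4"
    and lam_pos: "\<And>n. lam n > 0"
    and h_def: "\<And>n. h n = bandwidth m (lam n)"
    and h_order: "same_order h (\<lambda>n. real n powr (- d))"
    and d_range: "1 / (2 * real m + 1) \<le> d" "d < 2 * real m / (8 * real m - 1)"
    and hf_in: "\<And>\<nu>. hf \<nu> \<in> H"
    and hf_bounded: "\<exists>B. \<forall>\<nu>. \<forall>z\<in>{0..1}. \<bar>hf \<nu> z\<bar> \<le> B"
    and \<gamma>_mono: "mono \<gamma>"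
    and \<gamma>_order: "same_order \<gamma> (\<lambda>\<nu>. real \<nu> ^ (2 * m))"
    and hf_V: "\<And>\<mu> \<nu>. covV M Z (hf \<mu>) (hf \<nu>) = (if \<mu> = \<nu> then 1 else 0)"
    and hf_J: "\<And>\<mu> \<nu>. penJ m (hf \<mu>) (hf \<nu>) = (if \<mu> = \<nu> then \<gamma> \<mu> else 0)"
    and hf_expansion: "\<And>g n. g \<in> H \<Longrightarrow>
      (\<lambda>k. pen_norm M Z m (lam n) (\<lambda>z. g z - (\<Sum>\<nu><k. covV M Z g (hf \<nu>) * hf \<nu> z))) \<longlonglongrightarrow> 0"
    and W: "\<And>n. is_penalty_operator M Z m H (lam n) (W n)"
    and ghat: "\<And>n z y. n \<ge> 1 \<Longrightarrow> (\<forall>i\<in>{1..n}. z i \<in> {0..1}) \<Longrightarrow>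
      is_arg_max (pen_loglik m (lam n) n z y) (\<lambda>g. g \<in> H) (ghat n z y)"
    and \<zeta>: "\<zeta> > 0"
    and g0: "g0 \<in> H"
    and \<alpha>: "0 < \<alpha>" "\<alpha> < 1"
    and rate: "\<And>\<delta>'. \<delta>' > 0 \<Longrightarrow> \<exists>C' N'. \<forall>n\<ge>N'. \<forall>g\<in>alternatives M Z m H \<zeta>.
      measure M {\<omega> \<in> space M.
        pen_norm M Z m (lam n)
          (\<lambda>x. ghat n (\<lambda>i. Zs i \<omega>) (\<lambda>i. response Zs es (\<lambda>t. g0 t + g t) i \<omega>) x - (g0 x + g x))
        \<le> C' * est_rate m n (h n)} \<ge> 1 - \<delta>'"
    and \<eta>: "\<And>n. n \<ge> 1 \<Longrightarrow> \<eta> n \<ge> separation_bound m n (h n)"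
  shows "(\<forall>\<delta>. 0 < \<delta> \<and> \<delta> < 1 \<longrightarrow> (\<exists>C>0. \<exists>N>0. \<forall>n\<ge>N.
            \<forall>g\<in>alternatives M Z m H \<zeta>. pen_norm M Z m (lam n) g \<ge> C * \<eta> n \<longrightarrow>
              measure M {\<omega> \<in> space M.
                plrt_statistic M Z m (lam n) \<gamma> n
                  (\<lambda>i. Zs i \<omega>) (\<lambda>i. response Zs es (\<lambda>t. g0 t + g t) i \<omega>) g0 (W n g0)
                  (ghat n (\<lambda>i. Zs i \<omega>) (\<lambda>i. response Zs es (\<lambda>t. g0 t + g t) i \<omega>))
                > upper_normal_quantile \<alpha>} \<ge> 1 - \<delta>))
    \<and> (\<forall>n\<ge>1. \<forall>b>0. minimax_rate m n \<le> separation_bound m n b)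
    \<and> same_order (\<lambda>n. separation_bound m n (optimal_bandwidth m n)) (minimax_rate m)
    \<and> 1 / (2 * real m + 1) \<le> 2 / (4 * real m + 1)
    \<and> 2 / (4 * real m + 1) < 2 * real m / (8 * real m - 1)"
proof -
  interpret regression_model M Z e Zs es by (rule model)
  have m2: "m \<ge> 2"
  proof -
    have "1 \<le> sqrt (5::real)" by simp
    then have "4 < 4 * real m" using m by argo
    then show ?thesis by simp
  qed
  have PS: "penalized_space m H"
    using sobolev_spaces_closed[of m H] H m2 by (intro penalized_space.intro) auto
  have h_pos: "h n > 0" for n using h_def lam_pos bandwidth_pos by simp
  have lam_h: "h n ^ (2 * m) = lam n" for n
    using bandwidth_power[of m "lam n"] m2 lam_pos h_def by simp
  have "2 * real m / (8 * real m - 1) < 1 / 3" using m2 by (simp add: field_simps)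
  then have d: "0 < d" "d < 1 / 3" using d_range by (auto intro: less_le_trans[of 0 "1 / (2 * real m + 1)"])
  have \<gamma>0: "\<gamma> \<nu> \<ge> 0" for \<nu> using hf_J[of \<nu> \<nu>] penJ_nonneg[of m "hf \<nu>"] by simp
  have m1: "m \<ge> 1" using m2 by simp
  obtain cA where cA: "cA > 0" "\<forall>h. 0 < h \<longrightarrow> h \<le> 1 \<longrightarrow>
      summable (\<lambda>\<nu>. 1 / (1 + h ^ (2 * m) * \<gamma> \<nu>)) \<and> (\<Sum>\<nu>. 1 / (1 + h ^ (2 * m) * \<gamma> \<nu>)) \<le> cA / h"
    using smoothing_weights_bound[OF m1 \<gamma>0 \<gamma>_order] by metis
  obtain B where B: "\<And>\<nu> z. z \<in> {0..1} \<Longrightarrow> \<bar>hf \<nu> z\<bar> \<le> B" using hf_bounded by blast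
  have power: "\<exists>C>0. \<exists>N>0. \<forall>n\<ge>N. \<forall>g\<in>alternatives M Z m H \<zeta>. pen_norm M Z m (lam n) g \<ge> C * \<eta> n \<longrightarrow>
              measure M {\<omega> \<in> space M.
                plrt_statistic M Z m (lam n) \<gamma> n
                  (\<lambda>i. Zs i \<omega>) (\<lambda>i. response Zs es (\<lambda>t. g0 t + g t) i \<omega>) g0 (W n g0)
                  (ghat n (\<lambda>i. Zs i \<omega>) (\<lambda>i. response Zs es (\<lambda>t. g0 t + g t) i \<omega>))
                > upper_normal_quantile \<alpha>} \<ge> 1 - \<delta>" if \<delta>: "0 < \<delta>" for \<delta>
  proof -
    define t where "t = upper_normal_quantile \<alpha>"
    define c0 where "c0 = 2 * cA + cA\<^sup>2 * (B ^ 4 * expectation (\<lambda>\<omega>. e \<omega> ^ 4) + 1) + cA\<^sup>2 * B ^ 4 + \<zeta> + 1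
      + (2 * penJ m g0 g0 + 2 * \<zeta>)"
    have "B ^ 4 \<ge> 0" "expectation (\<lambda>\<omega>. e \<omega> ^ 4) \<ge> 0" "penJ m g0 g0 \<ge> 0" by (simp_all add: penJ_nonneg)
    then have c0: "c0 > 0" unfolding c0_def using cA(1) \<zeta> by (intro add_pos_nonneg add_nonneg_nonneg mult_nonneg_nonneg) auto
    \<comment> \<open>Markov's inequality with threshold \<open>K\<close> then leaves an exceptional event of probability at most \<open>\<delta>\<close>.\<close>
    define K where "K = c0 / \<delta>"
    have K: "K > 0" "c0 / K = \<delta>" using c0 \<delta> by (auto simp: K_def)
    define c1 where "c1 = sqrt K + (cA + sqrt K) * sqrt K + 5 * K + 2 + 3 * penJ m g0 g0 + 3 * \<zeta> + \<bar>t\<bar> * sqrt (2 * cA)"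
    have c1: "c1 > 0" unfolding c1_def using K cA(1) \<zeta> penJ_nonneg[of m g0]
      by (intro add_pos_nonneg add_nonneg_nonneg mult_nonneg_nonneg) auto
    have "\<forall>\<^sub>F n in sequentially. real n \<ge> 4 * K" by real_asymp
    with bandwidth_asymptotics[OF h_order d] eventually_ge_at_top[of "1::nat"]
    have "\<forall>\<^sub>F n in sequentially. h n \<le> 1 \<and> 1 \<le> real n * h n ^ 3 \<and> 4 * K \<le> real n \<and> n \<ge> 1"
      by eventually_elim auto
    then obtain N0 where N0: "\<And>n. n \<ge> N0 \<Longrightarrow> h n \<le> 1 \<and> 1 \<le> real n * h n ^ 3 \<and> 4 * K \<le> real n \<and> n \<ge> 1"
      by (auto simp: eventually_sequentially)
    show ?thesis
    proof (intro exI conjI allI impI ballI)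
      \<comment> \<open>With \<open>C = 2 * sqrt c1\<close> the squared separation \<open>(C * \<eta> n)\<^sup>2\<close> is at least \<open>4 * c1\<close> times the squared bound.\<close>
      show "2 * sqrt c1 > 0" using c1 by simp
      show "Suc N0 > 0" by simp
      fix n g assume n: "n \<ge> Suc N0" and g: "g \<in> alternatives M Z m H \<zeta>"
        and sep: "pen_norm M Z m (lam n) g \<ge> 2 * sqrt c1 * \<eta> n"
      from N0[of n] n have nn: "h n \<le> 1" "1 \<le> real n * h n ^ 3" "4 * K \<le> real n" "n \<ge> 1" by auto
      have sb: "(separation_bound m n (h n))\<^sup>2 = lam n + 1 / (real n * sqrt (h n))"
        using h_pos[of n] lam_pos[of n] nn(4)
        by (simp add: separation_bound_def lam_h powr_half_sqrt)
      have sb0: "separation_bound m n (h n) \<ge> 0"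
        using h_pos[of n] by (simp add: separation_bound_def)
      have "2 * sqrt c1 * separation_bound m n (h n) \<le> pen_norm M Z m (lam n) g"
        using order_trans[OF mult_left_mono[OF \<eta>[OF nn(4)], of "2 * sqrt c1"] sep] c1 by simp
      then have "(2 * sqrt c1 * separation_bound m n (h n))\<^sup>2 \<le> (pen_norm M Z m (lam n) g)\<^sup>2"
        using sb0 c1 by (intro power_mono) auto
      then have sep2: "4 * c1 * (lam n + 1 / (real n * sqrt (h n))) \<le> (pen_norm M Z m (lam n) g)\<^sup>2"
        using c1 by (simp add: power_mult_distrib sb)
      have max: "is_arg_max (pen_loglik m (lam n) n (\<lambda>i. Zs i \<omega>) (\<lambda>i. response Zs es (\<lambda>t. g0 t + g t) i \<omega>)) (\<lambda>u. u \<in> H)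
          (ghat n (\<lambda>i. Zs i \<omega>) (\<lambda>i. response Zs es (\<lambda>t. g0 t + g t) i \<omega>))" if "\<omega> \<in> space M" for \<omega>
        using that Zs_unit by (intro ghat nn(4)) auto
      have "summable (\<lambda>\<nu>. 1 / (1 + lam n * \<gamma> \<nu>))" "(\<Sum>\<nu>. 1 / (1 + lam n * \<gamma> \<nu>)) \<le> cA / h n"
        using cA(2)[rule_format, OF h_pos[of n] nn(1)] by (simp_all add: lam_h)
      from plrt_power[OF PS hf_in B hf_V hf_J lam_pos h_pos nn(1,4,2) g0 W \<zeta> g max this K(1) nn(3) c0_def c1_def sep2]
      show "measure M {\<omega> \<in> space M.
                plrt_statistic M Z m (lam n) \<gamma> n
                  (\<lambda>i. Zs i \<omega>) (\<lambda>i. response Zs es (\<lambda>t. g0 t + g t) i \<omega>) g0 (W n g0)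
                  (ghat n (\<lambda>i. Zs i \<omega>) (\<lambda>i. response Zs es (\<lambda>t. g0 t + g t) i \<omega>))
                > upper_normal_quantile \<alpha>} \<ge> 1 - \<delta>"
        unfolding K(2) t_def by simp
    qed
  qed
  show ?thesis
    using power minimax_rate_le_separation_bound same_order_separation_bound_optimal
      optimal_exponent_admissible[OF m2]
    by (intro conjI allI impI) auto
qed

end
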